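(* The following (partial) functionals are all computationally equivalent modulo $\exists^{2}$, i.e. any one of them, together with $\exists^{2}$, computes (via Kleene's S1–S9) any other: (a) A strong Cantor realiser. (b) A functional that on input regulated $f:[0,1]\to\mathbb{R}$ outputs $a,b\in[0,1]$ such that $\{x\in[0,1]: f(a)\le f(x)\le f(b)\}$ is infinite. (c) A functional that on input regulated $f:[0,1]\to\mathbb{R}$ outputs $y\in[0,1]$ where $f$ is continuous. (d) A functional that on input regulated $f:[0,1]\to\mathbb{R}$ outputs $y\in[0,1]$ where $f$ is quasi-continuous; likewise, a functional that outputs $y\in[0,1]$ where $f$ is lower semi-continuous; likewise, a functional that outputs $y\in[0,1]$ which is a Darboux point of $f$ (each of these three is equivalent to the others in the list). (e) A density functional that on input regulated $f:[0,1]\to\mathbb{R}$, $x\in[0,1]$ and $k\in\mathbb{N}$ outputs $y\in[0,1]\cap B(x,2^{-k})$ such that $f$ is continuous at $y$. (f) A functional that on input regulated $f:[0,1]\to\mathbb{R}$ outputs either $q\in\mathbb{Q}\cap[0,1]$ where $f$ is discontinuous, or $x\in[0,1]\setminus\mathbb{Q}$ where $f$ is continuous. (g) A functional that on input regulated $f,g:[0,1]\to\mathbb{R}$ outputs $x\in[0,1]$ such that $f$ and $g$ are both continuous at $x$ or both discontinuous at $x$. (h) A functional that on input regulated $f,g:[0,1]\to\mathbb{R}$ and a dense set $D\subset[0,1]$ that is weakly countable (together with a height for it), or countable, or strongly countable, outputs either $d\in D\cap[0,1]$ where $f$ is discontinuous, or $x\in[0,1]\setminus D$ where $f$ is continuous.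 (i) A functional that on input regulated $f:[0,1]\to[0,1]$ with Riemann integral $\int_{0}^{1}f(x)\,dx=0$ outputs $x\in[0,1]$ with $f(x)=0$. (j) A functional that on input regulated $f:[0,1]\to\mathbb{R}$ outputs $y\in(0,1)$ where $F(x):=\int_{0}^{x}f(t)\,dt$ is differentiable with $F'(y)=f(y)$. (k) A functional that on input regulated $f:[0,1]\to\mathbb{R}$ with only removable discontinuities outputs $x\in[0,1]$ which is not a strict local maximum of $f$.
   Context: Computability is Kleene's higher-order computability given by the schemes S1–S9. Kleene's $\exists^{2}$ is the functional $\varphi:\mathbb{N}^{\mathbb{N}}\to\{0,1\}$ with $\varphi(f)=0\iff(\exists n)(f(n)=0)$. Reals are represented by fast-converging Cauchy sequences of rationals, functions $\mathbb{R}\to\mathbb{R}$ by extensional type-$(1\to1)$ maps, and subsets of $\mathbb{R}$ by characteristic functions. The functionals listed are partial: they need only give the specified output on inputs meeting the specification. A set $A\subset\mathbb{R}$ is weakly countable if there is a height $H:\mathbb{R}\to\mathbb{N}$ for $A$, i.e. for every $n$ the set $\{x\in A:H(x)<n\}$ is finite; functionals on weakly countable sets take both $A$ and $H$ as input. $A$ is countable if there is $Y:\mathbb{R}\to\mathbb{N}$ injective on $A$, and strongly countable if moreover $Y$ is surjective onto $\mathbb{N}$ when restricted to $A$ (such $Y$ is also an input). A strong Cantor realiser is a functional that on input $A\subset[0,1]$ and a height $H$ for $A$ outputs some $y\in[0,1]\setminus A$. $f:[0,1]\to\mathbb{R}$ is regulated if for every $x_{0}$ the left limit $f(x_{0}-)$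 and right limit $f(x_{0}+)$ exist (one-sided at the endpoints). $f$ is lower semi-continuous at $x_{0}$ if $f(x_{0})\le\liminf_{x\to x_{0}}f(x)$. $f$ is quasi-continuous at $x_{0}$ if for every $\varepsilon>0$ and open neighbourhood $U$ of $x_{0}$ there is a non-empty open $G\subset U$ with $|f(x_{0})-f(x)|<\varepsilon$ for all $x\in G$. A real $y$ is a left (resp. right) cluster value of $f$ at $x$ if $y=\lim_{n}f(x_{n})$ for some sequence $x_{n}\to x$ with $x_{n}\le x$ (resp. $x_{n}\ge x$) for all $n$. A point $x$ is a Darboux point of $f$ if for every $\delta>0$, every left (resp. right) cluster value $y$ of $f$ at $x$ and every $z$ strictly between $y$ and $f(x)$, there is $w\in(x-\delta,x)$ (resp. $w\in(x,x+\delta)$) with $f(w)=z$. A point $x$ is a strict local maximum of $f$ if there is $N\in\mathbb{N}$ with $f(y)<f(x)$ for all $y\in B(x,2^{-N})$, $y\neq x$. $B(x,r)$ denotes the open ball of radius $r$ around $x$. *)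

theory Defs
  imports "HOL-Analysis.Analysis" "HOL-Library.Nat_Bijection" "HOL-Library.Countable"
begin

section \<open>Kleene's schemes S1--S9\<close>

text \<open>
  Total objects of types 0, 1, 2 and 1 \<open>\<rightarrow>\<close> 1 (curried: a type-1 argument and a number are mapped to
  a number), i.e. the possible inputs of the functionals considered below.
\<close>

datatype obj =
    Ty0 nat
  | Ty1 "nat \<Rightarrow> nat"
  | Ty2 "(nat \<Rightarrow> nat) \<Rightarrow> nat"
  | Ty11 "(nat \<Rightarrow> nat) \<Rightarrow> nat \<Rightarrow> nat"

text \<open>
  A partial functional of type at most 3. Finite types are in curried form, so that a functional
  with values in the sequences takes a number (the place in the sequence) as its last argument.
\<close>

type_synonym functional = "obj list \<Rightarrow> nat option"

datatype arg = Obj obj | Fnl functional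

text \<open>Application of arguments of type at least 2; type 1 is the subject of the separate scheme S7.\<close>

fun app :: "arg \<Rightarrow> obj list \<Rightarrow> nat option" where
  "app (Obj (Ty2 F)) [Ty1 f] = Some (F f)"
| "app (Obj (Ty11 F)) [Ty1 f, Ty0 n] = Some (F f n)"
| "app (Fnl \<Phi>) xs = \<Phi> xs"
| "app _ _ = None"

text \<open>
  \<open>kleene e args n\<close> is \<open>{e}(args) \<simeq> n\<close>. As usual, all finite types are treated (rather than only the pure
  ones) and the arguments form a single list, of which S6 moves any entry to the front; indices are
  codes of lists and do not carry the types of the arguments.

  \<open>kabs c args x\<close> says that \<open>x\<close> is the object \<open>\<lambda>\<sigma>. {d}(\<sigma>, args)\<close>, where \<open>c\<close> codes \<open>d\<close> and the
  type of \<open>x\<close>; in particular this abstraction is total. With it, S8 reads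
  \<open>\<alpha>(\<lambda>\<sigma>\<^sub>1. {d\<^sub>1}(\<sigma>\<^sub>1, \<alpha>, args), ..., \<lambda>\<sigma>\<^sub>m. {d\<^sub>m}(\<sigma>\<^sub>m, \<alpha>, args))\<close>, which is defined only if all
  the abstractions are total and the (possibly partial) \<open>\<alpha>\<close> is defined on them.
\<close>

inductive kleene :: "nat \<Rightarrow> arg list \<Rightarrow> nat \<Rightarrow> bool"
  and kabs :: "nat \<Rightarrow> arg list \<Rightarrow> obj \<Rightarrow> bool"
where
  S1: "kleene (list_encode [1]) (Obj (Ty0 n) # args) (Suc n)"
| S2: "kleene (list_encode [2, q]) args q"
| S3: "kleene (list_encode [3]) (Obj (Ty0 n) # args) n"
| S4: "kleene d args m \<Longrightarrow> kleene c (Obj (Ty0 m) # args) n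
       \<Longrightarrow> kleene (list_encode [4, c, d]) args n"
| S5_0: "kleene c args n \<Longrightarrow> kleene (list_encode [5, c, d]) (Obj (Ty0 0) # args) n"
| S5_Suc: "kleene (list_encode [5, c, d]) (Obj (Ty0 m) # args) k
       \<Longrightarrow> kleene d (Obj (Ty0 m) # Obj (Ty0 k) # args) n
       \<Longrightarrow> kleene (list_encode [5, c, d]) (Obj (Ty0 (Suc m)) # args) n"
| S6: "k < length args \<Longrightarrow> kleene c (args ! k # take k args @ drop (Suc k) args) n
       \<Longrightarrow> kleene (list_encode [6, k, c]) args n"
| S7: "kleene (list_encode [7]) (Obj (Ty1 f) # Obj (Ty0 n) # args) (f n)"
| S8: "length xs = length ds \<Longrightarrow> (\<And>i. i < length ds \<Longrightarrow> kabs (ds ! i) (\<alpha> # args) (xs ! i))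
       \<Longrightarrow> app \<alpha> xs = Some n \<Longrightarrow> kleene (list_encode (8 # ds)) (\<alpha> # args) n"
| S9: "m \<le> length args \<Longrightarrow> kleene c (take m args) n
       \<Longrightarrow> kleene (list_encode [9, m]) (Obj (Ty0 c) # args) n"
| abs0: "kleene d args n \<Longrightarrow> kabs (prod_encode (0, d)) args (Ty0 n)"
| abs1: "(\<And>m. kleene d (Obj (Ty0 m) # args) (f m)) \<Longrightarrow> kabs (prod_encode (1, d)) args (Ty1 f)"
| abs2: "(\<And>f. kleene d (Obj (Ty1 f) # args) (F f)) \<Longrightarrow> kabs (prod_encode (2, d)) args (Ty2 F)"
| abs11: "(\<And>f m. kleene d (Obj (Ty1 f) # Obj (Ty0 m) # args) (F f m))
       \<Longrightarrow> kabs (prod_encode (3, d)) args (Ty11 F)"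


lemma kleene_unique:
  shows "kleene e a n \<Longrightarrow> (\<And>m. kleene e a m \<Longrightarrow> m = n)"
    and "kabs e a x \<Longrightarrow> (\<And>y. kabs e a y \<Longrightarrow> y = x)"
proof (induction rule: kleene_kabs.inducts)
  case (S8 xs ds \<alpha> args n)
  from S8.prems obtain xs' where "length xs' = length ds" "app \<alpha> xs' = Some m"
    "\<And>i. i < length ds \<Longrightarrow> kabs (ds ! i) (\<alpha> # args) (xs' ! i)"
    by (cases rule: kleene.cases) (auto simp: list_encode_eq simp del: list_encode.simps)
  moreover from this S8 have "xs' = xs" by (metis nth_equalityI)
  ultimately show ?case using S8 by simp
next
  case S1
  from S1.prems show ?case
    by (cases rule: kleene.cases) (auto simp: list_encode_eq simp del: list_encode.simps)+
next
  case S2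
  from S2.prems show ?case
    by (cases rule: kleene.cases) (auto simp: list_encode_eq simp del: list_encode.simps)+
next
  case S3
  from S3.prems show ?case
    by (cases rule: kleene.cases) (auto simp: list_encode_eq simp del: list_encode.simps)+
next
  case S4
  from S4.prems show ?case
    by (cases rule: kleene.cases) (fastforce simp: list_encode_eq simp del: list_encode.simps dest: S4.IH)+
next
  case S5_0
  from S5_0.prems show ?case
    by (cases rule: kleene.cases) (auto simp: list_encode_eq simp del: list_encode.simps dest: S5_0.IH)+
next
  case S5_Suc
  from S5_Suc.prems show ?case
    by (cases rule: kleene.cases) (fastforce simp: list_encode_eq simp del: list_encode.simps dest: S5_Suc.IH)+
next
  case S6
  from S6.prems show ?case
    by (cases rule: kleene.cases) (auto simp: list_encode_eq simp del: list_encode.simps dest: S6.IH)+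
next
  case S7
  from S7.prems show ?case
    by (cases rule: kleene.cases) (auto simp: list_encode_eq simp del: list_encode.simps)+
next
  case S9
  from S9.prems show ?case
    by (cases rule: kleene.cases) (auto simp: list_encode_eq simp del: list_encode.simps dest: S9.IH)+
next
  case abs0
  from abs0.prems show ?case
    by (cases rule: kabs.cases) (auto simp: prod_encode_eq abs0.IH intro!: ext)
next
  case abs1
  from abs1.prems show ?case
    by (cases rule: kabs.cases) (auto simp: prod_encode_eq abs1.IH intro!: ext)
next
  case abs2
  from abs2.prems show ?case
    by (cases rule: kabs.cases) (auto simp: prod_encode_eq abs2.IH intro!: ext)
next
  case abs11
  from abs11.prems show ?case
    by (cases rule: kabs.cases) (auto simp: prod_encode_eq abs11.IH intro!: ext)
qed

definition E2 :: "(nat \<Rightarrow> nat) \<Rightarrow> nat" where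
  "E2 f = (if \<exists>n. f n = 0 then 0 else 1)"

text \<open>The partial functional \<open>\<lambda>xs. {e}(\<Phi>, \<exists>\<^sup>2, xs)\<close>.\<close>

definition kleene_fun :: "nat \<Rightarrow> functional \<Rightarrow> functional" where
  "kleene_fun e \<Phi> xs =
     (let args = Fnl \<Phi> # Obj (Ty2 E2) # map Obj xs
      in if \<exists>n. kleene e args n then Some (THE n. kleene e args n) else None)"

text \<open>
  A class of functionals is given by a specification. One algorithm is required to turn every
  functional satisfying \<open>P\<close> (together with \<open>\<exists>\<^sup>2\<close>) into a functional satisfying \<open>Q\<close>.
\<close>

definition computes_mod_E2 :: "(functional \<Rightarrow> bool) \<Rightarrow> (functional \<Rightarrow> bool) \<Rightarrow> bool" where
  "computes_mod_E2 P Q \<longleftrightarrow> (\<exists>e. \<forall>\<Phi>. P \<Phi> \<longrightarrow> Q (kleene_fun e \<Phi>))"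


section \<open>Representations\<close>

definition represents :: "(nat \<Rightarrow> nat) \<Rightarrow> real \<Rightarrow> bool" where
  "represents x r \<longleftrightarrow>
     (let q = (\<lambda>n. real_of_rat (nat_to_rat_surj (x n)))
      in (\<forall>n i. \<bar>q n - q (n + i)\<bar> < 1 / 2 ^ n) \<and> q \<longlonglongrightarrow> r)"

text \<open>
  A function \<open>[0,1] \<rightarrow> \<real>\<close> is rendered as a total \<open>f :: real \<Rightarrow> real\<close> of which only the values on
  \<open>{0..1}\<close> are ever used. That \<open>F\<close> represents such a function includes extensionality of \<open>F\<close>.
\<close>

definition fun_rep :: "((nat \<Rightarrow> nat) \<Rightarrow> nat \<Rightarrow> nat) \<Rightarrow> (real \<Rightarrow> real) \<Rightarrow> bool" where
  "fun_rep F f \<longleftrightarrow> (\<forall>x r. r \<in> {0..1} \<and> represents x r \<longrightarrow> represents (F x) (f r))"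

definition nat_fun_rep :: "((nat \<Rightarrow> nat) \<Rightarrow> nat) \<Rightarrow> (real \<Rightarrow> nat) \<Rightarrow> bool" where
  "nat_fun_rep h H \<longleftrightarrow> (\<forall>x r. represents x r \<longrightarrow> h x = H r)"

definition set_rep :: "((nat \<Rightarrow> nat) \<Rightarrow> nat) \<Rightarrow> real set \<Rightarrow> bool" where
  "set_rep \<xi> A \<longleftrightarrow> nat_fun_rep \<xi> (\<lambda>r. if r \<in> A then 1 else 0)"

text \<open>\<open>\<Phi>\<close> is defined on the inputs \<open>xs\<close> and its output is a representation of the real \<open>r\<close>.\<close>

definition outputs :: "functional \<Rightarrow> obj list \<Rightarrow> real \<Rightarrow> bool" where
  "outputs \<Phi> xs r \<longleftrightarrow> (\<exists>y. (\<forall>n. \<Phi> (xs @ [Ty0 n]) = Some (y n)) \<and> represents y r)"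


section \<open>Countability\<close>

definition is_height :: "(real \<Rightarrow> nat) \<Rightarrow> real set \<Rightarrow> bool" where
  "is_height H A \<longleftrightarrow> (\<forall>n. finite {x \<in> A. H x < n})"

definition countable_by :: "(real \<Rightarrow> nat) \<Rightarrow> real set \<Rightarrow> bool" where
  "countable_by Y A \<longleftrightarrow> inj_on Y A"

definition strongly_countable_by :: "(real \<Rightarrow> nat) \<Rightarrow> real set \<Rightarrow> bool" where
  "strongly_countable_by Y A \<longleftrightarrow> inj_on Y A \<and> Y ` A = UNIV"


section \<open>Functions on the unit interval\<close>

definition regulated :: "(real \<Rightarrow> real) \<Rightarrow> bool" where
  "regulated f \<longleftrightarrow>
     (\<forall>x\<in>{0<..1}. \<exists>l. (f \<longlongrightarrow> l) (at_left x)) \<and> (\<forall>x\<in>{0..<1}. \<exists>l. (f \<longlongrightarrow> l) (at_right x))"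

abbreviation cont_at :: "(real \<Rightarrow> real) \<Rightarrow> real \<Rightarrow> bool" where
  "cont_at f x \<equiv> continuous (at x within {0..1}) f"

definition lower_semicont_at :: "(real \<Rightarrow> real) \<Rightarrow> real \<Rightarrow> bool" where
  "lower_semicont_at f x \<longleftrightarrow> ereal (f x) \<le> Liminf (at x within {0..1}) (\<lambda>t. ereal (f t))"

definition quasi_cont_at :: "(real \<Rightarrow> real) \<Rightarrow> real \<Rightarrow> bool" where
  "quasi_cont_at f x \<longleftrightarrow>
     (\<forall>\<epsilon>>0. \<forall>U. openin (top_of_set {0..1}) U \<and> x \<in> U \<longrightarrow>
        (\<exists>G. openin (top_of_set {0..1}) G \<and> G \<noteq> {} \<and> G \<subseteq> U \<and> (\<forall>t\<in>G. \<bar>f x - f t\<bar> < \<epsilon>)))"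

definition left_cluster_value :: "(real \<Rightarrow> real) \<Rightarrow> real \<Rightarrow> real \<Rightarrow> bool" where
  "left_cluster_value f x y \<longleftrightarrow>
     (\<exists>s. (\<forall>n. s n \<in> {0..1} \<and> s n \<le> x) \<and> s \<longlonglongrightarrow> x \<and> (\<lambda>n. f (s n)) \<longlonglongrightarrow> y)"

definition right_cluster_value :: "(real \<Rightarrow> real) \<Rightarrow> real \<Rightarrow> real \<Rightarrow> bool" where
  "right_cluster_value f x y \<longleftrightarrow>
     (\<exists>s. (\<forall>n. s n \<in> {0..1} \<and> x \<le> s n) \<and> s \<longlonglongrightarrow> x \<and> (\<lambda>n. f (s n)) \<longlonglongrightarrow> y)"

definition strictly_between :: "real \<Rightarrow> real \<Rightarrow> real \<Rightarrow> bool" where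
  "strictly_between z a b \<longleftrightarrow> (a < z \<and> z < b) \<or> (b < z \<and> z < a)"

definition darboux_point :: "(real \<Rightarrow> real) \<Rightarrow> real \<Rightarrow> bool" where
  "darboux_point f x \<longleftrightarrow>
     (\<forall>\<delta>>0.
        (\<forall>y z. left_cluster_value f x y \<and> strictly_between z y (f x) \<longrightarrow>
           (\<exists>w \<in> {x - \<delta><..<x} \<inter> {0..1}. f w = z)) \<and>
        (\<forall>y z. right_cluster_value f x y \<and> strictly_between z y (f x) \<longrightarrow>
           (\<exists>w \<in> {x<..<x + \<delta>} \<inter> {0..1}. f w = z)))"

definition strict_local_max :: "(real \<Rightarrow> real) \<Rightarrow> real \<Rightarrow> bool" where
  "strict_local_max f x \<longleftrightarrow> (\<exists>N::nat. \<forall>y \<in> ball x (1 / 2 ^ N) \<inter> {0..1}. y \<noteq> x \<longrightarrow> f y < f x)"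

definition only_removable_discontinuities :: "(real \<Rightarrow> real) \<Rightarrow> bool" where
  "only_removable_discontinuities f \<longleftrightarrow>
     (\<forall>x\<in>{0..1}. \<not> cont_at f x \<longrightarrow> (\<exists>l. (f \<longlongrightarrow> l) (at x within {0..1})))"

text \<open>The Riemann integral, with uniform mesh (the library integral is the gauge integral).\<close>

definition has_riemann_integral :: "(real \<Rightarrow> real) \<Rightarrow> real \<Rightarrow> real \<Rightarrow> real \<Rightarrow> bool" where
  "has_riemann_integral f a b I \<longleftrightarrow>
     (\<forall>\<epsilon>>0. \<exists>\<delta>>0. \<forall>p. p tagged_division_of {a..b} \<and> (\<forall>(t, K)\<in>p. measure lborel K < \<delta>) \<longrightarrow>
        \<bar>(\<Sum>(t, K)\<in>p. measure lborel K * f t) - I\<bar> < \<epsilon>)"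

definition riemann_integral :: "(real \<Rightarrow> real) \<Rightarrow> real \<Rightarrow> real \<Rightarrow> real" where
  "riemann_integral f a b = (THE I. has_riemann_integral f a b I)"


section \<open>The functionals\<close>

definition strong_cantor_realiser :: "functional \<Rightarrow> bool" where
  "strong_cantor_realiser \<Phi> \<longleftrightarrow>
     (\<forall>\<xi> A h H. A \<subseteq> {0..1} \<and> set_rep \<xi> A \<and> nat_fun_rep h H \<and> is_height H A \<longrightarrow>
        (\<exists>y. outputs \<Phi> [Ty2 \<xi>, Ty2 h] y \<and> y \<in> {0..1} - A))"

text \<open>A pair of reals is output via an additional argument in \<open>{0, 1}\<close> that selects the component.\<close>

definition infinite_range_functional :: "functional \<Rightarrow> bool" where
  "infinite_range_functional \<Phi> \<longleftrightarrow>
     (\<forall>F f. fun_rep F f \<and> regulated f \<longrightarrow>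
        (\<exists>a b. outputs \<Phi> [Ty11 F, Ty0 0] a \<and> outputs \<Phi> [Ty11 F, Ty0 1] b \<and>
           a \<in> {0..1} \<and> b \<in> {0..1} \<and> infinite {x \<in> {0..1}. f a \<le> f x \<and> f x \<le> f b}))"

definition continuity_functional :: "functional \<Rightarrow> bool" where
  "continuity_functional \<Phi> \<longleftrightarrow>
     (\<forall>F f. fun_rep F f \<and> regulated f \<longrightarrow>
        (\<exists>y. outputs \<Phi> [Ty11 F] y \<and> y \<in> {0..1} \<and> cont_at f y))"

definition quasi_continuity_functional :: "functional \<Rightarrow> bool" where
  "quasi_continuity_functional \<Phi> \<longleftrightarrow>
     (\<forall>F f. fun_rep F f \<and> regulated f \<longrightarrow>
        (\<exists>y. outputs \<Phi> [Ty11 F] y \<and> y \<in> {0..1} \<and> quasi_cont_at f y))"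

definition lower_semicontinuity_functional :: "functional \<Rightarrow> bool" where
  "lower_semicontinuity_functional \<Phi> \<longleftrightarrow>
     (\<forall>F f. fun_rep F f \<and> regulated f \<longrightarrow>
        (\<exists>y. outputs \<Phi> [Ty11 F] y \<and> y \<in> {0..1} \<and> lower_semicont_at f y))"

definition darboux_functional :: "functional \<Rightarrow> bool" where
  "darboux_functional \<Phi> \<longleftrightarrow>
     (\<forall>F f. fun_rep F f \<and> regulated f \<longrightarrow>
        (\<exists>y. outputs \<Phi> [Ty11 F] y \<and> y \<in> {0..1} \<and> darboux_point f y))"

definition density_functional :: "functional \<Rightarrow> bool" where
  "density_functional \<Phi> \<longleftrightarrow>
     (\<forall>F f u x k. fun_rep F f \<and> regulated f \<and> represents u x \<and> x \<in> {0..1} \<longrightarrow>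
        (\<exists>y. outputs \<Phi> [Ty11 F, Ty1 u, Ty0 k] y \<and> y \<in> {0..1} \<inter> ball x (1 / 2 ^ k) \<and> cont_at f y))"

text \<open>
  An output in one of two disjoint sets is a single real: in the presence of \<open>\<exists>\<^sup>2\<close>, membership in
  \<open>\<rat>\<close> (and in a set given by its characteristic function) is decidable.
\<close>

definition rational_dichotomy_functional :: "functional \<Rightarrow> bool" where
  "rational_dichotomy_functional \<Phi> \<longleftrightarrow>
     (\<forall>F f. fun_rep F f \<and> regulated f \<longrightarrow>
        (\<exists>y. outputs \<Phi> [Ty11 F] y \<and>
           ((y \<in> \<rat> \<inter> {0..1} \<and> \<not> cont_at f y) \<or> (y \<in> {0..1} - \<rat> \<and> cont_at f y))))"

definition common_point_functional :: "functional \<Rightarrow> bool" where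
  "common_point_functional \<Phi> \<longleftrightarrow>
     (\<forall>F f G g. fun_rep F f \<and> regulated f \<and> fun_rep G g \<and> regulated g \<longrightarrow>
        (\<exists>x. outputs \<Phi> [Ty11 F, Ty11 G] x \<and> x \<in> {0..1} \<and>
           ((cont_at f x \<and> cont_at g x) \<or> (\<not> cont_at f x \<and> \<not> cont_at g x))))"

text \<open>
  The argument \<open>W\<close> says how the number-valued input \<open>Y\<close> witnesses countability of \<open>D\<close>. The second
  function \<open>g\<close> is an input that plays no role in the specification of the output.
\<close>

definition dense_dichotomy_functional ::
    "((real \<Rightarrow> nat) \<Rightarrow> real set \<Rightarrow> bool) \<Rightarrow> functional \<Rightarrow> bool" where
  "dense_dichotomy_functional W \<Phi> \<longleftrightarrow>
     (\<forall>F f G g \<xi> D h Y.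
        fun_rep F f \<and> regulated f \<and> fun_rep G g \<and> regulated g \<and>
        D \<subseteq> {0..1} \<and> {0..1} \<subseteq> closure D \<and> set_rep \<xi> D \<and> nat_fun_rep h Y \<and> W Y D \<longrightarrow>
        (\<exists>x. outputs \<Phi> [Ty11 F, Ty11 G, Ty2 \<xi>, Ty2 h] x \<and>
           ((x \<in> D \<inter> {0..1} \<and> \<not> cont_at f x) \<or> (x \<in> {0..1} - D \<and> cont_at f x))))"

definition integral_zero_functional :: "functional \<Rightarrow> bool" where
  "integral_zero_functional \<Phi> \<longleftrightarrow>
     (\<forall>F f. fun_rep F f \<and> regulated f \<and> f ` {0..1} \<subseteq> {0..1} \<and> has_riemann_integral f 0 1 0 \<longrightarrow>
        (\<exists>x. outputs \<Phi> [Ty11 F] x \<and> x \<in> {0..1} \<and> f x = 0))"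

definition ftc_functional :: "functional \<Rightarrow> bool" where
  "ftc_functional \<Phi> \<longleftrightarrow>
     (\<forall>F f. fun_rep F f \<and> regulated f \<longrightarrow>
        (\<exists>y. outputs \<Phi> [Ty11 F] y \<and> y \<in> {0<..<1} \<and>
           ((\<lambda>x. riemann_integral f 0 x) has_real_derivative f y) (at y)))"

definition non_strict_max_functional :: "functional \<Rightarrow> bool" where
  "non_strict_max_functional \<Phi> \<longleftrightarrow>
     (\<forall>F f. fun_rep F f \<and> regulated f \<and> only_removable_discontinuities f \<longrightarrow>
        (\<exists>x. outputs \<Phi> [Ty11 F] x \<and> x \<in> {0..1} \<and> \<not> strict_local_max f x))"

end

theory Submission
  imports Defs
begin

text \<open>
  Modulo \<open>\<exists>\<^sup>2\<close> a real depending on the inputs is computable as soon as its lower Dedekind cut is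
  arithmetically definable from them. A regulated function has countably many discontinuities; its
  one-sided limits are limits of sequences, so whether the jump at a point exceeds \<open>1 / 2 ^ n\<close> is
  decidable, and for each \<open>n\<close> this happens at finitely many points only. Hence the discontinuities
  form a weakly countable set with a computable height, and a point that avoids it is a point of
  continuity, from which the outputs of the other functionals are obtained. Conversely, a set
  \<open>A\<close> with height \<open>H\<close> is coded by the regulated function that is \<open>1 / 2 ^ (H x + 1)\<close> on \<open>A\<close> and \<open>0\<close>
  elsewhere. All its limits are \<open>0\<close>, so \<open>A\<close> is the set of its discontinuities and also the set of its
  strict local maxima, and every functional in the list is led outside \<open>A\<close>.

  Only (k) needs an extra idea. Let \<open>g\<close> be \<open>f\<close> with its discontinuities removed. If \<open>g\<close> is constant,
  no point of continuity of \<open>f\<close> is a strict maximum. Otherwise \<open>g a < g b\<close> for rational \<open>a, b\<close>, and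
  the last point of the segment from \<open>a\<close> to \<open>b\<close> that is a limit of points with \<open>g < c\<close> is not a strict
  maximum if \<open>f\<close> is continuous there; this point depends injectively on \<open>c\<close>, so \<open>c\<close> only has to
  avoid a weakly countable set.
\<close>


section \<open>Closure properties of Kleene computability\<close>

text \<open>The equivalence is not proved in pairs. Each functional of the list is shown to yield,
  uniformly, a point off any weakly countable set that is definable from the inputs, and each of
  them is computed from such a point. Cuts rather than Cauchy sequences are the working notion of a
  real: a cut depends on the real alone, and \<open>E2\<close> decides number quantifiers, so
  comparison, case distinction and limits need no moduli. Names are needed only where an object is
  passed to a functional or returned; taking least indices makes the name depend on the real alone,
  so that the objects passed are extensional. What has to be done by hand is the bookkeeping of
  argument lists. Apart from the truncation in S9, S6 is the only scheme that rearranges them, so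
  weakening, exchange and shifting under bound variables are derived before anything is
  computed.\<close>

lemma kleene_append:
  "kleene e a n \<Longrightarrow> kleene e (a @ b) n"
  "kabs e a x \<Longrightarrow> kabs e (a @ b) x"
proof (induction rule: kleene_kabs.inducts)
  case (S6 k args c n)
  then show ?case by (auto intro!: kleene_kabs.S6 simp: nth_append simp del: list_encode.simps)
next
  case (S8 xs ds \<alpha> args n)
  then show ?case by (auto intro!: kleene_kabs.S8 simp del: list_encode.simps)
next
  case (S9 m args c n)
  then show ?case by (auto intro!: kleene_kabs.S9 simp del: list_encode.simps)
qed (auto intro: kleene_kabs.intros simp del: list_encode.simps One_nat_def)

text \<open>S6 moves a single entry to the front, so the prefix \<open>p\<close> is assembled from
  its last element to its first; \<open>r\<close> collects the entries not yet moved.\<close>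

lemma moves_to_front:
  assumes "distinct p" "set p \<subseteq> {..<L}"
  shows "\<exists>r. mset (p @ r) = mset [0..<L] \<and> (\<forall>c. \<exists>c'. \<forall>a n. length a = L \<longrightarrow>
           kleene c (map ((!) a) (p @ r)) n \<longrightarrow> kleene c' a n)"
  using assms
proof (induction p)
  case Nil
  have "\<forall>c. \<exists>c'. \<forall>a n. length a = L \<longrightarrow> kleene c (map ((!) a) [0..<L]) n \<longrightarrow> kleene c' a n"
    by (metis map_nth)
  then show ?case by (intro exI[of _ "[0..<L]"]) auto
next
  case (Cons i p)
  then obtain r where r: "mset (p @ r) = mset [0..<L]"
    and c: "\<And>c. \<exists>c'. \<forall>a n. length a = L \<longrightarrow> kleene c (map ((!) a) (p @ r)) n \<longrightarrow> kleene c' a n"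
    by auto
  have "set (p @ r) = {..<L}"
    using arg_cong[OF r, of set_mset] by (simp add: lessThan_atLeast0)
  with Cons.prems have "i \<in> set r" by auto
  then obtain r1 r2 where r12: "r = r1 @ i # r2" by (meson split_list)
  let ?k = "length p + length r1"
  have "\<exists>c'. \<forall>a n. length a = L \<longrightarrow>
           kleene c (map ((!) a) ((i # p) @ r1 @ r2)) n \<longrightarrow> kleene c' a n" for c
  proof -
    have step: "kleene (list_encode [6, ?k, c]) (map ((!) a) (p @ r)) n"
      if "kleene c (map ((!) a) ((i # p) @ r1 @ r2)) n" for a n
    proof (rule S6)
      show "kleene c (map ((!) a) (p @ r) ! ?k # take ?k (map ((!) a) (p @ r)) @
              drop (Suc ?k) (map ((!) a) (p @ r))) n"
        using that by (simp add: r12 nth_append Suc_diff_le)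
    qed (simp add: r12)
    from c[of "list_encode [6, ?k, c]"] step show ?thesis by metis
  qed
  moreover have "mset ((i # p) @ r1 @ r2) = mset [0..<L]" using r r12 by simp
  ultimately show ?case by blast
qed

text \<open>Exchange and weakening in one rule: the unselected arguments end up behind the selected
  ones, where \<open>kleene_append\<close> makes them harmless.\<close>

lemma kleene_reindex:
  assumes "distinct p" "set p \<subseteq> {..<L}"
  obtains c' where "\<And>a n. length a = L \<Longrightarrow> kleene c (map ((!) a) p) n \<Longrightarrow> kleene c' a n"
  using moves_to_front[OF assms] kleene_append(1)[of c] that by (metis map_append)

text \<open>The abstracted variables stand in front of the arguments, so the selection is shifted
  past none, one or two of them, according to the type that \<open>d\<close> records.\<close>

lemma kabs_reindex:
  assumes p: "distinct p" "set p \<subseteq> {..<L}"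
  obtains d' where "\<And>a x. length a = L \<Longrightarrow> kabs d (map ((!) a) p) x \<Longrightarrow> kabs d' a x"
proof -
  obtain tag c where d: "d = prod_encode (tag, c)"
    by (metis prod_decode_inverse surj_pair)
  obtain c0 where c0: "\<And>a n. length a = L \<Longrightarrow> kleene c (map ((!) a) p) n \<Longrightarrow> kleene c0 a n"
    using kleene_reindex[OF p] by blast
  have "distinct (0 # map Suc p)" "set (0 # map Suc p) \<subseteq> {..<Suc L}"
    using p by (auto simp: distinct_map)
  from kleene_reindex[OF this] obtain c1 where c1: "\<And>a n. length a = Suc L \<Longrightarrow>
       kleene c (map ((!) a) (0 # map Suc p)) n \<Longrightarrow> kleene c1 a n"
    by blast
  have "distinct (0 # 1 # map (Suc \<circ> Suc) p)" "set (0 # 1 # map (Suc \<circ> Suc) p) \<subseteq> {..<Suc (Suc L)}"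
    using p by (auto simp: distinct_map inj_on_def)
  from kleene_reindex[OF this] obtain c2 where c2: "\<And>a n. length a = Suc (Suc L) \<Longrightarrow>
       kleene c (map ((!) a) (0 # 1 # map (Suc \<circ> Suc) p)) n \<Longrightarrow> kleene c2 a n"
    by blast
  have e1: "map ((!) (x # a)) (0 # map Suc p) = x # map ((!) a) p" for x :: arg and a by simp
  have e2: "map ((!) (x # y # a)) (0 # 1 # map (Suc \<circ> Suc) p) = x # y # map ((!) a) p"
    for x y :: arg and a by simp
  let ?d = "prod_encode (tag, if tag = 0 then c0 else if tag = 3 then c2 else c1)"
  have "kabs ?d a x" if L: "length a = L" and "kabs d (map ((!) a) p) x" for a x
    using that(2)
  proof cases
    case (abs0 d n)
    then show ?thesis using c0 L d by (auto simp: prod_encode_eq intro!: kleene_kabs.abs0)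
  next
    case (abs1 d f)
    then have "kleene c1 (Obj (Ty0 m) # a) (f m)" for m
      using c1[of "Obj (Ty0 m) # a"] L d unfolding e1 by (auto simp: prod_encode_eq)
    then show ?thesis using abs1 d by (auto simp: prod_encode_eq simp del: One_nat_def intro!: kleene_kabs.abs1)
  next
    case (abs2 d F)
    then have "kleene c1 (Obj (Ty1 f) # a) (F f)" for f
      using c1[of "Obj (Ty1 f) # a"] L d unfolding e1 by (auto simp: prod_encode_eq)
    then show ?thesis using abs2 d by (auto simp: prod_encode_eq intro!: kleene_kabs.abs2)
  next
    case (abs11 d F)
    then have "kleene c2 (Obj (Ty1 f) # Obj (Ty0 m) # a) (F f m)" for f m
      using c2[of "Obj (Ty1 f) # Obj (Ty0 m) # a"] L d unfolding e2 by (auto simp: prod_encode_eq)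
    then show ?thesis using abs11 d by (auto simp: prod_encode_eq intro!: kleene_kabs.abs11)
  qed
  then show thesis using that by blast
qed

text \<open>
  A context relates argument lists to the semantic objects \<open>g\<close> they stand for (a real function next
  to its representation, say). \<open>ext0\<close> and \<open>ext1\<close> bind a number and a sequence variable.
\<close>

type_synonym 'g ctx = "(arg list \<times> 'g) set"

text \<open>A common length makes the positions used by S6 and S9 the same for all members, and a
  fixed place of \<open>E2\<close> lets one index quantify over numbers throughout the
  context.\<close>

definition wfc :: "'g ctx \<Rightarrow> bool" where
  "wfc C \<longleftrightarrow> (\<exists>L k. \<forall>(a, g) \<in> C. length a = L \<and> k < L \<and> a ! k = Obj (Ty2 E2))"

text \<open>One index serves all members of the context; this is the uniformity that
  \<open>computes_mod_E2\<close> demands.\<close>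

definition kcomp :: "'g ctx \<Rightarrow> ('g \<Rightarrow> nat) \<Rightarrow> bool" where
  "kcomp C t \<longleftrightarrow> (\<exists>c. \<forall>(a, g) \<in> C. kleene c a (t g))"

definition ocomp :: "'g ctx \<Rightarrow> ('g \<Rightarrow> obj) \<Rightarrow> bool" where
  "ocomp C t \<longleftrightarrow> (\<exists>d. \<forall>(a, g) \<in> C. kabs d a (t g))"

definition has :: "'g ctx \<Rightarrow> ('g \<Rightarrow> arg \<Rightarrow> bool) \<Rightarrow> bool" where
  "has C R \<longleftrightarrow> (\<exists>k. \<forall>(a, g) \<in> C. k < length a \<and> R g (a ! k))"

definition extend :: "('v \<Rightarrow> obj) \<Rightarrow> 'g ctx \<Rightarrow> ('g \<times> 'v) ctx" where
  "extend c C = {(Obj (c v) # a, (g, v)) | a g v. (a, g) \<in> C}"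

abbreviation ext0 :: "'g ctx \<Rightarrow> ('g \<times> nat) ctx" where
  "ext0 \<equiv> extend Ty0"

abbreviation ext1 :: "'g ctx \<Rightarrow> ('g \<times> (nat \<Rightarrow> nat)) ctx" where
  "ext1 \<equiv> extend Ty1"

definition dec :: "'g ctx \<Rightarrow> ('g \<Rightarrow> bool) \<Rightarrow> bool" where
  "dec C P \<longleftrightarrow> kcomp C (\<lambda>g. if P g then 1 else 0)"

lemma wfc_extend: "wfc C \<Longrightarrow> wfc (extend c C)"
proof -
  assume "wfc C"
  then obtain L k where "\<forall>(a, g) \<in> C. length a = L \<and> k < L \<and> a ! k = Obj (Ty2 E2)"
    unfolding wfc_def by blast
  then show ?thesis
    unfolding wfc_def extend_def by (intro exI[of _ "Suc L"] exI[of _ "Suc k"]) auto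
qed

lemma wfc_length: "wfc C \<Longrightarrow> \<exists>L. \<forall>(a, g) \<in> C. length a = L"
  unfolding wfc_def by blast

text \<open>The map \<open>h\<close> on the semantic side mirrors the selection \<open>p\<close> on
  the side of the arguments; variables are dropped or exchanged this way.\<close>

lemma kcomp_reindex:
  assumes t: "kcomp D t" and p: "distinct p" "set p \<subseteq> {..<L}"
    and C: "\<And>a g. (a, g) \<in> C \<Longrightarrow> length a = L \<and> (map ((!) a) p, h g) \<in> D"
  shows "kcomp C (\<lambda>g. t (h g))"
proof -
  obtain c where c: "\<forall>(a, g) \<in> D. kleene c a (t g)" using t unfolding kcomp_def by blast
  obtain c' where "\<And>a n. length a = L \<Longrightarrow> kleene c (map ((!) a) p) n \<Longrightarrow> kleene c' a n"
    using kleene_reindex[OF p] by blast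
  with c C have "\<forall>(a, g) \<in> C. kleene c' a (t (h g))" by fast
  then show ?thesis unfolding kcomp_def by blast
qed

lemma kcomp_extend:
  assumes "wfc C" "kcomp C t"
  shows "kcomp (extend c C) (\<lambda>x. t (fst x))"
proof -
  obtain L where L: "\<forall>(a, g) \<in> C. length a = L" using wfc_length[OF assms(1)] by blast
  have "map ((!) (x # a)) (map Suc [0..<length a]) = a" for x :: arg and a
    by (simp add: o_def map_nth)
  with L show ?thesis
    by (intro kcomp_reindex[OF assms(2), of "map Suc [0..<L]" "Suc L"])
       (auto simp: extend_def distinct_map)
qed

section \<open>Schemes S1 to S5 as closure properties of terms\<close>

lemma kcomp_const: "kcomp C (\<lambda>g. q)"
  unfolding kcomp_def using S2 by blast

lemma kcomp_var: "kcomp (ext0 C) (\<lambda>x. snd x)"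
  unfolding kcomp_def extend_def using S3 by fastforce

lemma kcomp_let:
  assumes "kcomp C a" "kcomp (ext0 C) (\<lambda>x. t (fst x) (snd x))"
  shows "kcomp C (\<lambda>g. t g (a g))"
proof -
  obtain d c where "\<forall>(a', g) \<in> C. kleene d a' (a g)"
    "\<forall>(a, g) \<in> ext0 C. kleene c a (t (fst g) (snd g))"
    using assms unfolding kcomp_def by blast
  then have "\<forall>(a', g) \<in> C. kleene (list_encode [4, c, d]) a' (t g (a g))"
    unfolding extend_def by (fastforce intro!: S4 simp del: list_encode.simps)
  then show ?thesis unfolding kcomp_def by blast
qed

lemma kcomp_Suc: "kcomp C t \<Longrightarrow> kcomp C (\<lambda>g. Suc (t g))"
proof -
  assume "kcomp C t"
  then obtain c where "\<forall>(a, g) \<in> C. kleene c a (t g)" unfolding kcomp_def by blast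
  then have "\<forall>(a, g) \<in> C. kleene (list_encode [4, list_encode [1], c]) a (Suc (t g))"
    using S4[OF _ S1] by fast
  then show "kcomp C (\<lambda>g. Suc (t g))" unfolding kcomp_def by blast
qed

lemma kcomp_rec:
  assumes "kcomp C z" "kcomp (ext0 (ext0 C)) (\<lambda>x. s (fst (fst x)) (snd x) (snd (fst x)))" "kcomp C n"
  shows "kcomp C (\<lambda>g. rec_nat (z g) (s g) (n g))"
proof -
  obtain c d where c: "\<And>a g. (a, g) \<in> C \<Longrightarrow> kleene c a (z g)"
    and d: "\<And>a g. (a, g) \<in> ext0 (ext0 C) \<Longrightarrow> kleene d a (s (fst (fst g)) (snd g) (snd (fst g)))"
    using assms(1,2) unfolding kcomp_def by blast
  \<comment> \<open>S5 puts the counter \<open>m\<close> in front of the previous value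
    \<open>k\<close>, so the innermost variable is the counter.\<close>
  have d': "kleene d (Obj (Ty0 m) # Obj (Ty0 k) # a) (s g m k)" if "(a, g) \<in> C" for a g m k
    using d[of "Obj (Ty0 m) # Obj (Ty0 k) # a" "((g, k), m)"] that by (auto simp: extend_def)
  have "kleene (list_encode [5, c, d]) (Obj (Ty0 m) # a) (rec_nat (z g) (s g) m)"
    if "(a, g) \<in> C" for a g m
  proof (induction m)
    case 0
    show ?case using c[OF that] by (auto intro: S5_0 simp del: list_encode.simps)
  next
    case (Suc m)
    then show ?case using d'[OF that] by (auto intro: S5_Suc simp del: list_encode.simps)
  qed
  then have "kcomp (ext0 C) (\<lambda>x. rec_nat (z (fst x)) (s (fst x)) (snd x))"
    unfolding kcomp_def extend_def by fastforce
  from kcomp_let[OF assms(3) this] show ?thesis .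
qed

section \<open>Inputs as variables, abstraction, and calls of arguments of higher type\<close>

lemma has_extend: "has C R \<Longrightarrow> has (extend c C) (\<lambda>x. R (fst x))"
  unfolding has_def by (elim exE, rule_tac x="Suc k" in exI) (auto simp: extend_def)

lemma has_var1: "has (ext1 C) (\<lambda>x y. y = Obj (Ty1 (snd x)))"
  unfolding has_def by (rule exI[of _ 0]) (auto simp: extend_def)

lemma has_E2: "wfc C \<Longrightarrow> has C (\<lambda>g y. y = Obj (Ty2 E2))"
  unfolding wfc_def has_def by (elim exE) (rule_tac x=k in exI, auto)

text \<open>S7 wants the function first and its argument second, so S4 pushes the number and S6 then
  fetches the function, which has moved to position \<open>Suc k\<close>.\<close>

lemma kcomp_apply_var:
  assumes "has C (\<lambda>g y. y = Obj (Ty1 (u g)))" "kcomp C t"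
  shows "kcomp C (\<lambda>g. u g (t g))"
proof -
  obtain k c where k: "\<forall>(a, g) \<in> C. k < length a \<and> a ! k = Obj (Ty1 (u g))"
    and c: "\<forall>(a, g) \<in> C. kleene c a (t g)"
    using assms unfolding kcomp_def has_def by blast
  have "kleene (list_encode [4, list_encode [6, Suc k, list_encode [7]], c]) a (u g (t g))"
    if "(a, g) \<in> C" for a g
  proof (rule S4)
    show "kleene c a (t g)" using c that by auto
    show "kleene (list_encode [6, Suc k, list_encode [7]]) (Obj (Ty0 (t g)) # a) (u g (t g))"
      using k that by (intro S6) (auto intro!: S7 simp del: list_encode.simps)
  qed
  then show ?thesis unfolding kcomp_def by blast
qed

lemma ocomp_0: "kcomp C t \<Longrightarrow> ocomp C (\<lambda>g. Ty0 (t g))"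
  unfolding kcomp_def ocomp_def
  by (elim exE, rule_tac x="prod_encode (0, c)" in exI) (auto intro!: abs0)

lemma ocomp_1:
  assumes "kcomp (ext0 C) (\<lambda>x. t (fst x) (snd x))"
  shows "ocomp C (\<lambda>g. Ty1 (t g))"
proof -
  obtain c where c: "\<forall>(a, g) \<in> ext0 C. kleene c a (t (fst g) (snd g))"
    using assms unfolding kcomp_def by blast
  then have "\<forall>(a, g) \<in> C. kabs (prod_encode (1, c)) a (Ty1 (t g))"
    by (fastforce intro!: abs1 simp: extend_def)
  then show ?thesis unfolding ocomp_def by blast
qed

lemma ocomp_2:
  assumes "kcomp (ext1 C) (\<lambda>x. t (fst x) (snd x))"
  shows "ocomp C (\<lambda>g. Ty2 (t g))"
proof -
  obtain c where c: "\<forall>(a, g) \<in> ext1 C. kleene c a (t (fst g) (snd g))"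
    using assms unfolding kcomp_def by blast
  then have "\<forall>(a, g) \<in> C. kabs (prod_encode (2, c)) a (Ty2 (t g))"
    by (fastforce intro!: abs2 simp: extend_def)
  then show ?thesis unfolding ocomp_def by blast
qed

text \<open>\<open>abs11\<close> lists the sequence before the number, while
  \<open>ext0 (ext1 C)\<close> lists the number first; the selection \<open>?p\<close> exchanges the
  two.\<close>

lemma ocomp_11:
  assumes "wfc C" "kcomp (ext0 (ext1 C)) (\<lambda>x. t (fst (fst x)) (snd (fst x)) (snd x))"
  shows "ocomp C (\<lambda>g. Ty11 (t g))"
proof -
  obtain L where L: "\<forall>(a, g) \<in> C. length a = L" using wfc_length[OF assms(1)] by blast
  let ?p = "1 # 0 # map (Suc \<circ> Suc) [0..<L]"
  have m: "map ((!) (x # y # a)) (1 # 0 # map (Suc \<circ> Suc) [0..<length a]) = y # x # a"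
    for x y :: arg and a by (simp add: o_def map_nth)
  have "kcomp (ext1 (ext0 C)) (\<lambda>x. (\<lambda>y. t (fst (fst y)) (snd (fst y)) (snd y))
          ((\<lambda>((g, m), f). ((g, f), m)) x))"
    using L m by (intro kcomp_reindex[OF assms(2), of ?p "L + 2"])
      (auto simp: extend_def distinct_map inj_on_def simp del: list.map)
  then obtain c where "\<forall>(a, x) \<in> ext1 (ext0 C). kleene c a (t (fst (fst x)) (snd x) (snd (fst x)))"
    unfolding kcomp_def by (auto simp: case_prod_unfold)
  then have c: "\<And>a x. (a, x) \<in> ext1 (ext0 C) \<Longrightarrow>
       kleene c a (t (fst (fst x)) (snd x) (snd (fst x)))" by blast
  have "kabs (prod_encode (3, c)) a (Ty11 (t g))" if "(a, g) \<in> C" for a g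
    using that c[of "_ # _ # a" "((g, _), _)"]
    by (intro abs11) (auto simp: extend_def)
  then show ?thesis unfolding ocomp_def by blast
qed

text \<open>S8 needs the called argument in front, and its abstractions are evaluated on the list
  rotated in this way. Since \<open>os\<close> is computable over the original order, its indices
  are converted by a selection that undoes the rotation.\<close>

lemma kcomp_call:
  assumes "wfc C" "has C (\<lambda>g y. y = \<alpha> g)" "\<And>o'. o' \<in> set os \<Longrightarrow> ocomp C o'"
    and app: "\<And>a g. (a, g) \<in> C \<Longrightarrow> app (\<alpha> g) (map (\<lambda>o'. o' g) os) = Some (t g)"
  shows "kcomp C t"
proof -
  obtain L where L: "\<And>a g. (a, g) \<in> C \<Longrightarrow> length a = L" using wfc_length[OF assms(1)] by blast
  obtain k where k: "\<And>a g. (a, g) \<in> C \<Longrightarrow> k < length a \<and> a ! k = \<alpha> g"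
    using assms(2) unfolding has_def by blast
  show ?thesis
  proof (cases "C = {}")
    case False
    then have kL: "k < L" using L k by fastforce
    define rot where "rot a = a ! k # take k a @ drop (Suc k) a" for a :: "arg list"
    \<comment> \<open>Entry \<open>i\<close> of the original list sits in the rotated one at
      \<open>Suc i\<close> if \<open>i < k\<close>, at \<open>0\<close> if \<open>i = k\<close>, and
      at \<open>i\<close> beyond.\<close>
    define p where "p = map Suc [0..<k] @ 0 # [Suc k..<L]"
    have p: "distinct p" "set p \<subseteq> {..<L}" using kL by (auto simp: p_def distinct_map)
    have pa: "map ((!) (rot a)) p = a" if "length a = L" for a
    proof (rule nth_equalityI)
      show "length (map ((!) (rot a)) p) = length a" using that kL by (simp add: p_def)
      fix i assume "i < length (map ((!) (rot a)) p)"
      then have "i < L" using kL by (simp add: p_def)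
      then show "map ((!) (rot a)) p ! i = a ! i"
        using kL that by (auto simp: p_def rot_def nth_append nth_Cons' min_def)
    qed
    have len: "length (rot a) = L" if "length a = L" for a
      using that kL by (auto simp: rot_def)
    have "\<exists>d. \<forall>(a, g) \<in> C. kabs d (rot a) (o' g)" if "o' \<in> set os" for o'
    proof -
      from assms(3)[OF that] obtain d where d: "\<forall>(a, g) \<in> C. kabs d a (o' g)"
        unfolding ocomp_def by blast
      obtain d' where "\<And>a x. length a = L \<Longrightarrow> kabs d (map ((!) a) p) x \<Longrightarrow> kabs d' a x"
        using kabs_reindex[OF p] by blast
      then have "kabs d' (rot a) (o' g)" if "(a, g) \<in> C" for a g
        using d L[OF that] len[of a] pa[of a] that by (metis (no_types, lifting) case_prodD)
      then have "\<forall>(a, g) \<in> C. kabs d' (rot a) (o' g)" by blast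
      then show ?thesis by blast
    qed
    then have "\<forall>o' \<in> set os. \<exists>d. \<forall>(a, g) \<in> C. kabs d (rot a) (o' g)" by blast
    then obtain D where "\<forall>o' \<in> set os. \<forall>(a, g) \<in> C. kabs (D o') (rot a) (o' g)"
      using bchoice[of "set os" "\<lambda>o' d. \<forall>(a, g) \<in> C. kabs d (rot a) (o' g)"] by auto
    then have D: "\<And>o' a g. o' \<in> set os \<Longrightarrow> (a, g) \<in> C \<Longrightarrow> kabs (D o') (rot a) (o' g)"
      by blast
    have "kleene (list_encode [6, k, list_encode (8 # map D os)]) a (t g)" if ag: "(a, g) \<in> C" for a g
    proof (rule S6)
      show "k < length a" using k ag by auto
      have "kleene (list_encode (8 # map D os)) (\<alpha> g # take k a @ drop (Suc k) a) (t g)"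
      proof (rule S8[where xs = "map (\<lambda>o'. o' g) os"])
        fix i assume "i < length (map D os)"
        then show "kabs (map D os ! i) (\<alpha> g # take k a @ drop (Suc k) a) (map (\<lambda>o'. o' g) os ! i)"
          using D[of "os ! i", OF _ ag] k[OF ag] by (simp add: rot_def)
      qed (use app[OF ag] in auto)
      then show "kleene (list_encode (8 # map D os)) (a ! k # take k a @ drop (Suc k) a) (t g)"
        using k[OF ag] by simp
    qed
    then show ?thesis unfolding kcomp_def by blast
  qed (simp add: kcomp_def)
qed

section \<open>Arithmetic, connectives, number quantifiers and search\<close>

lemma kcomp_cong: "kcomp C s \<Longrightarrow> (\<And>a g. (a, g) \<in> C \<Longrightarrow> s g = t g) \<Longrightarrow> kcomp C t"
  unfolding kcomp_def by fastforce

lemma dec_cong: "dec C P \<Longrightarrow> (\<And>a g. (a, g) \<in> C \<Longrightarrow> P g = Q g) \<Longrightarrow> dec C Q"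
  unfolding dec_def by (erule kcomp_cong) simp

lemma kcomp_var': "wfc C \<Longrightarrow> kcomp (ext0 (ext0 C)) (\<lambda>x. snd (fst x))"
  using kcomp_extend[OF wfc_extend kcomp_var] .

lemma kcomp_add: "wfc C \<Longrightarrow> kcomp C s \<Longrightarrow> kcomp C t \<Longrightarrow> kcomp C (\<lambda>g. s g + t g)"
proof -
  assume a: "wfc C" "kcomp C s" "kcomp C t"
  have "kcomp C (\<lambda>g. rec_nat (s g) (\<lambda>m k. Suc k) (t g))"
    by (rule kcomp_rec[OF a(2) _ a(3)]) (intro kcomp_Suc kcomp_var' a)
  moreover have "rec_nat a (\<lambda>m k. Suc k) b = a + b" for a b :: nat by (induction b) auto
  ultimately show ?thesis by simp
qed

lemma kcomp_mult: "wfc C \<Longrightarrow> kcomp C s \<Longrightarrow> kcomp C t \<Longrightarrow> kcomp C (\<lambda>g. s g * t g)"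
proof -
  assume a: "wfc C" "kcomp C s" "kcomp C t"
  have "kcomp C (\<lambda>g. rec_nat 0 (\<lambda>m k. k + s g) (t g))"
    by (rule kcomp_rec[OF kcomp_const _ a(3)]) (intro kcomp_add kcomp_var' kcomp_extend wfc_extend a)
  moreover have "rec_nat 0 (\<lambda>m k. k + a) b = a * b" for a b :: nat by (induction b) auto
  ultimately show ?thesis by simp
qed

lemma kcomp_power: "wfc C \<Longrightarrow> kcomp C s \<Longrightarrow> kcomp C t \<Longrightarrow> kcomp C (\<lambda>g. s g ^ t g)"
proof -
  assume a: "wfc C" "kcomp C s" "kcomp C t"
  have "kcomp C (\<lambda>g. rec_nat 1 (\<lambda>m k. s g * k) (t g))"
    by (rule kcomp_rec[OF kcomp_const _ a(3)]) (intro kcomp_mult kcomp_var' kcomp_extend wfc_extend a)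
  moreover have "rec_nat 1 (\<lambda>m k. a * k) b = a ^ b" for a b :: nat by (induction b) auto
  ultimately show ?thesis by simp
qed

lemma kcomp_diff: "wfc C \<Longrightarrow> kcomp C s \<Longrightarrow> kcomp C t \<Longrightarrow> kcomp C (\<lambda>g. s g - t g)"
proof -
  assume a: "wfc C" "kcomp C s" "kcomp C t"
  have pred: "kcomp D (\<lambda>g. r g - 1)" if "wfc D" "kcomp D r" for D :: "'d ctx" and r
  proof -
    have "kcomp D (\<lambda>g. rec_nat 0 (\<lambda>m k. m) (r g))"
      by (rule kcomp_rec[OF kcomp_const _ that(2)]) (rule kcomp_var)
    moreover have "rec_nat 0 (\<lambda>m k. m) b = b - 1" for b :: nat by (cases b) auto
    ultimately show ?thesis by simp
  qed
  have pred2: "kcomp (ext0 (ext0 C)) (\<lambda>x. snd (fst x) - 1)"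
  proof -
    have "kcomp (ext0 (ext0 C)) (\<lambda>x. rec_nat 0 (\<lambda>m k. m) (snd (fst x)))"
      by (rule kcomp_rec[OF kcomp_const _ kcomp_var']) (rule kcomp_var a)+
    moreover have "rec_nat 0 (\<lambda>m k. m) b = b - 1" for b :: nat by (cases b) auto
    ultimately show ?thesis by simp
  qed
  have "kcomp C (\<lambda>g. rec_nat (s g) (\<lambda>m k. k - 1) (t g))"
    by (rule kcomp_rec[OF a(2) _ a(3)]) (rule pred2)
  moreover have "rec_nat a (\<lambda>m k. k - 1) b = a - b" for a b :: nat by (induction b) auto
  ultimately show ?thesis by simp
qed

lemma dec_const: "dec C (\<lambda>g. P)"
  unfolding dec_def by (rule kcomp_const)

lemma dec_not: "wfc C \<Longrightarrow> dec C P \<Longrightarrow> dec C (\<lambda>g. \<not> P g)"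
proof -
  assume "wfc C" "dec C P"
  then have "kcomp C (\<lambda>g. 1 - (if P g then 1 else 0))"
    unfolding dec_def by (intro kcomp_diff kcomp_const)
  then show ?thesis unfolding dec_def by (rule kcomp_cong) auto
qed

lemma dec_conj: "wfc C \<Longrightarrow> dec C P \<Longrightarrow> dec C Q \<Longrightarrow> dec C (\<lambda>g. P g \<and> Q g)"
proof -
  assume "wfc C" "dec C P" "dec C Q"
  then have "kcomp C (\<lambda>g. (if P g then 1 else 0) * (if Q g then 1 else 0))"
    unfolding dec_def by (intro kcomp_mult)
  then show ?thesis unfolding dec_def by (rule kcomp_cong) auto
qed

lemma dec_disj: "wfc C \<Longrightarrow> dec C P \<Longrightarrow> dec C Q \<Longrightarrow> dec C (\<lambda>g. P g \<or> Q g)"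
  by (rule dec_cong[OF dec_not[OF _ dec_conj[OF _ dec_not dec_not]]]) auto

lemma dec_imp: "wfc C \<Longrightarrow> dec C P \<Longrightarrow> dec C Q \<Longrightarrow> dec C (\<lambda>g. P g \<longrightarrow> Q g)"
  by (rule dec_cong[OF dec_disj[OF _ dec_not]]) auto

lemma dec_le: "wfc C \<Longrightarrow> kcomp C s \<Longrightarrow> kcomp C t \<Longrightarrow> dec C (\<lambda>g. s g \<le> t g)"
proof -
  assume "wfc C" "kcomp C s" "kcomp C t"
  then have "kcomp C (\<lambda>g. 1 - (s g - t g))" by (intro kcomp_diff kcomp_const)
  then show ?thesis unfolding dec_def by (rule kcomp_cong) auto
qed

lemma dec_less: "wfc C \<Longrightarrow> kcomp C s \<Longrightarrow> kcomp C t \<Longrightarrow> dec C (\<lambda>g. s g < (t g :: nat))"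
  unfolding not_le[symmetric] by (intro dec_not dec_le)

lemma dec_eq: "wfc C \<Longrightarrow> kcomp C s \<Longrightarrow> kcomp C t \<Longrightarrow> dec C (\<lambda>g. s g = (t g :: nat))"
  unfolding order_eq_iff by (intro dec_conj dec_le)

lemma kcomp_if:
  "wfc C \<Longrightarrow> dec C P \<Longrightarrow> kcomp C s \<Longrightarrow> kcomp C t \<Longrightarrow> kcomp C (\<lambda>g. if P g then s g else t g)"
proof -
  assume a: "wfc C" "dec C P" "kcomp C s" "kcomp C t"
  then have "kcomp C (\<lambda>g. (if P g then 1 else 0) * s g + (1 - (if P g then 1 else 0)) * t g)"
    unfolding dec_def by (intro kcomp_add kcomp_mult kcomp_diff kcomp_const)
  then show ?thesis by (rule kcomp_cong) auto
qed

lemma dec_if: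
  "wfc C \<Longrightarrow> dec C P \<Longrightarrow> dec C Q \<Longrightarrow> dec C R \<Longrightarrow> dec C (\<lambda>g. if P g then Q g else R g)"
  unfolding if_bool_eq_conj by (intro dec_conj dec_imp dec_not)

lemma dec_extend: "wfc C \<Longrightarrow> dec C P \<Longrightarrow> dec (ext0 C) (\<lambda>x. P (fst x))"
  unfolding dec_def by (rule kcomp_extend)

lemma dec_let: "kcomp C a \<Longrightarrow> dec (ext0 C) (\<lambda>x. P (fst x) (snd x)) \<Longrightarrow> dec C (\<lambda>g. P g (a g))"
  unfolding dec_def by (rule kcomp_let)

text \<open>\<open>E2\<close> looks for zeros and answers \<open>0\<close> on success, so truth
  values are reversed before and after the call.\<close>

lemma dec_ex:
  assumes "wfc C" "dec (ext0 C) (\<lambda>x. P (fst x) (snd x))"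
  shows "dec C (\<lambda>g. \<exists>n. P g n)"
proof -
  have 1: "kcomp (ext0 C) (\<lambda>x. 1 - (if P (fst x) (snd x) then 1 else 0))"
    using assms(2) unfolding dec_def by (intro kcomp_diff kcomp_const wfc_extend assms)
  have "kcomp C (\<lambda>g. E2 (\<lambda>n. 1 - (if P g n then 1 else 0)))"
    by (rule kcomp_call[OF assms(1) has_E2[OF assms(1)],
          of "[\<lambda>g. Ty1 (\<lambda>n. 1 - (if P g n then 1 else 0))]"])
       (auto intro!: ocomp_1 1 simp del: One_nat_def)
  from kcomp_diff[OF assms(1) kcomp_const[of _ 1] this] show ?thesis
    unfolding dec_def by (rule kcomp_cong) (auto simp: E2_def)
qed

lemma dec_all:
  assumes "wfc C" "dec (ext0 C) (\<lambda>x. P (fst x) (snd x))"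
  shows "dec C (\<lambda>g. \<forall>n. P g n)"
  by (rule dec_cong[OF dec_not[OF assms(1) dec_ex[OF assms(1) dec_not[OF wfc_extend assms(2)]]]])
     (auto simp: assms)

text \<open>
  Unbounded search. The search procedure is passed its own index through S9; the recursor S5, whose
  base case must terminate, decides whether to stop.
\<close>

lemma kcomp_Least:
  assumes wf: "wfc C" and P: "dec (ext0 C) (\<lambda>x. P (fst x) (snd x))"
    and ex: "\<And>a g. (a, g) \<in> C \<Longrightarrow> \<exists>n. P g n"
  shows "kcomp C (\<lambda>g. LEAST n. P g n)"
proof -
  obtain L where L: "\<And>a g. (a, g) \<in> C \<Longrightarrow> length a = L" using wfc_length[OF wf] by blast
  \<comment> \<open>The variable in front is the place of the procedure's own index; the number
    tested comes second. The test is \<open>0\<close> on success, so that S5 then takes its base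
    case.\<close>
  have "kcomp (ext0 (ext0 C)) (\<lambda>x. (\<lambda>y. 1 - (if P (fst y) (snd y) then 1 else 0)) (fst x))"
    using P unfolding dec_def by (intro kcomp_extend wfc_extend kcomp_diff kcomp_const wf)
  then obtain t where t: "\<forall>(a, x) \<in> ext0 (ext0 C).
      kleene t a (1 - (if P (fst (fst x)) (snd (fst x)) then 1 else 0))"
    unfolding kcomp_def by blast
  define get where "get k = list_encode [6, k, list_encode [3]]" for k
  have get: "kleene (get k) a m" if "k < length a" "a ! k = Obj (Ty0 m)" for k a m
    unfolding get_def using that by (auto intro!: S6 S3 simp del: list_encode.simps)
  \<comment> \<open>From the stack \<open>c, c, Suc n, m, k, c, n, a\<close> this keeps
    \<open>c, c, Suc n, a\<close>: S9 consumes the first \<open>c\<close>, and the second is the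
    self-reference of the restarted procedure.\<close>
  have "distinct ([0,1,2] @ [7..<7+L])" "set ([0,1,2] @ [7..<7+L]) \<subseteq> {..<7+L}" by auto
  from kleene_reindex[OF this] obtain r where r: "\<And>a n. length a = 7 + L \<Longrightarrow>
      kleene (list_encode [9, L+2]) (map ((!) a) ([0,1,2] @ [7..<7+L])) n \<Longrightarrow> kleene r a n"
    by blast
  define d where "d = list_encode [4, list_encode [4, list_encode [4, r, get 0],
      get 3], list_encode [4, list_encode [1], get 3]]"
  have d: "kleene d (Obj (Ty0 m) # Obj (Ty0 k) # Obj (Ty0 c) # Obj (Ty0 n) # a) N"
    if a: "length a = L" and N: "kleene c (Obj (Ty0 c) # Obj (Ty0 (Suc n)) # a) N" for m k c n a N
    unfolding d_def
  proof (intro S4)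
    let ?l = "Obj (Ty0 m) # Obj (Ty0 k) # Obj (Ty0 c) # Obj (Ty0 n) # a"
    show "kleene (get 3) ?l n" by (rule get) auto
    show "kleene (list_encode [1]) (Obj (Ty0 n) # ?l) (Suc n)" by (rule S1)
    show "kleene (get 3) (Obj (Ty0 (Suc n)) # ?l) c" by (rule get) auto
    show "kleene (get 0) (Obj (Ty0 c) # Obj (Ty0 (Suc n)) # ?l) c" by (rule get) auto
    let ?l7 = "Obj (Ty0 c) # Obj (Ty0 c) # Obj (Ty0 (Suc n)) # ?l"
    have m: "map ((!) ?l7) ([0,1,2] @ [7..<7+L]) = Obj (Ty0 c) # Obj (Ty0 c) # Obj (Ty0 (Suc n)) # a"
    proof -
      have "map ((!) ?l7) [7..<7+L] = map (\<lambda>i. ?l7 ! (7 + i)) [0..<L]"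
        by (auto intro!: nth_equalityI)
      also have "\<dots> = a"
        using a by (auto intro!: nth_equalityI simp: eval_nat_numeral)
      finally show ?thesis by simp
    qed
    show "kleene r ?l7 N"
    proof (rule r)
      show "kleene (list_encode [9, L + 2]) (map ((!) ?l7) ([0,1,2] @ [7..<7+L])) N"
        unfolding m using a N by (intro S9) auto
    qed (use a in simp)
  qed
  \<comment> \<open>On arguments \<open>e, n, a\<close> the number \<open>n\<close> is tested; the
    recursor returns \<open>n\<close> after the answer \<open>0\<close> and restarts at
    \<open>Suc n\<close> after the answer \<open>1\<close>.\<close>
  define e where "e = list_encode [4, list_encode [5, get 1, d], t]"
  have e: "kleene e (Obj (Ty0 e) # Obj (Ty0 n) # a) (LEAST n. P g n)"
    if ag: "(a, g) \<in> C" and "n \<le> (LEAST n. P g n)" for a g n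
    using that(2)
  \<comment> \<open>Downward from the least solution, since termination at \<open>n\<close> rests on
    termination at \<open>Suc n\<close>.\<close>
  proof (induction rule: inc_induct)
    let ?N = "LEAST n. P g n"
    have tt: "kleene t (Obj (Ty0 e) # Obj (Ty0 n) # a) (1 - (if P g n then 1 else 0))" for n
      using ag t by (auto simp: extend_def)
    case base
    have "P g ?N" using ex[OF ag] by (meson LeastI_ex)
    then have "kleene t (Obj (Ty0 e) # Obj (Ty0 ?N) # a) 0" using tt[of ?N] by simp
    then show ?case
      by (subst e_def, intro S4) (auto intro!: S5_0 get simp del: list_encode.simps)
  next
    let ?N = "LEAST n. P g n"
    have tt: "kleene t (Obj (Ty0 e) # Obj (Ty0 n) # a) (1 - (if P g n then 1 else 0))" for n
      using ag t by (auto simp: extend_def)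
    case (step n)
    then have "\<not> P g n" using not_less_Least by blast
    then have "kleene t (Obj (Ty0 e) # Obj (Ty0 n) # a) (Suc 0)" using tt[of n] by simp
    moreover have "kleene (list_encode [5, get 1, d])
        (Obj (Ty0 (Suc 0)) # Obj (Ty0 e) # Obj (Ty0 n) # a) ?N"
    proof (rule S5_Suc)
      show "kleene (list_encode [5, get 1, d]) (Obj (Ty0 0) # Obj (Ty0 e) # Obj (Ty0 n) # a) n"
        by (intro S5_0 get) auto
      show "kleene d (Obj (Ty0 0) # Obj (Ty0 n) # Obj (Ty0 e) # Obj (Ty0 n) # a) ?N"
        by (rule d) (use L ag step in auto)
    qed
    ultimately show ?case by (subst e_def) (rule S4)
  qed
  \<comment> \<open>Supplies the start value \<open>0\<close> and the procedure's own index.\<close>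
  have "kleene (list_encode [4, list_encode [4, e, list_encode [2, e]], list_encode [2, 0]]) a
      (LEAST n. P g n)" if "(a, g) \<in> C" for a g
    using e[OF that, of 0] by (intro S4) (auto intro: S2 simp del: list_encode.simps)
  then show ?thesis unfolding kcomp_def by blast
qed

section \<open>Computability of rational and real numbers\<close>

lemmas kcomp_intros = kcomp_const kcomp_Suc kcomp_var kcomp_add kcomp_mult kcomp_diff kcomp_power
  kcomp_if dec_const dec_not dec_conj dec_disj dec_imp dec_le dec_less dec_eq dec_if dec_ex dec_all
  kcomp_extend wfc_extend

lemma kcomp_swap:
  assumes "wfc C" "kcomp (ext0 (ext0 C)) (\<lambda>x. t (fst (fst x)) (snd (fst x)) (snd x))"
  shows "kcomp (ext0 (ext0 C)) (\<lambda>x. t (fst (fst x)) (snd x) (snd (fst x)))"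
proof -
  obtain L where L: "\<forall>(a, g) \<in> C. length a = L" using wfc_length[OF assms(1)] by blast
  have "map ((!) (x # y # a)) (1 # 0 # map (Suc \<circ> Suc) [0..<length a]) = y # x # a"
    for x y :: arg and a by (simp add: o_def map_nth)
  with L have "kcomp (ext0 (ext0 C)) (\<lambda>x. (\<lambda>x. t (fst (fst x)) (snd (fst x)) (snd x))
      ((\<lambda>((g, m), n). ((g, n), m)) x))"
    by (intro kcomp_reindex[OF assms(2), of "1 # 0 # map (Suc \<circ> Suc) [0..<L]" "L + 2"])
      (auto simp: extend_def distinct_map inj_on_def simp del: list.map)
  then show ?thesis by (simp add: case_prod_unfold)
qed

text \<open>Weakening underneath a bound number, needed whenever a sequence or a cut over
  \<open>C\<close> is used in a larger context.\<close>

lemma kcomp_under: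
  assumes "wfc C" "kcomp (ext0 C) (\<lambda>x. t (fst x) (snd x))"
  shows "kcomp (ext0 (extend c C)) (\<lambda>x. t (fst (fst x)) (snd x))"
proof -
  obtain L where L: "\<forall>(a, g) \<in> C. length a = L" using wfc_length[OF assms(1)] by blast
  have "map ((!) (x # y # a)) (0 # map (Suc \<circ> Suc) [0..<length a]) = x # a"
    for x y :: arg and a by (simp add: o_def map_nth)
  with L have "kcomp (ext0 (extend c C)) (\<lambda>x. (\<lambda>x. t (fst x) (snd x)) ((\<lambda>((g, m), n). (g, n)) x))"
    by (intro kcomp_reindex[OF assms(2), of "0 # map (Suc \<circ> Suc) [0..<L]" "L + 2"])
      (auto simp: extend_def distinct_map inj_on_def simp del: list.map)
  then show ?thesis by (simp add: case_prod_unfold)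
qed

section \<open>Sequences of numbers, and the rationals as quotients\<close>

definition nfam :: "'g ctx \<Rightarrow> ('g \<Rightarrow> nat \<Rightarrow> nat) \<Rightarrow> bool" where
  "nfam C y \<longleftrightarrow> kcomp (ext0 C) (\<lambda>x. y (fst x) (snd x))"

lemma nfam_extend: "wfc C \<Longrightarrow> nfam C y \<Longrightarrow> nfam (ext0 C) (\<lambda>x. y (fst x))"
  unfolding nfam_def by (rule kcomp_under)

lemma nfam_app: "nfam C y \<Longrightarrow> kcomp C n \<Longrightarrow> kcomp C (\<lambda>g. y g (n g))"
  unfolding nfam_def by (rule kcomp_let)

definition ratq :: "nat \<Rightarrow> real" where
  "ratq i = real_of_rat (nat_to_rat_surj i)"

lemma represents_ratq:
  "represents x r \<longleftrightarrow>
     (\<forall>n i. \<bar>ratq (x n) - ratq (x (n + i))\<bar> < 1 / 2 ^ n) \<and> (\<lambda>n. ratq (x n)) \<longlonglongrightarrow> r"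
  unfolding represents_def ratq_def Let_def by (rule refl)

lemma ratq_surj: "q \<in> \<rat> \<Longrightarrow> \<exists>i. ratq i = q"
  unfolding ratq_def Rats_def using surj_nat_to_rat_surj by (metis imageE surj_def)

lemma ratq_Rats: "ratq i \<in> \<rat>"
  unfolding ratq_def by simp

lemma ratq_dense: "x < y \<Longrightarrow> \<exists>i. x < ratq i \<and> ratq i < y"
  using Rats_dense_in_real ratq_surj by metis

text \<open>\<open>int_decode\<close> sends \<open>2 * m\<close> to \<open>m\<close> and
  \<open>2 * m + 1\<close> to \<open>- m - 1\<close>. Integers are kept as differences of natural
  numbers, which are the only values of S1--S9.\<close>

definition pos :: "nat \<Rightarrow> nat" where "pos n = (if even n then n div 2 else 0)"
definition neg :: "nat \<Rightarrow> nat" where "neg n = (if even n then 0 else Suc (n div 2))"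

lemma int_decode_pos_neg: "int_decode n = int (pos n) - int (neg n)"
  unfolding int_decode_def sum_decode_def pos_def neg_def by auto

text \<open>The pairing has the quadratic graph
  \<open>2 * n = (a + b) * Suc (a + b) + 2 * a\<close>, so each component is found by search, with
  the other one quantified away.\<close>

lemma kcomp_fst_snd_decode:
  assumes "wfc C" "kcomp C t"
  shows "kcomp C (\<lambda>g. fst (prod_decode (t g)))" "kcomp C (\<lambda>g. snd (prod_decode (t g)))"
proof -
  have tr: "prod_encode (a, b) = n \<longleftrightarrow> 2 * n = (a + b) * Suc (a + b) + 2 * a" for a b n
    unfolding prod_encode_def triangle_def by auto
  have 1: "(\<exists>b. prod_encode (a, b) = n) \<longleftrightarrow> a = fst (prod_decode n)" for a n
    by (metis prod.collapse prod_decode_inverse prod_encode_inverse fst_conv)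
  have 2: "(\<exists>a. prod_encode (a, b) = n) \<longleftrightarrow> b = snd (prod_decode n)" for b n
    by (metis prod.collapse prod_decode_inverse prod_encode_inverse snd_conv)
  have "kcomp C (\<lambda>g. LEAST a. \<exists>b. 2 * t g = (a + b) * Suc (a + b) + 2 * a)"
    by (intro kcomp_Least kcomp_intros assms) (unfold tr[symmetric] 1, blast)
  then show "kcomp C (\<lambda>g. fst (prod_decode (t g)))"
    unfolding tr[symmetric] 1 by (rule kcomp_cong) (simp add: Least_equality)
  have "kcomp C (\<lambda>g. LEAST b. \<exists>a. 2 * t g = (a + b) * Suc (a + b) + 2 * a)"
    by (intro kcomp_Least kcomp_intros assms) (unfold tr[symmetric] 2, blast)
  then show "kcomp C (\<lambda>g. snd (prod_decode (t g)))"
    unfolding tr[symmetric] 2 by (rule kcomp_cong) (simp add: Least_equality)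
qed

lemma kcomp_pos_neg:
  assumes "wfc C" "kcomp C t"
  shows "kcomp C (\<lambda>g. pos (t g))" "kcomp C (\<lambda>g. neg (t g))"
proof -
  have 1: "(LEAST m. n < 2 * m + 2) = n div 2" for n :: nat
    by (rule Least_equality) auto
  have 2: "even n \<longleftrightarrow> (\<exists>m. n = 2 * m)" for n :: nat by (auto elim!: evenE)
  have 3: "kcomp C (\<lambda>g. LEAST m. t g < 2 * m + 2)"
    by (intro kcomp_Least kcomp_intros assms) presburger
  have 4: "dec C (\<lambda>g. even (t g))"
    unfolding 2 by (intro kcomp_intros assms)
  show "kcomp C (\<lambda>g. pos (t g))"
    unfolding pos_def by (intro kcomp_intros assms 4 3[unfolded 1])
  show "kcomp C (\<lambda>g. neg (t g))"
    unfolding neg_def by (intro kcomp_intros assms 4 3[unfolded 1])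
qed

text \<open>
  \<open>ratq i = (num_pos i - num_neg i) / denom i\<close>; squaring the denominator disposes of its sign.
\<close>

definition denom :: "nat \<Rightarrow> nat" where
  "denom i = (let d = snd (prod_decode i) in
     if pos d + neg d = 0 then 1 else (pos d + neg d) * (pos d + neg d))"

definition num_pos :: "nat \<Rightarrow> nat" where
  "num_pos i = (let n = fst (prod_decode i); d = snd (prod_decode i) in pos n * pos d + neg n * neg d)"

definition num_neg :: "nat \<Rightarrow> nat" where
  "num_neg i = (let n = fst (prod_decode i); d = snd (prod_decode i) in pos n * neg d + neg n * pos d)"

lemma denom_pos: "0 < denom i"
  unfolding denom_def Let_def by auto

text \<open>When the coded denominator is \<open>0\<close>, both numerators vanish and
  \<open>denom\<close> is \<open>1\<close>, in agreement with division by zero being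
  \<open>0\<close>.\<close>

lemma ratq_eq: "ratq i = (real (num_pos i) - real (num_neg i)) / real (denom i)"
proof -
  obtain n d where i: "prod_decode i = (n, d)" by force
  have "pos d = 0 \<or> neg d = 0" by (auto simp: pos_def neg_def)
  moreover have "ratq i = (real (pos n) - real (neg n)) / (real (pos d) - real (neg d))"
    unfolding ratq_def nat_to_rat_surj_def i Let_def case_prod_conv int_decode_pos_neg
    by (simp add: of_rat_divide Fract_of_int_quotient of_rat_diff)
  ultimately show ?thesis
    unfolding denom_def num_pos_def num_neg_def Let_def i
    by (auto simp: field_simps)
qed

lemma kcomp_rat_parts:
  assumes "wfc C" "kcomp C t"
  shows "kcomp C (\<lambda>g. denom (t g))" "kcomp C (\<lambda>g. num_pos (t g))" "kcomp C (\<lambda>g. num_neg (t g))"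
  unfolding denom_def num_pos_def num_neg_def Let_def
  by (intro kcomp_intros kcomp_pos_neg kcomp_fst_snd_decode assms)+

text \<open>A real depending on the context is computable modulo \<open>\<exists>\<^sup>2\<close> iff its lower Dedekind cut is decidable.\<close>

definition rcomp :: "'g ctx \<Rightarrow> ('g \<Rightarrow> real) \<Rightarrow> bool" where
  "rcomp C r \<longleftrightarrow> dec (ext0 C) (\<lambda>x. ratq (snd x) < r (fst x))"

definition rfam :: "'g ctx \<Rightarrow> ('g \<Rightarrow> nat \<Rightarrow> real) \<Rightarrow> bool" where
  "rfam C s \<longleftrightarrow> rcomp (ext0 C) (\<lambda>x. s (fst x) (snd x))"

lemma rcomp_cong: "rcomp C r \<Longrightarrow> (\<And>a g. (a, g) \<in> C \<Longrightarrow> r g = s g) \<Longrightarrow> rcomp C s"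
  unfolding rcomp_def by (erule dec_cong) (auto simp: extend_def)

lemma rcomp_extend: "wfc C \<Longrightarrow> rcomp C r \<Longrightarrow> rcomp (extend c C) (\<lambda>x. r (fst x))"
  unfolding rcomp_def dec_def by (rule kcomp_under)

text \<open>In the cut of \<open>s g n\<close> the rational is the innermost variable; exchanging it
  with \<open>n\<close> brings \<open>n\<close> to the place where \<open>dec_let\<close>
  substitutes.\<close>

lemma rfam_app:
  assumes wf: "wfc C" and s: "rfam C s" and n: "kcomp C n"
  shows "rcomp C (\<lambda>g. s g (n g))"
proof -
  have "dec (ext0 (ext0 C)) (\<lambda>x. ratq (snd (fst x)) < s (fst (fst x)) (snd x))"
    using s unfolding rfam_def rcomp_def dec_def
    by (rule kcomp_swap[OF wf, of "\<lambda>g m n. if ratq n < s g m then 1 else 0"])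
  from dec_let[OF kcomp_extend[OF wf n] this]
  show ?thesis unfolding rcomp_def .
qed

lemma rfam_extend:
  assumes wf: "wfc C" and s: "rfam C s"
  shows "rfam (extend c C) (\<lambda>x. s (fst x))"
proof -
  obtain L where L: "\<forall>(a, g) \<in> C. length a = L" using wfc_length[OF wf] by blast
  have m: "map ((!) (x # y # z # a)) (0 # 1 # map (Suc \<circ> Suc \<circ> Suc) [0..<length a]) = x # y # a"
    for x y z :: arg and a by (simp add: o_def map_nth)
  note s' = s[unfolded rfam_def rcomp_def dec_def]
  from m L have "kcomp (ext0 (ext0 (extend c C))) (\<lambda>x. (\<lambda>x. if ratq (snd x) < s (fst (fst x)) (snd (fst x)) then 1 else 0)
     ((\<lambda>(((g, k), m), n). ((g, m), n)) x))"
    by (intro kcomp_reindex[OF s', of "0 # 1 # map (Suc \<circ> Suc \<circ> Suc) [0..<L]" "L + 3"])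
      (auto simp: extend_def distinct_map inj_on_def simp del: list.map)
  then show ?thesis unfolding rfam_def rcomp_def dec_def by (simp add: case_prod_unfold)
qed

section \<open>Cuts of fractions, comparison, limits, sums and products\<close>

lemma rcomp_frac:
  assumes wf: "wfc C" and abc: "kcomp C a" "kcomp C b" "kcomp C c"
    and pos: "\<And>x g. (x, g) \<in> C \<Longrightarrow> 0 < c g"
  shows "rcomp C (\<lambda>g. (real (a g) - real (b g)) / real (c g))"
proof -
  have "dec (ext0 C) (\<lambda>x. num_pos (snd x) * c (fst x) + b (fst x) * denom (snd x)
          < a (fst x) * denom (snd x) + num_neg (snd x) * c (fst x))"
    by (intro kcomp_intros kcomp_rat_parts abc wf)
  moreover have "num_pos i * c g + b g * denom i < a g * denom i + num_neg i * c g \<longleftrightarrow>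
     ratq i < (real (a g) - real (b g)) / real (c g)" if "(x, g) \<in> C" for x g i
  proof -
    have "ratq i < (real (a g) - real (b g)) / real (c g) \<longleftrightarrow>
      real (num_pos i * c g + b g * denom i) < real (a g * denom i + num_neg i * c g)"
      using denom_pos[of i] pos[OF that] unfolding ratq_eq by (simp add: field_simps)
    then show ?thesis unfolding of_nat_less_iff by simp
  qed
  ultimately show ?thesis
    unfolding rcomp_def by (elim dec_cong) (auto simp: extend_def)
qed

lemma rcomp_ratq: "wfc C \<Longrightarrow> kcomp C t \<Longrightarrow> rcomp C (\<lambda>g. ratq (t g))"
  unfolding ratq_eq by (intro rcomp_frac kcomp_rat_parts denom_pos)

lemma rcomp_nat: "wfc C \<Longrightarrow> kcomp C t \<Longrightarrow> rcomp C (\<lambda>g. real (t g))"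
  using rcomp_frac[of C t "\<lambda>_. 0" "\<lambda>_. 1"] by (simp add: kcomp_const)

lemma rcomp_zero: "wfc C \<Longrightarrow> rcomp C (\<lambda>g. 0)"
  using rcomp_nat[of C "\<lambda>_. 0"] by (simp add: kcomp_const)

lemma rcomp_one: "wfc C \<Longrightarrow> rcomp C (\<lambda>g. 1)"
  using rcomp_nat[of C "\<lambda>_. 1"] by (simp add: kcomp_const)

lemma rcomp_numeral: "wfc C \<Longrightarrow> rcomp C (\<lambda>g. numeral k)"
  using rcomp_nat[of C "\<lambda>_. numeral k"] by (simp add: kcomp_const)

lemma rcomp_inverse_power: "wfc C \<Longrightarrow> kcomp C t \<Longrightarrow> rcomp C (\<lambda>g. 1 / 2 ^ t g)"
  using rcomp_frac[of C "\<lambda>_. 1" "\<lambda>_. 0" "\<lambda>g. 2 ^ t g"] by (simp add: kcomp_intros)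

text \<open>A rational outside the lower cut of \<open>r\<close> and inside that of \<open>s\<close>
  witnesses \<open>r < s\<close>, so a comparison of reals costs one number quantifier.\<close>

lemma dec_rless: 
  assumes "wfc C" "rcomp C r" "rcomp C s"
  shows "dec C (\<lambda>g. r g < s g)"
proof -
  have "dec C (\<lambda>g. \<exists>i. \<not> ratq i < r g \<and> ratq i < s g)"
    using assms(2,3) unfolding rcomp_def by (intro kcomp_intros assms)
  moreover have "(\<exists>i. \<not> ratq i < a \<and> ratq i < b) \<longleftrightarrow> a < b" for a b
    using ratq_dense[of a b] by (auto simp: not_less intro: less_imp_le)
  ultimately show ?thesis by simp
qed

lemma dec_rle: "wfc C \<Longrightarrow> rcomp C r \<Longrightarrow> rcomp C s \<Longrightarrow> dec C (\<lambda>g. r g \<le> s g)"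
  unfolding not_less[symmetric] by (intro dec_not dec_rless)

lemma dec_req: "wfc C \<Longrightarrow> rcomp C r \<Longrightarrow> rcomp C s \<Longrightarrow> dec C (\<lambda>g. r g = s g)"
  unfolding order_eq_iff by (intro dec_conj dec_rle)

lemma rcomp_if:
  "wfc C \<Longrightarrow> dec C P \<Longrightarrow> rcomp C r \<Longrightarrow> rcomp C s \<Longrightarrow> rcomp C (\<lambda>g. if P g then r g else s g)"
  using dec_if[of "ext0 C" "\<lambda>x. P (fst x)" "\<lambda>x. ratq (snd x) < r (fst x)" "\<lambda>x. ratq (snd x) < s (fst x)"]
  unfolding rcomp_def by (simp add: wfc_extend dec_extend if_distrib)

text \<open>No rate of convergence is required: \<open>q\<close> is below the limit iff some
  rational above \<open>q\<close> is eventually below the sequence, and this is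
  arithmetical.\<close>

lemma rcomp_lim:
  assumes wf: "wfc C" and s: "rfam C s" and lim: "\<And>a g. (a, g) \<in> C \<Longrightarrow> s g \<longlonglongrightarrow> r g"
  shows "rcomp C r"
proof -
  have "dec (ext0 C) (\<lambda>x. \<exists>i N. ratq (snd x) < ratq i \<and> (\<forall>n. N \<le> n \<longrightarrow> ratq i < s (fst x) n))"
    by (intro kcomp_intros dec_rless rcomp_ratq rfam_app rfam_extend s wf)
  moreover have "(\<exists>i N. q < ratq i \<and> (\<forall>n. N \<le> n \<longrightarrow> ratq i < s g n)) \<longleftrightarrow> q < r g"
    if "(a, g) \<in> C" for a g q
  proof
    assume "\<exists>i N. q < ratq i \<and> (\<forall>n. N \<le> n \<longrightarrow> ratq i < s g n)"
    then obtain i N where "q < ratq i" "\<And>n. N \<le> n \<Longrightarrow> ratq i \<le> s g n" by (auto intro: less_imp_le)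
    moreover from this have "ratq i \<le> r g" by (intro LIMSEQ_le_const[OF lim[OF that]]) blast
    ultimately show "q < r g" by simp
  next
    assume "q < r g"
    then obtain i where i: "q < ratq i" "ratq i < r g" using ratq_dense by blast
    then have "eventually (\<lambda>n. ratq i < s g n) sequentially"
      using order_tendstoD(1)[OF lim[OF that]] by blast
    then show "\<exists>i N. q < ratq i \<and> (\<forall>n. N \<le> n \<longrightarrow> ratq i < s g n)"
      using i unfolding eventually_sequentially by blast
  qed
  ultimately show ?thesis
    unfolding rcomp_def by (elim dec_cong) (force simp: extend_def simp del: ex_simps)
qed

lemma rcomp_ratq_add:
  "wfc C \<Longrightarrow> kcomp C i \<Longrightarrow> kcomp C j \<Longrightarrow> rcomp C (\<lambda>g. ratq (i g) + ratq (j g))"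
proof -
  assume a: "wfc C" "kcomp C i" "kcomp C j"
  have "rcomp C (\<lambda>g.
     (real (num_pos (i g) * denom (j g) + num_pos (j g) * denom (i g)) -
      real (num_neg (i g) * denom (j g) + num_neg (j g) * denom (i g))) /
      real (denom (i g) * denom (j g)))"
    by (intro rcomp_frac kcomp_intros kcomp_rat_parts a) (simp add: denom_pos)
  then show ?thesis
    by (rule rcomp_cong) (use denom_pos in \<open>auto simp: ratq_eq field_simps dest: less_imp_neq\<close>)
qed

lemma rcomp_ratq_mult:
  "wfc C \<Longrightarrow> kcomp C i \<Longrightarrow> kcomp C j \<Longrightarrow> rcomp C (\<lambda>g. ratq (i g) * ratq (j g))"
proof -
  assume a: "wfc C" "kcomp C i" "kcomp C j"
  have "rcomp C (\<lambda>g.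
     (real (num_pos (i g) * num_pos (j g) + num_neg (j g) * num_neg (i g)) -
      real (num_neg (i g) * num_pos (j g) + num_neg (j g) * num_pos (i g))) /
      real (denom (i g) * denom (j g)))"
    by (intro rcomp_frac kcomp_intros kcomp_rat_parts a) (simp add: denom_pos)
  then show ?thesis
    by (rule rcomp_cong) (use denom_pos in \<open>auto simp: ratq_eq field_simps dest: less_imp_neq\<close>)
qed

lemma rcomp_ratq_neg: "wfc C \<Longrightarrow> kcomp C i \<Longrightarrow> rcomp C (\<lambda>g. - ratq (i g))"
proof -
  assume a: "wfc C" "kcomp C i"
  have "rcomp C (\<lambda>g. (real (num_neg (i g)) - real (num_pos (i g))) / real (denom (i g)))"
    by (intro rcomp_frac kcomp_intros kcomp_rat_parts a) (simp add: denom_pos)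
  then show ?thesis by (rule rcomp_cong) (simp add: ratq_eq minus_divide_left)
qed

lemma rcomp_add:
  assumes wf: "wfc C" and r: "rcomp C r" and s: "rcomp C s"
  shows "rcomp C (\<lambda>g. r g + s g)"
proof -
  have "dec (ext0 C) (\<lambda>x. \<exists>i j. ratq i < r (fst x) \<and> ratq j < s (fst x) \<and> ratq (snd x) < ratq i + ratq j)"
    by (intro kcomp_intros dec_rless rcomp_ratq rcomp_ratq_add rcomp_extend r s wf)
  moreover have "(\<exists>i j. ratq i < a \<and> ratq j < b \<and> q < ratq i + ratq j) \<longleftrightarrow> q < a + b" for a b q
  proof
    assume "q < a + b"
    then obtain i where i: "q - b < ratq i" "ratq i < a" using ratq_dense[of "q - b" a] by auto
    then obtain j where "q - ratq i < ratq j" "ratq j < b" using ratq_dense[of "q - ratq i" b] by auto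
    with i show "\<exists>i j. ratq i < a \<and> ratq j < b \<and> q < ratq i + ratq j"
      by (intro exI[of _ i] exI[of _ j]) auto
  qed auto
  ultimately show ?thesis unfolding rcomp_def by simp
qed

lemma rcomp_neg:
  assumes wf: "wfc C" and r: "rcomp C r"
  shows "rcomp C (\<lambda>g. - r g)"
proof -
  have "dec (ext0 C) (\<lambda>x. r (fst x) < - ratq (snd x))"
    by (intro kcomp_intros dec_rless rcomp_ratq_neg rcomp_extend r wf)
  then show ?thesis unfolding rcomp_def by (rule dec_cong) auto
qed

lemma rcomp_diff: "wfc C \<Longrightarrow> rcomp C r \<Longrightarrow> rcomp C s \<Longrightarrow> rcomp C (\<lambda>g. r g - s g)"
  unfolding diff_conv_add_uminus by (intro rcomp_add rcomp_neg)

lemma rcomp_abs: "wfc C \<Longrightarrow> rcomp C r \<Longrightarrow> rcomp C (\<lambda>g. \<bar>r g\<bar>)"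
  unfolding abs_if by (intro rcomp_if dec_rless rcomp_neg rcomp_zero)

lemma rcomp_max: "wfc C \<Longrightarrow> rcomp C r \<Longrightarrow> rcomp C s \<Longrightarrow> rcomp C (\<lambda>g. max (r g) (s g))"
  unfolding max_def by (intro rcomp_if dec_rle)

lemma rcomp_min: "wfc C \<Longrightarrow> rcomp C r \<Longrightarrow> rcomp C s \<Longrightarrow> rcomp C (\<lambda>g. min (r g) (s g))"
  unfolding min_def by (intro rcomp_if dec_rle)

text \<open>A name that depends on the real alone, whence the objects built from it are extensional.
  Two errors below \<open>1 / 2 ^ Suc n\<close> add up to the modulus \<open>1 / 2 ^ n\<close> of
  \<open>represents\<close>.\<close>

definition name :: "real \<Rightarrow> nat \<Rightarrow> nat" where
  "name r n = (LEAST i. \<bar>ratq i - r\<bar> < 1 / 2 ^ Suc n)"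

lemma name_approx: "\<bar>ratq (name r n) - r\<bar> < 1 / 2 ^ Suc n"
proof -
  have "\<exists>i. \<bar>ratq i - r\<bar> < 1 / 2 ^ Suc n"
    using ratq_dense[of "r - 1 / 2 ^ Suc n" "r + 1 / 2 ^ Suc n"]
    by (simp add: abs_less_iff) (smt (verit) field_sum_of_halves)
  then show ?thesis unfolding name_def by (rule LeastI_ex)
qed

lemma represents_name: "represents (name r) r"
  unfolding represents_ratq
proof (intro conjI allI)
  fix n i
  have "(1 :: real) / 2 ^ Suc (n + i) \<le> 1 / 2 ^ Suc n"
    by (intro divide_left_mono power_increasing) auto
  then have "\<bar>ratq (name r n) - ratq (name r (n + i))\<bar> < 1 / 2 ^ Suc n + 1 / 2 ^ Suc n"
    using name_approx[of r n] name_approx[of r "n + i"] by linarith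
  also have "\<dots> = 1 / 2 ^ n" by simp
  finally show "\<bar>ratq (name r n) - ratq (name r (n + i))\<bar> < 1 / 2 ^ n" .
next
  have "(\<lambda>n. 1 / 2 ^ Suc n :: real) \<longlonglongrightarrow> 0"
    using LIMSEQ_Suc[OF LIMSEQ_power_zero[of "1/2 :: real"]] by (simp add: power_one_over)
  then have "(\<lambda>n. ratq (name r n) - r) \<longlonglongrightarrow> 0"
    by (rule Lim_null_comparison[rotated]) (intro always_eventually allI, unfold real_norm_def,
        intro less_imp_le name_approx)
  then show "(\<lambda>n. ratq (name r n)) \<longlonglongrightarrow> r" by (rule LIM_zero_cancel)
qed

lemma nfam_name:
  assumes wf: "wfc C" and r: "rcomp C r"
  shows "nfam C (\<lambda>g. name (r g))"
proof -
  have "kcomp (ext0 C) (\<lambda>x. LEAST i. \<bar>ratq i - r (fst x)\<bar> < 1 / 2 ^ Suc (snd x))"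
  proof (rule kcomp_Least)
    show "dec (ext0 (ext0 C)) (\<lambda>y. \<bar>ratq (snd y) - r (fst (fst y))\<bar> < 1 / 2 ^ Suc (snd (fst y)))"
      by (intro kcomp_intros dec_rless rcomp_abs rcomp_diff rcomp_ratq rcomp_extend rcomp_inverse_power r wf)
    show "\<exists>i. \<bar>ratq i - r (fst x)\<bar> < 1 / 2 ^ Suc (snd x)" for x :: "_ \<times> nat"
      using name_approx by blast
  qed (intro wfc_extend wf)
  then show ?thesis unfolding nfam_def name_def .
qed

lemma kcomp_name: "wfc C \<Longrightarrow> rcomp C r \<Longrightarrow> kcomp C n \<Longrightarrow> kcomp C (\<lambda>g. name (r g) (n g))"
  by (rule nfam_app[OF nfam_name])

text \<open>A product of cuts would require a distinction of signs; products of rational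
  approximations only require a limit.\<close>

lemma rcomp_mult:
  assumes wf: "wfc C" and r: "rcomp C r" and s: "rcomp C s"
  shows "rcomp C (\<lambda>g. r g * s g)"
proof (rule rcomp_lim[OF wf])
  show "rfam C (\<lambda>g n. ratq (name (r g) n) * ratq (name (s g) n))"
    unfolding rfam_def
    by (intro rcomp_ratq_mult kcomp_name kcomp_var rcomp_extend wfc_extend wf r s)
  show "(\<lambda>n. ratq (name (r g) n) * ratq (name (s g) n)) \<longlonglongrightarrow> r g * s g" for g
    using represents_name unfolding represents_ratq by (intro tendsto_mult) auto
qed

lemma represents_unique: "represents u r \<Longrightarrow> represents u s \<Longrightarrow> r = s"
  unfolding represents_ratq using LIMSEQ_unique by blast

text \<open>Together with \<open>nfam_name\<close> this passes between names, which are inputs and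
  outputs, and cuts, with which one computes.\<close>

lemma rcomp_represents:
  assumes wf: "wfc C" and y: "nfam C y" and r: "\<And>a g. (a, g) \<in> C \<Longrightarrow> represents (y g) (r g)"
  shows "rcomp C r"
proof (rule rcomp_lim[OF wf])
  show "rfam C (\<lambda>g n. ratq (y g n))"
    unfolding rfam_def using y unfolding nfam_def by (intro rcomp_ratq wfc_extend wf)
qed (use r in \<open>simp add: represents_ratq\<close>)

text \<open>The value \<open>0\<close> off the names makes this a total function of the sequence,
  and by \<open>representable_iff\<close> the case distinction is arithmetical.\<close>

definition lim_of :: "(nat \<Rightarrow> nat) \<Rightarrow> real" where
  "lim_of u = (if \<exists>r. represents u r then THE r. represents u r else 0)"

lemma lim_of_eq: "represents u r \<Longrightarrow> lim_of u = r"
  unfolding lim_of_def using represents_unique by (auto intro!: the_equality)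

lemma representable_iff:
  "(\<exists>r. represents u r) \<longleftrightarrow> (\<forall>n i. \<bar>ratq (u n) - ratq (u (n + i))\<bar> < 1 / 2 ^ n)"
proof
  assume H: "\<forall>n i. \<bar>ratq (u n) - ratq (u (n + i))\<bar> < 1 / 2 ^ n"
  have "Cauchy (\<lambda>n. ratq (u n))"
  proof (rule metric_CauchyI)
    fix e :: real assume "0 < e"
    then obtain n where n: "(1/2 :: real) ^ n < e / 2"
      using real_arch_pow_inv[of "e/2" "1/2"] by auto
    have "dist (ratq (u m)) (ratq (u k)) < e" if "n \<le> m" "n \<le> k" for m k
    proof -
      from that obtain i j where "m = n + i" "k = n + j" unfolding le_iff_add by blast
      with H[rule_format, of n i] H[rule_format, of n j] n show ?thesis
        unfolding dist_real_def power_one_over \<open>m = n + i\<close> \<open>k = n + j\<close> by linarith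
    qed
    then show "\<exists>M. \<forall>m\<ge>M. \<forall>n\<ge>M. dist (ratq (u m)) (ratq (u n)) < e" by blast
  qed
  then show "\<exists>r. represents u r"
    using H unfolding represents_ratq by (auto simp: Cauchy_convergent_iff convergent_def)
qed (auto simp: represents_ratq)

lemma rcomp_lim_of:
  assumes wf: "wfc C" and u: "nfam C u"
  shows "rcomp C (\<lambda>g. lim_of (u g))"
proof (rule rcomp_lim[OF wf])
  let ?s = "\<lambda>g n. if \<forall>n i. \<bar>ratq (u g n) - ratq (u g (n + i))\<bar> < 1 / 2 ^ n then ratq (u g n) else 0"
  show "rfam C ?s"
    unfolding rfam_def
    by (intro rcomp_if kcomp_intros dec_rless rcomp_abs rcomp_diff rcomp_ratq rcomp_inverse_power
        rcomp_zero nfam_app[of _ "\<lambda>x. u (fst x)"] nfam_app[of _ "\<lambda>x. u (fst (fst (fst x)))"]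
        nfam_extend wf u)
  show "?s g \<longlonglongrightarrow> lim_of (u g)" for g
  proof (cases "\<exists>r. represents (u g) r")
    case True
    then obtain r where "represents (u g) r" by blast
    then show ?thesis using lim_of_eq by (auto simp: represents_ratq)
  next
    case False
    then show ?thesis unfolding representable_iff[symmetric] by (simp add: lim_of_def del: not_ex)
  qed
qed

lemma nfam_var: "wfc C \<Longrightarrow> nfam (ext1 C) (\<lambda>x. snd x)"
  unfolding nfam_def
  by (rule kcomp_apply_var[where u = "\<lambda>x. snd (fst x)" and t = snd, OF has_extend[OF has_var1] kcomp_var])

lemma rcomp_var: "wfc C \<Longrightarrow> rcomp (ext1 C) (\<lambda>x. lim_of (snd x))"
  by (intro rcomp_lim_of nfam_var wfc_extend)

section \<open>Regulated functions\<close>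

lemma eventually_unit_interval:
  fixes x :: real
  assumes "x \<in> {0..1}" "0 < x \<Longrightarrow> eventually P (at_left x)" "x < 1 \<Longrightarrow> eventually P (at_right x)"
  shows "eventually P (at x within {0..1})"
proof -
  consider "x = 0" | "x = 1" | "0 < x" "x < 1" using assms(1) by force
  then show ?thesis
  proof cases
    case 1
    then show ?thesis using assms(3) by (simp add: at_within_Icc_at_right)
  next
    case 2
    then show ?thesis using assms(2) by (simp add: at_within_Icc_at_left)
  next
    case 3
    then show ?thesis using assms(2,3) by (simp add: at_within_Icc_at eventually_at_split)
  qed
qed

lemma at_left_le_unit: "x \<in> {0<..1} \<Longrightarrow> at_left x \<le> at x within {0..1 :: real}"
  using at_within_Icc_at_left[of 0 x] at_le[of "{0..x}" "{0..1}" x] by auto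

lemma at_right_le_unit: "x \<in> {0..<1} \<Longrightarrow> at_right x \<le> at x within {0..1 :: real}"
  using at_within_Icc_at_right[of x 1] at_le[of "{x..1}" "{0..1}" x] by auto

lemma at_unit_nontrivial: "x \<in> {0..1} \<Longrightarrow> at x within {0..1 :: real} \<noteq> bot"
  by (simp add: trivial_limit_within islimpt_Icc)

text \<open>Infinitely many exceptions would accumulate at some \<open>x\<close>, but near
  \<open>x\<close> there are none except possibly \<open>x\<close> itself.\<close>

lemma finite_if_locally_eventually:
  fixes P :: "real \<Rightarrow> bool"
  assumes "\<And>x. x \<in> {0..1} \<Longrightarrow> eventually (\<lambda>t. \<not> P t) (at x within {0..1})"
  shows "finite {t \<in> {0..1}. P t}"
proof (rule ccontr)
  assume "infinite {t \<in> {0..1}. P t}"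
  then obtain x where x: "x \<in> {0..1}" "x islimpt {t \<in> {0..1}. P t}"
    using Heine_Borel_imp_Bolzano_Weierstrass[of "{0..1 :: real}" "{t \<in> {0..1}. P t}"]
    by (metis (no_types, lifting) compact_Icc mem_Collect_eq subsetI)
  from assms[OF x(1)] have "eventually (\<lambda>t. t \<notin> {t \<in> {0..1}. P t}) (at x)"
    unfolding eventually_at_filter by (rule eventually_mono) auto
  with x(2) show False unfolding islimpt_iff_eventually by blast
qed

lemma eventually_left_interval:
  fixes x :: real
  assumes "eventually P (at_left x)" "c < x"
  obtains d where "c < d" "d < x" "\<And>t. t \<in> {d<..<x} \<Longrightarrow> P t"
proof -
  obtain d where d: "d < x" "\<forall>t>d. t < x \<longrightarrow> P t"
    using assms(1) unfolding eventually_at_left_field by blast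
  obtain d' where "max c d < d'" "d' < x" using dense[of "max c d" x] d(1) assms(2) by auto
  with d that[of d'] show thesis by auto
qed

lemma eventually_right_interval:
  fixes x :: real
  assumes "eventually P (at_right x)" "x < c"
  obtains d where "x < d" "d < c" "\<And>t. t \<in> {x<..<d} \<Longrightarrow> P t"
proof -
  obtain d where d: "x < d" "\<forall>t>x. t < d \<longrightarrow> P t"
    using assms(1) unfolding eventually_at_right_field by blast
  obtain d' where "x < d'" "d' < min c d" using dense[of x "min c d"] d(1) assms(2) by auto
  with d that[of d'] show thesis by auto
qed

text \<open>The scaling of the step makes \<open>lval f 0 = f 0\<close> and \<open>rval f 1 = f 1\<close>.\<close>

definition lval :: "(real \<Rightarrow> real) \<Rightarrow> real \<Rightarrow> real" where
  "lval f x = lim (\<lambda>n. f (x - x * (1 / 2 ^ Suc n)))"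

definition rval :: "(real \<Rightarrow> real) \<Rightarrow> real \<Rightarrow> real" where
  "rval f x = lim (\<lambda>n. f (x + (1 - x) * (1 / 2 ^ Suc n)))"

lemma inverse_powers_null: "(\<lambda>n. 1 / 2 ^ Suc n :: real) \<longlonglongrightarrow> 0"
  using LIMSEQ_Suc[OF LIMSEQ_power_zero[of "1/2 :: real"]] by (simp add: power_one_over)

lemma lval_seq:
  fixes x :: real
  assumes "0 < x"
  shows "filterlim (\<lambda>n. x - x * (1 / 2 ^ Suc n)) (at_left x) sequentially"
  unfolding filterlim_at
proof
  have "(\<lambda>n. x - x * (1 / 2 ^ Suc n)) \<longlonglongrightarrow> x - x * 0"
    by (intro tendsto_intros inverse_powers_null)
  then show "(\<lambda>n. x - x * (1 / 2 ^ Suc n)) \<longlonglongrightarrow> x" by simp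
qed (use assms in auto)

lemma rval_seq:
  fixes x :: real
  assumes "x < 1"
  shows "filterlim (\<lambda>n. x + (1 - x) * (1 / 2 ^ Suc n)) (at_right x) sequentially"
  unfolding filterlim_at
proof
  have "(\<lambda>n. x + (1 - x) * (1 / 2 ^ Suc n)) \<longlonglongrightarrow> x + (1 - x) * 0"
    by (intro tendsto_intros inverse_powers_null)
  then show "(\<lambda>n. x + (1 - x) * (1 / 2 ^ Suc n)) \<longlonglongrightarrow> x" by simp
qed (use assms in auto)

lemma lval_point:
  assumes "x \<in> {0..1 :: real}"
  shows "x - x * (1 / 2 ^ Suc n) \<in> {0..x}"
proof -
  have "(1 / 2 ^ Suc n :: real) \<le> 1"
    using power_increasing[of 0 "Suc n" "2 :: real"] by simp
  then have "x * (1 / 2 ^ Suc n) \<le> x * 1" using assms by (intro mult_left_mono) auto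
  then show ?thesis using assms by simp
qed

lemma rval_point:
  assumes "x \<in> {0..1 :: real}"
  shows "x + (1 - x) * (1 / 2 ^ Suc n) \<in> {x..1}"
  using lval_point[of "1 - x" n] assms by auto

lemma lval_eqI: "0 < x \<Longrightarrow> (f \<longlongrightarrow> l) (at_left x) \<Longrightarrow> lval f x = l"
  unfolding lval_def by (intro limI filterlim_compose[OF _ lval_seq])

lemma rval_eqI: "x < 1 \<Longrightarrow> (f \<longlongrightarrow> l) (at_right x) \<Longrightarrow> rval f x = l"
  unfolding rval_def by (intro limI filterlim_compose[OF _ rval_seq])

lemma lval_0: "lval f 0 = f 0" and rval_1: "rval f 1 = f 1"
  unfolding lval_def rval_def by (simp_all add: limI)

lemma regulated_left: "regulated f \<Longrightarrow> x \<in> {0<..1} \<Longrightarrow> (f \<longlongrightarrow> lval f x) (at_left x)"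
  unfolding regulated_def using lval_eqI by fastforce

lemma regulated_right: "regulated f \<Longrightarrow> x \<in> {0..<1} \<Longrightarrow> (f \<longlongrightarrow> rval f x) (at_right x)"
  unfolding regulated_def using rval_eqI by fastforce

lemma lval_tendsto:
  assumes "regulated f" "x \<in> {0..1}"
  shows "(\<lambda>n. f (x - x * (1 / 2 ^ Suc n))) \<longlonglongrightarrow> lval f x"
proof (cases "x = 0")
  case False
  then show ?thesis
    using assms by (intro filterlim_compose[OF regulated_left lval_seq]) auto
qed (simp add: lval_0)

lemma rval_tendsto:
  assumes "regulated f" "x \<in> {0..1}"
  shows "(\<lambda>n. f (x + (1 - x) * (1 / 2 ^ Suc n))) \<longlonglongrightarrow> rval f x"
proof (cases "x = 1")
  case False
  then show ?thesis
    using assms by (intro filterlim_compose[OF regulated_right rval_seq]) auto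
qed (simp add: rval_1)

section \<open>Jumps and the set of discontinuities\<close>

definition jump :: "(real \<Rightarrow> real) \<Rightarrow> real \<Rightarrow> real" where
  "jump f x = max \<bar>f x - lval f x\<bar> \<bar>f x - rval f x\<bar>"

definition disc :: "(real \<Rightarrow> real) \<Rightarrow> real set" where
  "disc f = {x \<in> {0..1}. 0 < jump f x}"

lemma tendsto_at_unit_iff:
  assumes "x \<in> {0..1 :: real}"
  shows "(f \<longlongrightarrow> (l :: real)) (at x within {0..1}) \<longleftrightarrow>
     (0 < x \<longrightarrow> (f \<longlongrightarrow> l) (at_left x)) \<and> (x < 1 \<longrightarrow> (f \<longlongrightarrow> l) (at_right x))"
proof (intro iffI conjI impI)
  assume l: "(f \<longlongrightarrow> l) (at x within {0..1})"
  show "(f \<longlongrightarrow> l) (at_left x)" if "0 < x"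
    using that assms by (intro tendsto_mono[OF at_left_le_unit l]) auto
  show "(f \<longlongrightarrow> l) (at_right x)" if "x < 1"
    using that assms by (intro tendsto_mono[OF at_right_le_unit l]) auto
next
  assume "(0 < x \<longrightarrow> (f \<longlongrightarrow> l) (at_left x)) \<and> (x < 1 \<longrightarrow> (f \<longlongrightarrow> l) (at_right x))"
  then show "(f \<longlongrightarrow> l) (at x within {0..1})"
    unfolding tendsto_def by (blast intro: eventually_unit_interval[OF assms])
qed

text \<open>By the conventions for \<open>lval\<close> and \<open>rval\<close> at the endpoints, the
  missing one-sided limit contributes nothing to the jump there.\<close>

lemma cont_at_iff_jump:
  assumes f: "regulated f" and x: "x \<in> {0..1}"
  shows "cont_at f x \<longleftrightarrow> jump f x = 0"
proof -
  have L: "(f \<longlongrightarrow> f x) (at_left x) \<longleftrightarrow> f x = lval f x" if "0 < x"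
    using regulated_left[OF f, of x] x that lval_eqI[of x f "f x"] by auto
  have R: "(f \<longlongrightarrow> f x) (at_right x) \<longleftrightarrow> f x = rval f x" if "x < 1"
    using regulated_right[OF f, of x] x that rval_eqI[of x f "f x"] by auto
  have "cont_at f x \<longleftrightarrow> f x = lval f x \<and> f x = rval f x"
    unfolding continuous_within tendsto_at_unit_iff[OF x]
    using L R lval_0[of f] rval_1[of f] x
    by (cases "x = 0"; cases "x = 1") auto
  then show ?thesis unfolding jump_def by (auto simp: max_def)
qed

lemma disc_eq: "regulated f \<Longrightarrow> disc f = {x \<in> {0..1}. \<not> cont_at f x}"
proof -
  assume "regulated f"
  moreover have "0 \<le> jump f x" for x unfolding jump_def by linarith
  ultimately show ?thesis unfolding disc_def using cont_at_iff_jump[of f] by (auto simp: less_le)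
qed

text \<open>Both one-sided limits at \<open>t\<close> inherit the bound \<open>d\<close> on the
  distance to \<open>l\<close>, as does \<open>f t\<close>; the differences are then at most
  \<open>2 * d\<close>.\<close>

lemma jump_le_oscillation:
  assumes f: "regulated f" and ab: "{a<..<b} \<subseteq> {0..1}" and t: "t \<in> {a<..<b}"
    and osc: "\<And>s. s \<in> {a<..<b} \<Longrightarrow> \<bar>f s - l\<bar> \<le> d"
  shows "jump f t \<le> 2 * d"
proof -
  \<comment> \<open>The inclusion speaks of the open interval only, so midpoints next to
    \<open>t\<close> are used to place \<open>t\<close> strictly between \<open>0\<close> and
    \<open>1\<close>.\<close>
  have "a < (a + t) / 2" "(a + t) / 2 < b" "a < (t + b) / 2" "(t + b) / 2 < b" using t by auto
  then have "(a + t) / 2 \<in> {0..1}" "(t + b) / 2 \<in> {0..1}"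
    by (intro subsetD[OF ab]; simp)+
  then have "0 \<le> (a + t) / 2" "(t + b) / 2 \<le> 1" by auto
  moreover have "(a + t) / 2 < t" "t < (t + b) / 2" using t by auto
  ultimately have t01: "0 < t" "t < 1" by linarith+
  have "eventually (\<lambda>s. s \<in> {a<..<t}) (at_left t)"
    using t by (auto simp: eventually_at_left_field)
  then have "eventually (\<lambda>s. \<bar>f s - l\<bar> \<le> d) (at_left t)"
    by (rule eventually_mono) (use osc t in auto)
  moreover have "((\<lambda>s. \<bar>f s - l\<bar>) \<longlongrightarrow> \<bar>lval f t - l\<bar>) (at_left t)"
    using regulated_left[OF f, of t] t01 by (intro tendsto_intros) auto
  ultimately have 1: "\<bar>lval f t - l\<bar> \<le> d"
    by (intro tendsto_upperbound[of _ _ "at_left t"]) auto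
  have "eventually (\<lambda>s. s \<in> {t<..<b}) (at_right t)"
    using t by (auto simp: eventually_at_right_field)
  then have "eventually (\<lambda>s. \<bar>f s - l\<bar> \<le> d) (at_right t)"
    by (rule eventually_mono) (use osc t in auto)
  moreover have "((\<lambda>s. \<bar>f s - l\<bar>) \<longlongrightarrow> \<bar>rval f t - l\<bar>) (at_right t)"
    using regulated_right[OF f, of t] t01 by (intro tendsto_intros) auto
  ultimately have 2: "\<bar>rval f t - l\<bar> \<le> d"
    by (intro tendsto_upperbound[of _ _ "at_right t"]) auto
  show ?thesis unfolding jump_def using 1 2 osc[OF t] by linarith
qed

text \<open>Close to \<open>x\<close> on either side, \<open>f\<close> is within
  \<open>e / 2\<close> of its limit from that side, so no jump there exceeds \<open>e\<close>;
  compactness does the rest.\<close>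

lemma finite_jump_greater:
  assumes f: "regulated f" and e: "0 < e"
  shows "finite {x \<in> {0..1}. e < jump f x}"
proof (rule finite_if_locally_eventually, rule eventually_unit_interval)
  fix x :: real assume x: "x \<in> {0..1}"
  show "x \<in> {0..1}" by fact
  show "eventually (\<lambda>t. \<not> e < jump f t) (at_left x)" if "0 < x"
  proof -
    have "eventually (\<lambda>t. \<bar>f t - lval f x\<bar> < e / 2) (at_left x)"
      using tendstoD[OF regulated_left[OF f, of x], of "e / 2"] x that e by (auto simp: dist_real_def)
    from eventually_left_interval[OF this that] obtain d
      where d: "0 < d" "d < x" "\<And>t. t \<in> {d<..<x} \<Longrightarrow> \<bar>f t - lval f x\<bar> < e / 2" by blast
    have "\<not> e < jump f t" if "t \<in> {d<..<x}" for t
      using jump_le_oscillation[OF f _ that, of "lval f x" "e / 2"] d x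
      by (force intro: less_imp_le)
    then show ?thesis unfolding eventually_at_left_field using d(2) by auto
  qed
  show "eventually (\<lambda>t. \<not> e < jump f t) (at_right x)" if "x < 1"
  proof -
    have "eventually (\<lambda>t. \<bar>f t - rval f x\<bar> < e / 2) (at_right x)"
      using tendstoD[OF regulated_right[OF f, of x], of "e / 2"] x that e by (auto simp: dist_real_def)
    from eventually_right_interval[OF this that] obtain d
      where d: "x < d" "d < 1" "\<And>t. t \<in> {x<..<d} \<Longrightarrow> \<bar>f t - rval f x\<bar> < e / 2" by blast
    have "\<not> e < jump f t" if "t \<in> {x<..<d}" for t
      using jump_le_oscillation[OF f _ that, of "rval f x" "e / 2"] d x
      by (force intro: less_imp_le)
    then show ?thesis unfolding eventually_at_right_field using d(1) by auto
  qed
qed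

text \<open>The implication lets the search succeed at points without a jump, where it returns
  \<open>0\<close>; the height has to be total to be passed to a functional.\<close>

definition jump_height :: "(real \<Rightarrow> real) \<Rightarrow> real \<Rightarrow> nat" where
  "jump_height f x = (LEAST n. 0 < jump f x \<longrightarrow> 1 / 2 ^ n < jump f x)"

lemma jump_height: "\<exists>n. 0 < jump f x \<longrightarrow> 1 / 2 ^ n < jump f x"
  using real_arch_pow_inv[of "jump f x" "1/2"] by (auto simp: power_one_over)

lemma is_height_disc:
  assumes "regulated f"
  shows "is_height (jump_height f) (disc f)"
  unfolding is_height_def
proof
  fix n
  have "1 / 2 ^ n < jump f x" if "x \<in> disc f" "jump_height f x < n" for x
  proof -
    have "1 / 2 ^ jump_height f x < jump f x"
      using LeastI_ex[OF jump_height[of f x]] that(1) unfolding jump_height_def disc_def by auto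
    moreover have "(1 :: real) / 2 ^ n \<le> 1 / 2 ^ jump_height f x"
      using that(2) by (intro divide_left_mono power_increasing) auto
    ultimately show ?thesis by linarith
  qed
  then have "{x \<in> disc f. jump_height f x < n} \<subseteq> {x \<in> {0..1}. 1 / 2 ^ n < jump f x}"
    by (auto simp: disc_def)
  then show "finite {x \<in> disc f. jump_height f x < n}"
    using finite_jump_greater[OF assms, of "1 / 2 ^ n"] finite_subset by auto
qed

lemma countable_is_height: "is_height H A \<Longrightarrow> countable A"
proof -
  assume "is_height H A"
  then have "countable (\<Union>n. {x \<in> A. H x < n})"
    unfolding is_height_def by (intro countable_UN) (auto intro: countable_finite)
  moreover have "(\<Union>n. {x \<in> A. H x < n}) = A" by auto
  ultimately show ?thesis by simp
qed

section \<open>Consequences of continuity at a point\<close>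

lemma cont_at_seq:
  assumes "cont_at f y" "\<And>n. s n \<in> {0..1}" "s \<longlonglongrightarrow> y" "y \<in> {0..1}"
  shows "(\<lambda>n. f (s n)) \<longlonglongrightarrow> f y"
  using assms unfolding continuous_within_sequentially by (auto simp: o_def)

lemma cont_at_imp_quasi_cont_at:
  assumes "cont_at f y" "y \<in> {0..1}"
  shows "quasi_cont_at f y"
  unfolding quasi_cont_at_def
proof (intro allI impI)
  fix e :: real and U assume e: "0 < e" and U: "openin (top_of_set {0..1}) U \<and> y \<in> U"
  obtain d where d: "0 < d" "\<And>t. t \<in> {0..1} \<Longrightarrow> dist t y < d \<Longrightarrow> dist (f t) (f y) < e"
    using assms(1) e unfolding continuous_within_eps_delta by blast
  show "\<exists>G. openin (top_of_set {0..1}) G \<and> G \<noteq> {} \<and> G \<subseteq> U \<and> (\<forall>t\<in>G. \<bar>f y - f t\<bar> < e)"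
  proof (intro exI[of _ "U \<inter> ({0..1} \<inter> ball y d)"] conjI ballI)
    show "openin (top_of_set {0..1}) (U \<inter> ({0..1} \<inter> ball y d))"
      using U by (intro openin_Int openin_open_Int) auto
    show "U \<inter> ({0..1} \<inter> ball y d) \<noteq> {}" using U assms(2) d(1) by auto
    show "\<bar>f y - f t\<bar> < e" if "t \<in> U \<inter> ({0..1} \<inter> ball y d)" for t
      using d(2)[of t] that by (auto simp: dist_real_def abs_minus_commute)
  qed auto
qed

lemma cont_at_imp_lower_semicont_at:
  assumes "cont_at f y" "y \<in> {0..1}"
  shows "lower_semicont_at f y"
proof -
  have "((\<lambda>t. ereal (f t)) \<longlongrightarrow> ereal (f y)) (at y within {0..1})"
    using assms(1) by (simp add: continuous_within)
  from lim_imp_Liminf[OF at_unit_nontrivial[OF assms(2)] this]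
  show ?thesis unfolding lower_semicont_at_def by simp
qed

lemma cont_at_imp_darboux_point:
  assumes "cont_at f y" "y \<in> {0..1}"
  shows "darboux_point f y"
proof -
  have "v = f y" if "left_cluster_value f y v \<or> right_cluster_value f y v" for v
    using that cont_at_seq[OF assms(1) _ _ assms(2)] LIMSEQ_unique
    unfolding left_cluster_value_def right_cluster_value_def by metis
  then show ?thesis unfolding darboux_point_def strictly_between_def by fastforce
qed

section \<open>The function coding a weakly countable set\<close>

definition coding_fun :: "(real \<Rightarrow> nat) \<Rightarrow> real set \<Rightarrow> real \<Rightarrow> real" where
  "coding_fun H A x = (if x \<in> A then 1 / 2 ^ Suc (H x) else 0)"

lemma coding_fun_nonneg: "0 \<le> coding_fun H A x"
  and coding_fun_le_1: "coding_fun H A x \<le> 1"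
  and coding_fun_pos_iff: "0 < coding_fun H A x \<longleftrightarrow> x \<in> A"
  and coding_fun_eq_0_iff: "coding_fun H A x = 0 \<longleftrightarrow> x \<notin> A"
  unfolding coding_fun_def using power_increasing[of 0 "Suc (H x)" "2 :: real"] by auto

text \<open>A value of at least \<open>e\<close> bounds the height, and sets of bounded height are
  finite.\<close>

lemma finite_coding_fun_ge:
  assumes "is_height H A" "0 < e"
  shows "finite {x. e \<le> coding_fun H A x}"
proof -
  obtain n where n: "(1/2 :: real) ^ n < e" using real_arch_pow_inv[OF assms(2), of "1/2"] by auto
  have "x \<in> A \<and> H x < n" if "e \<le> coding_fun H A x" for x
  proof -
    have x: "x \<in> A" using that assms(2) coding_fun_pos_iff[of H A x] by linarith
    then have "1 / 2 ^ n < 1 / (2 :: real) ^ Suc (H x)"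
      using that n by (simp add: coding_fun_def power_one_over)
    then have "(2 :: real) ^ Suc (H x) < 2 ^ n" by (simp add: divide_simps)
    then have "Suc (H x) < n" by (rule power_less_imp_less_exp[rotated]) simp
    with x show ?thesis by simp
  qed
  then have "{x. e \<le> coding_fun H A x} \<subseteq> {x \<in> A. H x < n}" by auto
  then show ?thesis using assms(1) finite_subset unfolding is_height_def by blast
qed

lemma coding_fun_tendsto:
  assumes "is_height H A"
  shows "(coding_fun H A \<longlongrightarrow> 0) (at x within S)"
proof (rule tendsto_within_subset[of _ _ _ UNIV], rule tendstoI)
  fix e :: real assume "0 < e"
  from finite_coding_fun_ge[OF assms this]
  have "eventually (\<lambda>t. t \<notin> {x. e \<le> coding_fun H A x}) (at x)"
    using islimpt_iff_eventually islimpt_finite by blast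
  then show "eventually (\<lambda>t. dist (coding_fun H A t) 0 < e) (at x)"
    by (rule eventually_mono) (simp add: dist_real_def coding_fun_nonneg)
qed simp

lemma regulated_coding_fun: "is_height H A \<Longrightarrow> regulated (coding_fun H A)"
  unfolding regulated_def by (intro conjI ballI exI[of _ 0]) (rule coding_fun_tendsto, assumption)+

lemma cont_at_coding_fun:
  assumes "is_height H A" "x \<in> {0..1}"
  shows "cont_at (coding_fun H A) x \<longleftrightarrow> x \<notin> A"
  unfolding continuous_within coding_fun_eq_0_iff[symmetric, where H = H]
  using tendsto_unique[OF at_unit_nontrivial[OF assms(2)] coding_fun_tendsto[OF assms(1)]]
    coding_fun_tendsto[OF assms(1), of x "{0..1}"] by force

text \<open>Quasi-continuity at a point of \<open>A\<close> would give a non-empty relatively open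
  set on which the values are at least half the value at \<open>x\<close>. Such a set is infinite,
  but only finitely many points have such values.\<close>

lemma quasi_cont_at_coding_fun:
  assumes H: "is_height H A" and x: "x \<in> {0..1}" and q: "quasi_cont_at (coding_fun H A) x"
  shows "x \<notin> A"
proof
  let ?f = "coding_fun H A"
  assume "x \<in> A"
  then have p: "0 < ?f x" by (simp add: coding_fun_pos_iff)
  have "openin (top_of_set {0..1}) {0..1 :: real} \<and> x \<in> {0..1}" using x by simp
  then obtain G where G: "openin (top_of_set {0..1}) G" "G \<noteq> {}" "\<And>t. t \<in> G \<Longrightarrow> \<bar>?f x - ?f t\<bar> < ?f x / 2"
    using q p unfolding quasi_cont_at_def by (meson half_gt_zero)
  then have "G \<subseteq> {t. ?f x / 2 \<le> ?f t}" by (smt (verit) field_sum_of_halves mem_Collect_eq subsetI)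
  then have fin: "finite G" using finite_coding_fun_ge[OF H, of "?f x / 2"] p finite_subset by auto
  obtain t where t: "t \<in> G" using G(2) by blast
  from G(1) obtain T where T: "open T" "G = {0..1} \<inter> T" by (auto simp: openin_open)
  have "t islimpt {0..1}" using t T by (simp add: islimpt_Icc)
  then have "infinite (T \<inter> {0..1})" using t T unfolding islimpt_eq_acc_point by blast
  then show False using fin T(2) by (simp add: Int_commute)
qed

lemma lower_semicont_at_coding_fun:
  assumes H: "is_height H A" and x: "x \<in> {0..1}" and q: "lower_semicont_at (coding_fun H A) x"
  shows "x \<notin> A"
proof -
  have "((\<lambda>t. ereal (coding_fun H A t)) \<longlongrightarrow> ereal 0) (at x within {0..1})"
    using coding_fun_tendsto[OF H] by simp
  then have "Liminf (at x within {0..1}) (\<lambda>t. ereal (coding_fun H A t)) = ereal 0"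
    using lim_imp_Liminf[OF at_unit_nontrivial[OF x]] by blast
  then have "coding_fun H A x \<le> 0" using q unfolding lower_semicont_at_def by simp
  then show ?thesis using coding_fun_pos_iff[of H A x] by auto
qed

text \<open>
  The value \<open>0\<close> is a cluster value on at least one side, and \<open>3 / 4 * f x\<close> is not attained,
  since every nonzero value of the coding function is a power of \<open>1 / 2\<close>.
\<close>

lemma darboux_point_coding_fun:
  assumes H: "is_height H A" and x: "x \<in> {0..1}" and q: "darboux_point (coding_fun H A) x"
  shows "x \<notin> A"
proof
  let ?f = "coding_fun H A"
  assume xA: "x \<in> A"
  then have p: "0 < ?f x" by (simp add: coding_fun_pos_iff)
  define z where "z = 3 / 4 * ?f x"
  have z: "strictly_between z 0 (?f x)" using p by (simp add: z_def strictly_between_def)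
  have "?f w \<noteq> z" for w
  proof
    assume w: "?f w = z"
    then have "w \<in> A" using p coding_fun_pos_iff[of H A w] by (simp add: z_def)
    then have "4 * 2 ^ Suc (H x) = 3 * (2 ^ Suc (H w) :: real)"
      using w xA by (simp add: z_def coding_fun_def field_simps)
    then have "real (4 * 2 ^ Suc (H x)) = real (3 * 2 ^ Suc (H w))" by simp
    then have "4 * 2 ^ Suc (H x) = (3 * 2 ^ Suc (H w) :: nat)" by (rule of_nat_eq_iff[THEN iffD1])
    then have "(2 :: nat) ^ (Suc (H x) + 2) = 3 * 2 ^ Suc (H w)" by (simp add: power_add)
    then have "(3 :: nat) dvd 2 ^ (Suc (H x) + 2)" by (rule dvdI)
    then have "(3 :: nat) dvd 2" by (rule prime_dvd_power[rotated]) simp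
    then show False by simp
  qed
  moreover have "left_cluster_value ?f x 0 \<or> right_cluster_value ?f x 0"
  \<comment> \<open>At \<open>0\<close> only the right side is available; everywhere else the left
    side serves.\<close>
  proof (cases "x = 0")
    case False
    define s where "s n = x - x * (1 / 2 ^ Suc n)" for n
    have s: "filterlim s (at_left x) sequentially"
      unfolding s_def using x False by (intro lval_seq) auto
    have "s n \<in> {0..1} \<and> s n \<le> x" for n
      using lval_point[OF x, of n] x unfolding s_def[symmetric] by simp
    moreover have "s \<longlonglongrightarrow> x" using s by (simp add: filterlim_at)
    moreover have "(\<lambda>n. ?f (s n)) \<longlonglongrightarrow> 0"
      using filterlim_compose[OF coding_fun_tendsto[OF H] s] .
    ultimately have "left_cluster_value ?f x 0" unfolding left_cluster_value_def by blast
    then show ?thesis ..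
  next
    case True
    define s where "s n = x + (1 - x) * (1 / 2 ^ Suc n)" for n
    have s: "filterlim s (at_right x) sequentially"
      unfolding s_def using True by (intro rval_seq) auto
    have "s n \<in> {0..1} \<and> x \<le> s n" for n
      using rval_point[OF x, of n] x unfolding s_def[symmetric] by simp
    moreover have "s \<longlonglongrightarrow> x" using s by (simp add: filterlim_at)
    moreover have "(\<lambda>n. ?f (s n)) \<longlonglongrightarrow> 0"
      using filterlim_compose[OF coding_fun_tendsto[OF H] s] .
    ultimately have "right_cluster_value ?f x 0" unfolding right_cluster_value_def by blast
    then show ?thesis ..
  qed
  ultimately show False using q z unfolding darboux_point_def by (metis zero_less_one)
qed

text \<open>A positive lower bound is reached at finitely many points only, so the first output of
  (b) already lies outside \<open>A\<close>, whatever the second is.\<close>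

lemma infinite_range_coding_fun:
  assumes H: "is_height H A"
    and "infinite {x \<in> {0..1}. coding_fun H A a \<le> coding_fun H A x \<and> coding_fun H A x \<le> b}"
  shows "a \<notin> A"
proof
  assume "a \<in> A"
  then have "finite {x. coding_fun H A a \<le> coding_fun H A x}"
    by (intro finite_coding_fun_ge[OF H]) (simp add: coding_fun_pos_iff)
  then show False using assms(2) by (auto elim: rev_finite_subset)
qed

lemma strict_local_max_coding_fun:
  assumes H: "is_height H A" and "x \<in> A"
  shows "strict_local_max (coding_fun H A) x"
proof -
  have "0 < coding_fun H A x" using assms(2) by (simp add: coding_fun_pos_iff)
  then have "eventually (\<lambda>t. coding_fun H A t < coding_fun H A x) (at x)"
    using order_tendstoD(2)[OF coding_fun_tendsto[OF H]] by blast
  then obtain d where d: "0 < d" "\<And>t. t \<noteq> x \<Longrightarrow> dist t x < d \<Longrightarrow> coding_fun H A t < coding_fun H A x"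
    unfolding eventually_at by auto
  obtain N where "(1/2 :: real) ^ N < d" using real_arch_pow_inv[OF d(1), of "1/2"] by auto
  then show ?thesis
    unfolding strict_local_max_def using d(2)
    by (intro exI[of _ N]) (auto simp: dist_commute power_one_over)
qed

lemma only_removable_discontinuities_coding_fun:
  "is_height H A \<Longrightarrow> only_removable_discontinuities (coding_fun H A)"
  unfolding only_removable_discontinuities_def
  by (intro impI ballI exI[of _ 0]) (rule coding_fun_tendsto, assumption)

section \<open>Riemann integration of regulated functions\<close>

text \<open>The two sides are treated separately and \<open>x\<close> is exempt, since
  \<open>f x\<close> and the two one-sided limits may differ arbitrarily.\<close>

definition small_osc :: "(real \<Rightarrow> real) \<Rightarrow> real \<Rightarrow> real \<Rightarrow> real \<Rightarrow> bool" where
  "small_osc f e x d \<longleftrightarrow> 0 < d \<and>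
    (\<forall>s \<in> {0..1} \<inter> {x - d<..<x}. \<forall>t \<in> {0..1} \<inter> {x - d<..<x}. \<bar>f s - f t\<bar> \<le> e) \<and>
    (\<forall>s \<in> {0..1} \<inter> {x<..<x + d}. \<forall>t \<in> {0..1} \<inter> {x<..<x + d}. \<bar>f s - f t\<bar> \<le> e)"

lemma small_oscD:
  assumes "small_osc f e x d"
  shows "s \<in> {0..1} \<inter> {x - d<..<x} \<Longrightarrow> t \<in> {0..1} \<inter> {x - d<..<x} \<Longrightarrow> \<bar>f s - f t\<bar> \<le> e"
    and "s \<in> {0..1} \<inter> {x<..<x + d} \<Longrightarrow> t \<in> {0..1} \<inter> {x<..<x + d} \<Longrightarrow> \<bar>f s - f t\<bar> \<le> e"
  using assms unfolding small_osc_def by blast+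

lemma regulated_small_oscillation:
  assumes f: "regulated f" and e: "0 < e" and x: "x \<in> {0..1}"
  shows "\<exists>d. small_osc f e x d"
proof -
  have "\<exists>d>0. \<forall>s \<in> {0..1} \<inter> {x - d<..<x}. \<forall>t \<in> {0..1} \<inter> {x - d<..<x}. \<bar>f s - f t\<bar> \<le> e"
  proof (cases "x = 0")
    case False
    have "eventually (\<lambda>t. \<bar>f t - lval f x\<bar> < e / 2) (at_left x)"
      using tendstoD[OF regulated_left[OF f, of x], of "e / 2"] x False e by (auto simp: dist_real_def)
    from eventually_left_interval[OF this, of 0] x False obtain d
      where d: "d < x" "\<And>t. t \<in> {d<..<x} \<Longrightarrow> \<bar>f t - lval f x\<bar> < e / 2" by auto
    have "\<bar>f s - f t\<bar> \<le> e" if "s \<in> {d<..<x}" "t \<in> {d<..<x}" for s t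
      using d(2)[OF that(1)] d(2)[OF that(2)] by linarith
    then show ?thesis using d(1) by (intro exI[of _ "x - d"]) auto
  qed (auto intro: exI[of _ 1])
  then obtain d1 where d1: "0 < d1"
    "\<And>s t. s \<in> {0..1} \<inter> {x - d1<..<x} \<Longrightarrow> t \<in> {0..1} \<inter> {x - d1<..<x} \<Longrightarrow> \<bar>f s - f t\<bar> \<le> e"
    by blast
  have "\<exists>d>0. \<forall>s \<in> {0..1} \<inter> {x<..<x + d}. \<forall>t \<in> {0..1} \<inter> {x<..<x + d}. \<bar>f s - f t\<bar> \<le> e"
  proof (cases "x = 1")
    case False
    have "eventually (\<lambda>t. \<bar>f t - rval f x\<bar> < e / 2) (at_right x)"
      using tendstoD[OF regulated_right[OF f, of x], of "e / 2"] x False e by (auto simp: dist_real_def)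
    from eventually_right_interval[OF this, of 1] x False obtain d
      where d: "x < d" "\<And>t. t \<in> {x<..<d} \<Longrightarrow> \<bar>f t - rval f x\<bar> < e / 2" by auto
    have "\<bar>f s - f t\<bar> \<le> e" if "s \<in> {x<..<d}" "t \<in> {x<..<d}" for s t
      using d(2)[OF that(1)] d(2)[OF that(2)] by linarith
    then show ?thesis using d(1) by (intro exI[of _ "d - x"]) auto
  qed (auto intro: exI[of _ 1])
  then obtain d2 where d2: "0 < d2"
    "\<And>s t. s \<in> {0..1} \<inter> {x<..<x + d2} \<Longrightarrow> t \<in> {0..1} \<inter> {x<..<x + d2} \<Longrightarrow> \<bar>f s - f t\<bar> \<le> e"
    by blast
  show ?thesis unfolding small_osc_def using d1 d2 by (intro exI[of _ "min d1 d2"]) auto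
qed

text \<open>Away from finitely many centres, \<open>f\<close> oscillates by at most \<open>e\<close>
  on each half of a ball; boundedness and Riemann integrability are both read off from such a
  cover.\<close>

lemma regulated_finite_cover:
  assumes f: "regulated f" and e: "0 < e"
  obtains S d where "finite S" "{0..1} \<subseteq> (\<Union>x\<in>S. ball x (d x :: real))"
    "\<And>x. x \<in> S \<Longrightarrow> small_osc f e x (d x)"
proof -
  obtain d where d: "\<And>x. x \<in> {0..1} \<Longrightarrow> small_osc f e x (d x)"
    using regulated_small_oscillation[OF f e] by metis
  have "{0..1} \<subseteq> (\<Union>x\<in>{0..1}. ball x (d x))"
  proof
    fix x :: real assume x: "x \<in> {0..1}"
    then have "x \<in> ball x (d x)" using d unfolding small_osc_def by simp
    then show "x \<in> (\<Union>x\<in>{0..1}. ball x (d x))" using x by blast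
  qed
  then obtain S where S: "S \<subseteq> {0..1}" "finite S" "{0..1} \<subseteq> (\<Union>x\<in>S. ball x (d x))"
    using compactE_image[OF compact_Icc, of "{0..1}" "\<lambda>x. ball x (d x)"] by blast
  show thesis by (rule that[OF S(2,3)]) (use S(1) d in blast)
qed

lemma regulated_bounded:
  assumes f: "regulated f"
  obtains M where "0 \<le> M" "\<And>x. x \<in> {0..1} \<Longrightarrow> \<bar>f x\<bar> \<le> M"
proof -
  obtain S d where S: "finite S" "{0..1} \<subseteq> (\<Union>x\<in>S. ball x (d x :: real))"
    and osc: "\<And>x. x \<in> S \<Longrightarrow> small_osc f 1 x (d x)"
    by (rule regulated_finite_cover[OF f zero_less_one], rule that; assumption)
  have bdd: "bounded (f ` B)" if "\<And>s t. s \<in> B \<Longrightarrow> t \<in> B \<Longrightarrow> \<bar>f s - f t\<bar> \<le> 1" for B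
  proof (cases "B = {}")
    case False
    then obtain b where "b \<in> B" by blast
    then show ?thesis
      using that unfolding bounded_any_center[where a = "f b"]
      by (intro exI[of _ 1]) (auto simp: dist_real_def)
  qed simp
  have "bounded (f ` ({0..1} \<inter> ball x (d x)))" if "x \<in> S" for x
  proof -
    have "f ` ({0..1} \<inter> ball x (d x)) \<subseteq> insert (f x)
       (f ` ({0..1} \<inter> {x - d x<..<x}) \<union> f ` ({0..1} \<inter> {x<..<x + d x}))"
    proof -
      have "{0..1} \<inter> ball x (d x) \<subseteq> insert x ({0..1} \<inter> {x - d x<..<x} \<union> {0..1} \<inter> {x<..<x + d x})"
        by (auto simp: dist_real_def abs_if split: if_splits)
      from image_mono[OF this, of f] show ?thesis by (simp only: image_insert image_Un)
    qed
    moreover have "bounded \<dots>"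
      using bdd small_oscD[OF osc[OF that]] by (simp only: bounded_insert bounded_Un)
    ultimately show ?thesis using bounded_subset by blast
  qed
  then have "bounded (\<Union>x\<in>S. f ` ({0..1} \<inter> ball x (d x)))" using S(1) by (intro bounded_UN) auto
  then have "bounded (f ` {0..1})" by (rule bounded_subset) (use S(2) in blast)
  then obtain M where "\<forall>x \<in> {0..1}. \<bar>f x\<bar> \<le> M" unfolding bounded_iff by auto
  then show thesis using that[of "max 0 M"] by fastforce
qed

lemma countable_imp_negligible: "countable S \<Longrightarrow> negligible (S :: real set)"
  unfolding negligible_iff_null_sets
  by (intro null_sets_completionI countable_imp_null_set_lborel)

text \<open>Off the countable, hence negligible, set \<open>disc f\<close> the function is
  continuous and bounded.\<close>

lemma regulated_integrable:
  assumes f: "regulated f"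
  shows "f integrable_on {0..1}"
proof -
  have N: "negligible (disc f)"
    using countable_imp_negligible countable_is_height[OF is_height_disc[OF f]] by blast
  obtain M where M: "\<And>x. x \<in> {0..1} \<Longrightarrow> \<bar>f x\<bar> \<le> M" using regulated_bounded[OF f] by blast
  let ?S = "{0..1} - disc f"
  have S: "?S \<in> sets lebesgue" using negligible_imp_sets[OF N] by auto
  have "continuous_on ?S f"
    unfolding continuous_on_eq_continuous_within
  proof
    fix x assume "x \<in> ?S"
    then have "cont_at f x" unfolding disc_eq[OF f] by auto
    then show "continuous (at x within ?S) f" by (rule continuous_within_subset) auto
  qed
  from continuous_imp_measurable_on_sets_lebesgue[OF this S]
  have "f integrable_on ?S"
  proof (rule measurable_bounded_by_integrable_imp_integrable_real)
    have "(\<lambda>x. M) integrable_on {0..1 :: real}" by (rule integrable_const_ivl)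
    then show "(\<lambda>x. M) integrable_on ?S"
      by (rule integrable_spike_set) (auto intro: negligible_subset[OF N])
  qed (use M S in auto)
  then show ?thesis by (rule integrable_spike_set) (auto intro: negligible_subset[OF N])
qed

section \<open>Riemann sums of regulated functions\<close>

lemma tagged_content_near_point:
  fixes s :: real
  assumes p: "p tagged_partial_division_of {a..b}"
    and near: "\<And>t K. (t, K) \<in> p \<Longrightarrow> s \<in> K \<and> measure lborel K < d" and d: "0 < d"
  shows "(\<Sum>(t, K)\<in>p. measure lborel K) \<le> 2 * d"
proof -
  note P = tagged_partial_division_ofD[OF p]
  have "sum (measure lborel) (snd ` p) = sum (measure lborel \<circ> snd) p"
  \<comment> \<open>A piece that occurs with two tags has empty interior and hence content
    \<open>0\<close>, so it does not matter how often it is counted.\<close>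
  proof (rule sum.reindex_nontrivial[OF P(1)])
    fix x y assume xy: "x \<in> p" "y \<in> p" "x \<noteq> y" "snd x = snd y"
    obtain u K where x: "x = (u, K)" by force
    obtain v where y: "y = (v, K)" using xy(4) x by (cases y) auto
    have "interior K \<inter> interior K = {}" using P(5)[of u K v K] xy x y by auto
    moreover obtain l r where "K = cbox l r" using P(4)[of u K] xy x by auto
    ultimately show "measure lborel (snd x) = 0" using x by (simp add: content_eq_0_interior)
  qed
  also have "\<dots> = (\<Sum>(t, K)\<in>p. measure lborel K)" by (simp add: case_prod_unfold o_def)
  finally have eq: "sum (measure lborel) (snd ` p) = (\<Sum>(t, K)\<in>p. measure lborel K)" .
  have "\<Union>(snd ` p) \<subseteq> cbox (s - d) (s + d)"
  proof
    fix y assume "y \<in> \<Union>(snd ` p)"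
    then obtain t K where tK: "(t, K) \<in> p" "y \<in> K" by auto
    then obtain l r where K: "K = {l..r}" using P(4)[of t K] by auto
    then have "s \<in> {l..r}" "r - l < d" using near[OF tK(1)] by (auto simp: content_real_if)
    then show "y \<in> cbox (s - d) (s + d)" using tK K by auto
  qed
  from subadditive_content_division[OF partial_division_of_tagged_division[OF p] this]
  show ?thesis unfolding eq using d by simp
qed

text \<open>A piece that contains no centre of the cover lies on one side of a centre and
  contributes at most the oscillation there. The other pieces have total content at most
  \<open>2 * \<delta>\<close> per centre and are estimated by the bound of \<open>f\<close>.\<close>

lemma regulated_has_riemann_integral:
  assumes f: "regulated f" and b: "b \<in> {0..1}"
  shows "has_riemann_integral f 0 b (integral {0..b} f)"
  unfolding has_riemann_integral_def
proof (intro allI impI)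
  fix e :: real assume e: "0 < e"
  obtain M where M: "0 \<le> M" "\<And>x. x \<in> {0..1} \<Longrightarrow> \<bar>f x\<bar> \<le> M" using regulated_bounded[OF f] by blast
  define \<eta> where "\<eta> = e / 4"
  have \<eta>: "0 < \<eta>" using e by (simp add: \<eta>_def)
  obtain S d where S: "finite S" "{0..1} \<subseteq> (\<Union>x\<in>S. ball x (d x :: real))"
    and osc: "\<And>x. x \<in> S \<Longrightarrow> small_osc f \<eta> x (d x)"
    by (rule regulated_finite_cover[OF f \<eta>], rule that; assumption)
  have "{0..1} \<subseteq> \<Union>((\<lambda>x. ball x (d x)) ` S)" using S(2) by blast
  \<comment> \<open>\<open>r\<close> is a Lebesgue number of the cover.\<close>
  then obtain r where r: "0 < r" "\<And>y. y \<in> {0..1} \<Longrightarrow> \<exists>G \<in> (\<lambda>x. ball x (d x)) ` S. ball y r \<subseteq> G"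
    by (rule Heine_Borel_lemma[OF compact_Icc]) auto
  define c where "c = real (card S) + 1"
  \<comment> \<open>This choice bounds the contribution of the pieces at centres by
    \<open>e / 2\<close>, next to \<open>e / 4\<close> for the others. The additional
    \<open>1\<close> in \<open>c\<close> and in \<open>M + 1\<close> excludes a zero
    divisor.\<close>
  define \<delta> where "\<delta> = min r (e / (8 * (M + 1) * c))"
  have c: "0 < c" unfolding c_def by simp
  have \<delta>: "0 < \<delta>" using r(1) e M(1) c by (simp add: \<delta>_def)
  have fint: "f integrable_on cbox 0 b"
    using integrable_on_subinterval[OF regulated_integrable[OF f], of 0 b] b by simp
  have small: "\<bar>f s - f t\<bar> \<le> \<eta>"
    if "0 \<le> l" "u \<le> 1" "u - l < \<delta>" "S \<inter> {l..u} = {}" "s \<in> {l..u}" "t \<in> {l..u}" for l u s t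
  proof -
    have l: "l \<in> {0..1}" using that by auto
    then obtain x where x: "x \<in> S" "ball l r \<subseteq> ball x (d x)" using r(2) by blast
    have "{l..u} \<subseteq> ball l r" using that(3) by (auto simp: dist_real_def \<delta>_def)
    then have "{l..u} \<subseteq> ball x (d x)" using x(2) by blast
    then have st: "s \<in> ball x (d x)" "t \<in> ball x (d x)" using that by auto
    have "x < l \<or> u < x" using that(4) x(1) by auto
    then show ?thesis
    proof
      assume "x < l"
      then show ?thesis using small_oscD(2)[OF osc[OF x(1)]] st that by (auto simp: dist_real_def)
    next
      assume "u < x"
      then show ?thesis using small_oscD(1)[OF osc[OF x(1)]] st that by (auto simp: dist_real_def)
    qed
  qed
  show "\<exists>\<delta>>0. \<forall>p. p tagged_division_of {0..b} \<and> (\<forall>(t, K)\<in>p. measure lborel K < \<delta>) \<longrightarrow>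
          \<bar>(\<Sum>(t, K)\<in>p. measure lborel K * f t) - integral {0..b} f\<bar> < e"
  proof (intro exI[of _ \<delta>] conjI allI impI \<delta>)
    fix p assume "p tagged_division_of {0..b} \<and> (\<forall>(t, K)\<in>p. measure lborel K < \<delta>)"
    then have p: "p tagged_division_of cbox 0 b" and mesh: "\<And>t K. (t, K) \<in> p \<Longrightarrow> measure lborel K < \<delta>" by auto
    note P = tagged_division_ofD[OF p]
    define bad where "bad = {(t, K) \<in> p. S \<inter> K \<noteq> {}}"
    have iv: "\<exists>l u. K = {l..u} \<and> l \<le> u \<and> 0 \<le> l \<and> u \<le> 1" if tK: "(t, K) \<in> p" for t K
    proof -
      obtain l u where K: "K = {l..u}" using P(4)[OF tK] by auto
      have "t \<in> K" "K \<subseteq> {0..b}" using P(2,3)[OF tK] by auto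
      with K b show ?thesis by (intro exI[of _ l] exI[of _ u]) auto
    qed
    have piece: "\<bar>measure lborel K * f t - integral K f\<bar> \<le> measure lborel K * B"
      if tK: "(t, K) \<in> p" and B: "\<And>s. s \<in> K \<Longrightarrow> \<bar>f s - f t\<bar> \<le> B" for t K B
    proof -
      obtain l u where K: "K = {l..u}" "l \<le> u" using iv[OF tK] by blast
      have "K \<subseteq> {0..b}" using P(3)[OF tK] by simp
      then have fK: "f integrable_on {l..u}"
        using K integrable_on_subinterval[OF fint, of l u] by simp
      have "t \<in> K" using P(2)[OF tK] .
      then have B0: "0 \<le> B" using B[of t] by simp
      have "((\<lambda>s. f s - f t) has_integral (integral K f - measure lborel K * f t)) {l..u}"
        using has_integral_diff[OF integrable_integral[OF fK] has_integral_const_real[of "f t" l u]] K by simp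
      from has_integral_bound_real[OF B0 _ this, of "{}"] B K
      have "\<bar>integral K f - measure lborel K * f t\<bar> \<le> B * measure lborel {l..u}" by simp
      then show ?thesis using K by (simp add: abs_minus_commute mult.commute)
    qed
    have good_term: "\<bar>measure lborel K * f t - integral K f\<bar> \<le> measure lborel K * \<eta>" if "(t, K) \<in> p - bad" for t K
    proof (rule piece)
      show tK: "(t, K) \<in> p" using that by auto
      fix s assume s: "s \<in> K"
      obtain l u where K: "K = {l..u}" "l \<le> u" "0 \<le> l" "u \<le> 1" using iv[OF tK] by blast
      have "u - l < \<delta>" using mesh[OF tK] K by simp
      moreover have "S \<inter> {l..u} = {}" using that K by (auto simp: bad_def)
      ultimately show "\<bar>f s - f t\<bar> \<le> \<eta>" using small[of l u s t] K s P(2)[OF tK] by auto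
    qed
    have bad_term: "\<bar>measure lborel K * f t - integral K f\<bar> \<le> measure lborel K * (2 * M)" if "(t, K) \<in> bad" for t K
    proof (rule piece)
      show tK: "(t, K) \<in> p" using that by (auto simp: bad_def)
      fix s assume s: "s \<in> K"
      have "K \<subseteq> {0..1}" using P(3)[OF tK] b by auto
      then have "\<bar>f s\<bar> \<le> M" "\<bar>f t\<bar> \<le> M" using M(2) s P(2)[OF tK] by auto
      then show "\<bar>f s - f t\<bar> \<le> 2 * M" by linarith
    qed
    have fin: "finite p" "bad \<subseteq> p" using P(1) by (auto simp: bad_def)
    have bad_content: "(\<Sum>(t, K)\<in>bad. measure lborel K) \<le> real (card S) * (2 * \<delta>)"
    proof -
      \<comment> \<open>A piece may contain several centres; its content is counted once for each,
        and the two sums are exchanged.\<close>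
      have "(\<Sum>(t, K)\<in>bad. measure lborel K) \<le> (\<Sum>x\<in>S. \<Sum>(t, K)\<in>{(t, K) \<in> p. x \<in> K}. measure lborel K)"
      proof -
        have "(\<Sum>(t, K)\<in>bad. measure lborel K) \<le> (\<Sum>(t, K)\<in>p. \<Sum>x\<in>{x \<in> S. x \<in> K}. measure lborel K)"
        proof -
          have "measure lborel K \<le> (\<Sum>x\<in>{x \<in> S. x \<in> K}. measure lborel K)" if "(t, K) \<in> bad" for t K
          proof -
            have "{x \<in> S. x \<in> K} \<noteq> {}" using that by (auto simp: bad_def)
            then have "1 \<le> card {x \<in> S. x \<in> K}" using S(1) by (simp add: Suc_le_eq card_gt_0_iff)
            then have "1 * measure lborel K \<le> real (card {x \<in> S. x \<in> K}) * measure lborel K"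
              by (intro mult_right_mono) auto
            then show ?thesis by simp
          qed
          then have "(\<Sum>(t, K)\<in>bad. measure lborel K)
              \<le> (\<Sum>(t, K)\<in>bad. \<Sum>x\<in>{x \<in> S. x \<in> K}. measure lborel K)"
            by (intro sum_mono) auto
          also have "\<dots> \<le> (\<Sum>(t, K)\<in>p. \<Sum>x\<in>{x \<in> S. x \<in> K}. measure lborel K)"
            using fin by (intro sum_mono2) (auto intro!: sum_nonneg)
          finally show ?thesis .
        qed
        also have "\<dots> = (\<Sum>q\<in>p. \<Sum>x | x \<in> S \<and> x \<in> snd q. measure lborel (snd q))"
          by (simp add: case_prod_unfold)
        also have "\<dots> = (\<Sum>x\<in>S. \<Sum>q | q \<in> p \<and> x \<in> snd q. measure lborel (snd q))"
          by (rule sum.swap_restrict[OF fin(1) S(1)])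
        also have "\<dots> = (\<Sum>x\<in>S. \<Sum>(t, K)\<in>{(t, K) \<in> p. x \<in> K}. measure lborel K)"
          by (intro sum.cong) (auto simp: case_prod_unfold)
        finally show ?thesis .
      qed
      also have "\<dots> \<le> (\<Sum>x\<in>S. 2 * \<delta>)"
      proof (rule sum_mono)
        fix x assume "x \<in> S"
        have "p tagged_partial_division_of {0..b}" using p by (simp add: tagged_division_of_def)
        then have "{(t, K) \<in> p. x \<in> K} tagged_partial_division_of {0..b}"
          by (rule tagged_partial_division_subset) auto
        then show "(\<Sum>(t, K)\<in>{(t, K) \<in> p. x \<in> K}. measure lborel K) \<le> 2 * \<delta>"
          by (rule tagged_content_near_point) (use mesh \<delta> in auto)
      qed
      finally show ?thesis by simp
    qed
    have "(\<Sum>(t, K)\<in>p. measure lborel K * f t) - integral {0..b} f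
      = (\<Sum>(t, K)\<in>p. measure lborel K * f t - integral K f)"
      using integral_combine_tagged_division_topdown[OF fint p]
      by (simp add: sum_subtractf case_prod_unfold)
    also have "\<bar>\<dots>\<bar> \<le> (\<Sum>(t, K)\<in>p. \<bar>measure lborel K * f t - integral K f\<bar>)"
      unfolding case_prod_unfold by (rule sum_abs)
    also have "\<dots> = (\<Sum>(t, K)\<in>p - bad. \<bar>measure lborel K * f t - integral K f\<bar>) +
        (\<Sum>(t, K)\<in>bad. \<bar>measure lborel K * f t - integral K f\<bar>)"
      using fin by (intro sum.subset_diff) auto
    also have "\<dots> \<le> (\<Sum>(t, K)\<in>p - bad. measure lborel K * \<eta>) + (\<Sum>(t, K)\<in>bad. measure lborel K * (2 * M))"
      using good_term bad_term by (intro add_mono sum_mono) auto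
    also have "(\<Sum>(t, K)\<in>p - bad. measure lborel K * \<eta>) \<le> (\<Sum>(t, K)\<in>p. measure lborel K * \<eta>)"
      using fin \<eta> by (intro sum_mono2) (auto intro: mult_nonneg_nonneg)
    also have "(\<Sum>(t, K)\<in>p. measure lborel K * \<eta>) = (\<Sum>(t, K)\<in>p. measure lborel K) * \<eta>"
      by (simp add: sum_distrib_right case_prod_unfold)
    also have "(\<Sum>(t, K)\<in>p. measure lborel K) = b"
      using additive_content_tagged_division[OF p] b by simp
    also have "(\<Sum>(t, K)\<in>bad. measure lborel K * (2 * M)) = (\<Sum>(t, K)\<in>bad. measure lborel K) * (2 * M)"
      by (simp add: sum_distrib_right case_prod_unfold)
    finally have "\<bar>(\<Sum>(t, K)\<in>p. measure lborel K * f t) - integral {0..b} f\<bar>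
      \<le> b * \<eta> + (\<Sum>(t, K)\<in>bad. measure lborel K) * (2 * M)" by simp
    also have "\<dots> \<le> 1 * \<eta> + (real (card S) * (2 * \<delta>)) * (2 * M)"
      using bad_content b \<eta> M(1) by (intro add_mono mult_right_mono) auto
    also have "(real (card S) * (2 * \<delta>)) * (2 * M) \<le> c * (2 * \<delta>) * (2 * (M + 1))"
      using \<delta> M(1) by (intro mult_mono) (auto simp: c_def)
    also have "c * (2 * \<delta>) * (2 * (M + 1)) \<le> c * (2 * (e / (8 * (M + 1) * c))) * (2 * (M + 1))"
      using c M(1) by (intro mult_right_mono mult_left_mono) (auto simp: \<delta>_def)
    also have "\<dots> = e / 2"
    proof -
      have eq: "c * (2 * (e / (8 * m * c))) * (2 * m) = e / 2" if "m \<noteq> 0" for m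
        using that c by (simp add: field_simps)
      show ?thesis using M(1) by (intro eq) simp
    qed
    finally show "\<bar>(\<Sum>(t, K)\<in>p. measure lborel K * f t) - integral {0..b} f\<bar> < e" using e by (simp add: \<eta>_def)
  qed
qed

text \<open>Every division that is fine for balls of radius \<open>d / 2\<close> has mesh below
  \<open>d\<close>. In particular the Riemann integral is unique.\<close>

lemma has_riemann_integral_imp_has_integral:
  assumes "has_riemann_integral f a b I"
  shows "(f has_integral I) {a..b}"
  unfolding has_integral_real
proof (intro allI impI)
  fix e :: real assume "0 < e"
  with assms have "\<exists>d>0. \<forall>p. p tagged_division_of {a..b} \<and> (\<forall>(t, K)\<in>p. measure lborel K < d) \<longrightarrow>
      \<bar>(\<Sum>(t, K)\<in>p. measure lborel K * f t) - I\<bar> < e"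
    unfolding has_riemann_integral_def by (elim allE impE)
  then obtain d where d: "0 < d" "\<forall>p. p tagged_division_of {a..b} \<and>
      (\<forall>(t, K)\<in>p. measure lborel K < d) \<longrightarrow> \<bar>(\<Sum>(t, K)\<in>p. measure lborel K * f t) - I\<bar> < e"
    by (elim exE conjE)
  show "\<exists>\<gamma>. gauge \<gamma> \<and> (\<forall>p. p tagged_division_of {a..b} \<and> \<gamma> fine p \<longrightarrow>
          norm ((\<Sum>(x, k)\<in>p. measure lborel k *\<^sub>R f x) - I) < e)"
  proof (intro exI[of _ "\<lambda>x. ball x (d / 2)"] conjI allI impI)
    show "gauge (\<lambda>x. ball x (d / 2))" using d(1) by (intro gauge_ball) simp
    fix p assume p: "p tagged_division_of {a..b} \<and> (\<lambda>x. ball x (d / 2)) fine p"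
    have "measure lborel K < d" if tK: "(t, K) \<in> p" for t K
    proof -
      obtain l u where K: "K = {l..u}" "t \<in> K"
        using tagged_division_ofD(2,4)[OF conjunct1[OF p] tK] by auto
      moreover have "K \<subseteq> ball t (d / 2)" using p tK unfolding fine_def by blast
      then have "{l..u} \<subseteq> ball t (d / 2)" using K by simp
      then have "l \<in> ball t (d / 2)" "u \<in> ball t (d / 2)"
        using K by (meson atLeastAtMost_iff order_refl order_trans subsetD)+
      ultimately show ?thesis by (auto simp: dist_real_def abs_less_iff)
    qed
    then have "\<forall>(t, K)\<in>p. measure lborel K < d" by blast
    with d(2)[THEN spec, of p] p show "norm ((\<Sum>(x, k)\<in>p. measure lborel k *\<^sub>R f x) - I) < e"
      by simp
  qed
qed

lemma riemann_integral_eq_integral: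
  assumes "regulated f" "b \<in> {0..1}"
  shows "riemann_integral f 0 b = integral {0..b} f"
  unfolding riemann_integral_def
proof (rule the_equality)
  show "I = integral {0..b} f" if "has_riemann_integral f 0 b I" for I
    using has_riemann_integral_imp_has_integral[OF that] by (simp add: integral_unique)
qed (rule regulated_has_riemann_integral[OF assms])

section \<open>Derivatives of the indefinite integral\<close>

lemma cont_at_imp_integral_derivative:
  assumes f: "regulated f" and y: "y \<in> {0..1}" and c: "cont_at f y"
  shows "((\<lambda>u. integral {0..u} f) has_real_derivative f y) (at y within {0..1})"
  using integral_has_vector_derivative_continuous_at[OF regulated_integrable[OF f], of y "{}"] y c
  by (simp add: has_real_derivative_iff_has_vector_derivative)

lemma cont_at_imp_riemann_integral_derivative:
  assumes f: "regulated f" and y: "y \<in> {0<..<1}" and c: "cont_at f y"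
  shows "((\<lambda>x. riemann_integral f 0 x) has_real_derivative f y) (at y)"
proof -
  have "((\<lambda>u. integral {0..u} f) has_real_derivative f y) (at y)"
    using cont_at_imp_integral_derivative[OF f _ c] y by (simp add: at_within_Icc_at)
  then show ?thesis
    by (rule has_field_derivative_transform_within_open[of _ _ _ "{0<..<1}"])
      (use y riemann_integral_eq_integral[OF f] in auto)
qed

text \<open>Nonnegativity forces all integrals from \<open>0\<close> to \<open>u\<close> to vanish,
  and at a point of continuity \<open>f\<close> is the derivative of this zero function.\<close>

lemma cont_at_imp_zero_of_integral_zero:
  assumes f: "regulated f" and y: "y \<in> {0..1}" and c: "cont_at f y"
    and nonneg: "f ` {0..1} \<subseteq> {0..1}" and I: "has_riemann_integral f 0 1 0"
  shows "f y = 0"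
proof -
  have I0: "integral {0..1} f = 0"
    using has_riemann_integral_imp_has_integral[OF I] by (rule integral_unique)
  have nonneg': "0 \<le> f x" if "x \<in> {0..1}" for x using nonneg that unfolding image_subset_iff by simp
  have "integral {0..u} f = 0" if u: "u \<in> {0..1}" for u
  proof -
    have fu: "f integrable_on {0..u}"
      using integrable_on_subinterval[OF regulated_integrable[OF f], of 0 u] u by simp
    have "integral {0..u} f \<le> integral {0..1} f"
      using u nonneg' fu regulated_integrable[OF f] by (intro integral_subset_le) auto
    moreover have "0 \<le> integral {0..u} f"
      using u nonneg' fu by (intro integral_nonneg) auto
    ultimately show ?thesis using I0 by simp
  qed
  then have zero: "integral {0..u} f = 0" if "u \<in> {0..1}" "dist u y < 1" for u
    using that by blast
  have "((\<lambda>u. 0) has_real_derivative f y) (at y within {0..1})"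
    by (rule has_field_derivative_transform_within[OF cont_at_imp_integral_derivative[OF f y c]
          zero_less_one y zero])
  then have "((\<lambda>u. 0) has_vector_derivative f y) (at y within {0..1})"
    by (simp add: has_real_derivative_iff_has_vector_derivative)
  then show ?thesis
    by (rule vector_derivative_unique_within[OF at_unit_nontrivial[OF y] _ has_vector_derivative_const])
qed

lemma integral_coding_fun:
  assumes "is_height H A"
  shows "integral S (coding_fun H A) = 0"
proof -
  have "negligible A" using countable_imp_negligible countable_is_height[OF assms] by blast
  then have "(coding_fun H A has_integral 0) S"
    by (rule has_integral_negligible) (simp add: coding_fun_def)
  then show ?thesis by (rule integral_unique)
qed

lemma has_riemann_integral_coding_fun:
  "is_height H A \<Longrightarrow> has_riemann_integral (coding_fun H A) 0 1 0"
  using regulated_has_riemann_integral[OF regulated_coding_fun, of H A 1] integral_coding_fun[of H A]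
  by simp

lemma riemann_integral_derivative_coding_fun:
  assumes H: "is_height H A" and y: "y \<in> {0<..<1}"
    and d: "((\<lambda>x. riemann_integral (coding_fun H A) 0 x) has_real_derivative coding_fun H A y) (at y)"
  shows "y \<notin> A"
proof -
  have "((\<lambda>x. 0) has_real_derivative coding_fun H A y) (at y)"
    using d by (rule has_field_derivative_transform_within_open[of _ _ _ "{0<..<1}"])
      (use y riemann_integral_eq_integral[OF regulated_coding_fun[OF H]] integral_coding_fun[OF H] in auto)
  then have "coding_fun H A y = 0" using DERIV_unique DERIV_const by blast
  then show ?thesis by (simp add: coding_fun_eq_0_iff)
qed

section \<open>Points obtained from a point of continuity\<close>

definition approach :: "real \<Rightarrow> nat \<Rightarrow> real" where
  "approach y n = (if y < 1 then y + (1 - y) * (1 / 2 ^ Suc n) else y - y * (1 / 2 ^ Suc n))"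

text \<open>The implication inside \<open>LEAST\<close> lets the search succeed in both cases. If no
  value along the sequence is below \<open>f y\<close>, then \<open>y\<close> itself gives a lower
  bound.\<close>

definition lower_point :: "(real \<Rightarrow> real) \<Rightarrow> real \<Rightarrow> real" where
  "lower_point f y = (if \<exists>n. f (approach y n) < f y
     then approach y (LEAST n. (\<exists>n. f (approach y n) < f y) \<longrightarrow> f (approach y n) < f y) else y)"

definition upper_point :: "(real \<Rightarrow> real) \<Rightarrow> real \<Rightarrow> real" where
  "upper_point f y = (if \<exists>n. f y < f (approach y n)
     then approach y (LEAST n. (\<exists>n. f y < f (approach y n)) \<longrightarrow> f y < f (approach y n)) else y)"

lemma approach_in_unit: "y \<in> {0..1} \<Longrightarrow> approach y n \<in> {0..1}"
  using lval_point[of y n] rval_point[of y n] unfolding approach_def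
  by (cases "y < 1") (simp_all del: power_Suc)

lemma approach_tendsto: "y \<in> {0..1} \<Longrightarrow> approach y \<longlonglongrightarrow> y"
  using lval_seq[of y] rval_seq[of y] unfolding approach_def
  by (cases "y < 1") (simp_all add: filterlim_at del: power_Suc)

lemma inj_approach:
  assumes "y \<in> {0..1}"
  shows "inj (approach y)"
proof (rule injI)
  fix m n assume eq: "approach y m = approach y n"
  have "1 / 2 ^ Suc m = (1 / 2 ^ Suc n :: real)"
  proof (cases "y < 1")
    case True
    then show ?thesis using eq unfolding approach_def by (simp del: power_Suc)
  next
    case False
    then have "y = 1" using assms by simp
    then show ?thesis using eq unfolding approach_def by (simp del: power_Suc)
  qed
  then have "(2 :: real) ^ Suc m = 2 ^ Suc n" by (simp add: divide_simps del: power_Suc)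
  then have "Suc m = Suc n" by (subst (asm) power_inject_exp) auto
  then show "m = n" by simp
qed

lemma lower_point_in_unit: "y \<in> {0..1} \<Longrightarrow> lower_point f y \<in> {0..1}"
  and upper_point_in_unit: "y \<in> {0..1} \<Longrightarrow> upper_point f y \<in> {0..1}"
  unfolding lower_point_def upper_point_def using approach_in_unit by auto

text \<open>A strict inequality at \<open>lower_point\<close> or \<open>upper_point\<close> persists
  along the sequence by continuity; otherwise the bound holds at every index. So all late terms of
  the injective sequence \<open>approach y\<close> belong to the set.\<close>

lemma infinite_range_at_cont_point:
  assumes c: "cont_at f y" and y: "y \<in> {0..1}"
  shows "infinite {x \<in> {0..1}. f (lower_point f y) \<le> f x \<and> f x \<le> f (upper_point f y)}"
proof -
  have lim: "(\<lambda>n. f (approach y n)) \<longlonglongrightarrow> f y"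
    by (rule cont_at_seq[OF c approach_in_unit[OF y] approach_tendsto[OF y] y])
  have "eventually (\<lambda>n. f (lower_point f y) \<le> f (approach y n)) sequentially"
  proof (cases "\<exists>n. f (approach y n) < f y")
    case True
    then have "f (approach y (LEAST n. (\<exists>n. f (approach y n) < f y) \<longrightarrow> f (approach y n) < f y)) < f y"
      using LeastI_ex[of "\<lambda>n. (\<exists>n. f (approach y n) < f y) \<longrightarrow> f (approach y n) < f y"] by blast
    then have "f (lower_point f y) < f y" using True unfolding lower_point_def by simp
    from order_tendstoD(1)[OF lim this] show ?thesis by (rule eventually_mono) simp
  next
    case False
    then have "lower_point f y = y" unfolding lower_point_def by simp
    then show ?thesis using False by (simp add: not_less)
  qed
  moreover have "eventually (\<lambda>n. f (approach y n) \<le> f (upper_point f y)) sequentially"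
  proof (cases "\<exists>n. f y < f (approach y n)")
    case True
    then have "f y < f (approach y (LEAST n. (\<exists>n. f y < f (approach y n)) \<longrightarrow> f y < f (approach y n)))"
      using LeastI_ex[of "\<lambda>n. (\<exists>n. f y < f (approach y n)) \<longrightarrow> f y < f (approach y n)"] by blast
    then have "f y < f (upper_point f y)" using True unfolding upper_point_def by simp
    from order_tendstoD(2)[OF lim this] show ?thesis by (rule eventually_mono) simp
  next
    case False
    then have "upper_point f y = y" unfolding upper_point_def by simp
    then show ?thesis using False by (simp add: not_less)
  qed
  ultimately have "eventually (\<lambda>n. f (lower_point f y) \<le> f (approach y n) \<and>
      f (approach y n) \<le> f (upper_point f y)) sequentially"
    by (rule eventually_conj)
  then obtain N where N: "\<And>n. N \<le> n \<Longrightarrow> f (lower_point f y) \<le> f (approach y n) \<and>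
      f (approach y n) \<le> f (upper_point f y)"
    unfolding eventually_sequentially by blast
  have "infinite (approach y ` {N..})"
    using inj_approach[OF y] by (simp add: finite_image_iff inj_on_subset infinite_Ici)
  moreover have "approach y ` {N..} \<subseteq> {x \<in> {0..1}. f (lower_point f y) \<le> f x \<and> f x \<le> f (upper_point f y)}"
    using N approach_in_unit[OF y] by auto
  ultimately show ?thesis using infinite_super by blast
qed

section \<open>Functions with removable discontinuities\<close>

text \<open>At an endpoint only one of the two limits is one-sided; the other is the value of \<open>f\<close>.\<close>

definition cleared :: "(real \<Rightarrow> real) \<Rightarrow> real \<Rightarrow> real" where
  "cleared f x = (if x \<le> 1 / 2 then rval f x else lval f x)"

lemma cleared_tendsto:
  assumes rem: "only_removable_discontinuities f" and x: "x \<in> {0..1}"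
  shows "(f \<longlongrightarrow> cleared f x) (at x within {0..1})"
proof -
  obtain l where l: "(f \<longlongrightarrow> l) (at x within {0..1})"
    using rem x unfolding only_removable_discontinuities_def continuous_within by blast
  then have "0 < x \<Longrightarrow> lval f x = l" "x < 1 \<Longrightarrow> rval f x = l"
    unfolding tendsto_at_unit_iff[OF x] by (auto intro: lval_eqI rval_eqI)
  then have "cleared f x = l" unfolding cleared_def by simp
  with l show ?thesis by simp
qed

lemma cleared_eq:
  assumes rem: "only_removable_discontinuities f" and reg: "regulated f"
    and x: "x \<in> {0..1}" "x \<notin> disc f"
  shows "f x = cleared f x"
proof -
  have "(f \<longlongrightarrow> f x) (at x within {0..1})"
    using x unfolding disc_eq[OF reg] continuous_within by blast
  then show ?thesis
    using tendsto_unique[OF at_unit_nontrivial[OF x(1)] _ cleared_tendsto[OF rem x(1)]] by blast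
qed

text \<open>Near \<open>x\<close>, all values of \<open>f\<close> off \<open>x\<close> are within
  \<open>e / 2\<close> of \<open>cleared f x\<close>; at a nearby \<open>z\<close> the cleared value
  is a limit of such values, whatever \<open>f z\<close> is.\<close>

lemma continuous_on_cleared:
  assumes rem: "only_removable_discontinuities f"
  shows "continuous_on {0..1} (cleared f)"
  unfolding continuous_on_iff
proof (intro ballI allI impI)
  fix x e :: real assume x: "x \<in> {0..1}" and e: "0 < e"
  then have "eventually (\<lambda>t. dist (f t) (cleared f x) < e / 2) (at x within {0..1})"
    using tendstoD[OF cleared_tendsto[OF rem x], of "e / 2"] by simp
  then obtain d where d: "0 < d"
    "\<And>t. t \<in> {0..1} \<Longrightarrow> t \<noteq> x \<Longrightarrow> dist t x < d \<Longrightarrow> dist (f t) (cleared f x) < e / 2"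
    unfolding eventually_at by blast
  have "dist (cleared f z) (cleared f x) < e" if z: "z \<in> {0..1}" "dist z x < d" for z
  proof (cases "z = x")
    case False
    have "eventually (\<lambda>t. t \<in> ball x d - {x}) (nhds z)"
      using z False by (intro eventually_nhds_in_open) (auto simp: dist_commute)
    then have "eventually (\<lambda>t. dist (f t) (cleared f x) \<le> e / 2) (at z within {0..1})"
      unfolding eventually_at_filter
    proof (rule eventually_mono, intro impI)
      fix t assume "t \<in> ball x d - {x}" "t \<noteq> z" "t \<in> {0..1}"
      then show "dist (f t) (cleared f x) \<le> e / 2"
        by (intro less_imp_le d(2)) (auto simp: dist_commute)
    qed
    moreover have "((\<lambda>t. dist (f t) (cleared f x)) \<longlongrightarrow> dist (cleared f z) (cleared f x)) (at z within {0..1})"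
      by (intro tendsto_intros cleared_tendsto[OF rem z(1)])
    ultimately have "dist (cleared f z) (cleared f x) \<le> e / 2"
      using tendsto_upperbound at_unit_nontrivial[OF z(1)] by blast
    then show ?thesis using e by simp
  qed (use e in simp)
  then show "\<exists>d>0. \<forall>z\<in>{0..1}. dist z x < d \<longrightarrow> dist (cleared f z) (cleared f x) < e"
    using d(1) by blast
qed

section \<open>Last points below a level\<close>

lemma exists_outside_countable:
  fixes a b :: real
  assumes "countable S" "a < b"
  shows "\<exists>s \<in> {a<..<b}. s \<notin> S"
proof (rule ccontr)
  assume "\<not> ?thesis"
  then have "{a<..<b} \<subseteq> S" by blast
  then show False using assms uncountable_open_interval[of a b] countable_subset by blast
qed

text \<open>The inserted \<open>0\<close> keeps the set non-empty: for \<open>c = h 0\<close> the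
  function need not fall below \<open>c\<close> at all.\<close>

definition last_below :: "(real \<Rightarrow> real) \<Rightarrow> real \<Rightarrow> real" where
  "last_below h c = Sup (insert 0 {s \<in> {0..1}. h s < c})"

text \<open>By closedness \<open>h\<close> is at most \<open>c\<close> at the supremum, and by
  continuity from the right at least \<open>c\<close>. That no later value is below \<open>c\<close>
  is what will exclude a strict maximum.\<close>

lemma last_below:
  assumes h: "continuous_on {0..1} h" and c: "h 0 \<le> c" "c < h 1"
  shows "0 \<le> last_below h c" "last_below h c < 1" "h (last_below h c) = c"
    "\<And>s. last_below h c < s \<Longrightarrow> s \<le> 1 \<Longrightarrow> c \<le> h s"
proof -
  let ?S = "insert 0 {s \<in> {0..1}. h s < c}" and ?s = "last_below h c"
  have bdd: "bdd_above ?S" by (intro bdd_aboveI[of _ 1]) auto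
  show s0: "0 \<le> ?s" unfolding last_below_def by (intro cSup_upper bdd) simp
  have s1: "?s \<le> 1" unfolding last_below_def by (intro cSup_least) auto
  show right: "c \<le> h s" if "?s < s" "s \<le> 1" for s
  proof (rule ccontr)
    assume "\<not> c \<le> h s"
    then have "s \<in> ?S" using that s0 by auto
    then have "s \<le> ?s" unfolding last_below_def by (intro cSup_upper bdd)
    then show False using that by simp
  qed
  have "closed {s \<in> {0..1}. h s \<le> c}"
    using continuous_closed_preimage[OF h closed_real_atLeastAtMost, of "{..c}"]
    by (simp add: vimage_def Int_def)
  then have "closure ?S \<subseteq> {s \<in> {0..1}. h s \<le> c}"
    using c by (intro closure_minimal) auto
  moreover have "?s \<in> closure ?S"
    unfolding last_below_def by (intro closure_contains_Sup bdd) simp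
  ultimately have le: "h ?s \<le> c" by blast
  then show s1': "?s < 1" using s1 c(2) by (cases "?s = 1") auto
  have "(h \<longlongrightarrow> h ?s) (at_right ?s)"
    using h s0 s1' at_right_le_unit[of ?s] unfolding continuous_on_def
    by (intro tendsto_mono[of "at_right ?s" "at ?s within {0..1}"]) auto
  moreover have "eventually (\<lambda>s. c \<le> h s) (at_right ?s)"
    unfolding eventually_at_right_field using right s1' by (intro exI[of _ 1]) auto
  ultimately have "c \<le> h ?s" by (intro tendsto_lowerbound[of h _ "at_right ?s"]) auto
  with le show "h ?s = c" by simp
qed

text \<open>A strict inequality survives a small move to the left, which leads to a rational point
  still above \<open>q\<close>. For \<open>s = 0\<close> no move is possible, but \<open>0\<close>
  is rational itself.\<close>

lemma rational_value_below:
  assumes h: "continuous_on {0..1} h" and s: "s \<in> {0..1 :: real}" "h s < (c :: real)" "q < s \<or> s = 0"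
  shows "\<exists>r \<in> \<rat> \<inter> {0..1}. h r < c \<and> (q < r \<or> s = 0)"
proof (cases "s = 0")
  case False
  then have "0 < s" using s by simp
  have "(h \<longlongrightarrow> h s) (at_left s)"
    using h s(1) \<open>0 < s\<close> at_left_le_unit[of s] unfolding continuous_on_def
    by (intro tendsto_mono[of "at_left s" "at s within {0..1}"]) auto
  from order_tendstoD(2)[OF this s(2)] \<open>0 < s\<close> obtain d
    where d: "0 < d" "d < s" "\<And>t. t \<in> {d<..<s} \<Longrightarrow> h t < c"
    by (rule eventually_left_interval) blast
  have "max d q < s" using d s(3) False by auto
  then obtain r where "r \<in> \<rat>" "max d q < r" "r < s" using Rats_dense_in_real by blast
  then show ?thesis using d s(1) by (intro bexI[of _ r]) auto
qed (use s in \<open>auto intro!: bexI[of _ 0]\<close>)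

text \<open>The restriction to rational points turns the supremum into a cut defined by a number
  quantifier; this makes \<open>last_below\<close> computable.\<close>

lemma less_last_below_iff:
  assumes h: "continuous_on {0..1} h"
  shows "q < last_below h c \<longleftrightarrow> q < 0 \<or> (\<exists>r \<in> \<rat> \<inter> {0..1}. h r < c \<and> q < r)"
proof -
  let ?S = "insert 0 {s \<in> {0..1}. h s < c}"
  have "bdd_above ?S" by (intro bdd_aboveI[of _ 1]) auto
  then have "q < last_below h c \<longleftrightarrow> (\<exists>s \<in> ?S. q < s)"
    unfolding last_below_def by (intro less_cSup_iff) auto
  also have "\<dots> \<longleftrightarrow> q < 0 \<or> (\<exists>r \<in> \<rat> \<inter> {0..1}. h r < c \<and> q < r)"
  proof
    assume "\<exists>s \<in> ?S. q < s"
    then obtain s where s: "s = 0 \<or> s \<in> {0..1} \<and> h s < c" "q < s" by auto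
    from s(1) show "q < 0 \<or> (\<exists>r \<in> \<rat> \<inter> {0..1}. h r < c \<and> q < r)"
    proof
      assume "s \<in> {0..1} \<and> h s < c"
      then obtain r where "r \<in> \<rat> \<inter> {0..1}" "h r < c" "q < r \<or> s = 0"
        using rational_value_below[OF h, of s c q] s(2) by meson
      then show ?thesis using s(2) by meson
    qed (use s(2) in simp)
  next
    assume "q < 0 \<or> (\<exists>r \<in> \<rat> \<inter> {0..1}. h r < c \<and> q < r)"
    then show "\<exists>s \<in> ?S. q < s"
    proof
      assume "\<exists>r \<in> \<rat> \<inter> {0..1}. h r < c \<and> q < r"
      then obtain r where "r \<in> {0..1}" "h r < c" "q < r" by blast
      then show ?thesis by (intro bexI[of _ r]) auto
    qed (intro bexI[of _ 0], simp_all)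
  qed
  finally show ?thesis .
qed

text \<open>The two endpoints come in no particular order; parametrisation by the unit interval
  treats both directions alike.\<close>

definition segment :: "real \<Rightarrow> real \<Rightarrow> real \<Rightarrow> real" where
  "segment a b s = a + (b - a) * s"

lemma segment_in_unit:
  assumes "a \<in> {0..1}" "b \<in> {0..1}" "s \<in> {0..1}"
  shows "segment a b s \<in> {0..1}"
proof -
  have "segment a b s = (1 - s) *\<^sub>R a + s *\<^sub>R b" by (simp add: segment_def algebra_simps)
  then show ?thesis using convexD[of "{0..1 :: real}" a b "1 - s" s] assms by simp
qed

text \<open>The factor \<open>1 / 2\<close> keeps every level strictly below
  \<open>cleared f b\<close>, as \<open>last_below\<close> requires.\<close>

definition level :: "(real \<Rightarrow> real) \<Rightarrow> real \<Rightarrow> real \<Rightarrow> real \<Rightarrow> real" where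
  "level f a b t = cleared f a + (cleared f b - cleared f a) * t * (1 / 2)"

definition level_point :: "(real \<Rightarrow> real) \<Rightarrow> real \<Rightarrow> real \<Rightarrow> real \<Rightarrow> real" where
  "level_point f a b t =
     segment a b (last_below (\<lambda>s. cleared f (segment a b s)) (level f a b t))"

lemma continuous_on_cleared_segment:
  assumes "only_removable_discontinuities f" "a \<in> {0..1}" "b \<in> {0..1}"
  shows "continuous_on {0..1} (\<lambda>s. cleared f (segment a b s))"
proof (rule continuous_on_compose2[OF continuous_on_cleared[OF assms(1)]])
  show "continuous_on {0..1} (segment a b)" unfolding segment_def by (intro continuous_intros)
qed (use segment_in_unit[OF assms(2,3)] in auto)

lemma level_point:
  assumes rem: "only_removable_discontinuities f" and ab: "a \<in> {0..1}" "b \<in> {0..1}"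
    and less: "cleared f a < cleared f b" and t: "t \<in> {0..1}"
  shows "level_point f a b t \<in> {0..1}" "cleared f (level_point f a b t) = level f a b t"
    and "regulated f \<Longrightarrow> level_point f a b t \<notin> disc f \<Longrightarrow> \<not> strict_local_max f (level_point f a b t)"
proof -
  define h where "h = (\<lambda>s. cleared f (segment a b s))"
  define s where "s = last_below h (level f a b t)"
  have h: "continuous_on {0..1} h" unfolding h_def by (rule continuous_on_cleared_segment[OF rem ab])
  define X where "X = (cleared f b - cleared f a) * t"
  have "X \<le> (cleared f b - cleared f a) * 1" unfolding X_def
    using less t by (intro mult_left_mono) auto
  then have 1: "X \<le> cleared f b - cleared f a" by simp
  have 2: "0 \<le> X" unfolding X_def using less t by simp
  have h01: "h 0 = cleared f a" "h 1 = cleared f b" by (simp_all add: h_def segment_def)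
  have c0: "h 0 \<le> level f a b t" unfolding h01 level_def X_def[symmetric] using 2 by linarith
  have c1: "level f a b t < h 1" unfolding h01 level_def X_def[symmetric] using 1 less by linarith
  note s = last_below[OF h c0 c1, folded s_def]
  have y: "level_point f a b t = segment a b s" unfolding level_point_def s_def h_def ..
  show y01: "level_point f a b t \<in> {0..1}"
    unfolding y using s(1,2) by (intro segment_in_unit ab) auto
  show yl: "cleared f (level_point f a b t) = level f a b t"
    using s(3) unfolding y h_def .
  assume reg: "regulated f" and nd: "level_point f a b t \<notin> disc f"
  have "\<exists>z \<in> ball (segment a b s) (1 / 2 ^ N) \<inter> {0..1}. z \<noteq> segment a b s \<and> f (segment a b s) \<le> f z" for N
  proof -
    have ne: "a \<noteq> b" using less by auto
    then have "inj (segment a b)" unfolding segment_def by (auto intro!: injI)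
    moreover have "countable (segment a b ` (segment a b -` disc f))"
      by (rule countable_subset[OF image_vimage_subset countable_is_height[OF is_height_disc[OF reg]]])
    ultimately have "countable (segment a b -` disc f)"
      using countable_image_inj_on inj_on_subset by blast
    \<comment> \<open>The parameter \<open>u\<close> comes right after \<open>s\<close> and avoids
      the countably many parameters of discontinuities, so that \<open>f\<close> agrees with
      \<open>cleared f\<close> there.\<close>
    from exists_outside_countable[OF this, of s "min 1 (s + 1 / 2 ^ N)"] s(2)
    obtain u where u: "s < u" "u < 1" "u < s + 1 / 2 ^ N" "segment a b u \<notin> disc f" by auto
    have u01: "segment a b u \<in> {0..1}" using u s(1) by (intro segment_in_unit ab) auto
    have "f (segment a b u) = h u" unfolding h_def using cleared_eq[OF rem reg u01 u(4)] .
    moreover have "f (segment a b s) = level f a b t"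
      using cleared_eq[OF rem reg y01 nd] yl unfolding y by simp
    ultimately have le: "f (segment a b s) \<le> f (segment a b u)" using s(4)[of u] u by simp
    have "segment a b s - segment a b u = (b - a) * (s - u)"
      unfolding segment_def by (simp add: algebra_simps)
    then have "\<bar>segment a b s - segment a b u\<bar> = \<bar>b - a\<bar> * \<bar>s - u\<bar>" by (simp add: abs_mult)
    \<comment> \<open>As the segment has length at most \<open>1\<close>, close parameters give
      close points.\<close>
    moreover have ba: "\<bar>b - a\<bar> \<le> 1" using ab by (auto simp: abs_le_iff)
    ultimately have "\<bar>segment a b s - segment a b u\<bar> \<le> \<bar>s - u\<bar>"
      using mult_right_mono[OF ba abs_ge_zero[of "s - u"]] by simp
    then have "segment a b u \<in> ball (segment a b s) (1 / 2 ^ N)"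
      using u by (simp add: dist_real_def)
    moreover have "segment a b u \<noteq> segment a b s" using u(1) ne unfolding segment_def by simp
    ultimately show ?thesis using u01 le by blast
  qed
  then show "\<not> strict_local_max f (level_point f a b t)"
    unfolding y strict_local_max_def by (metis not_le)
qed

text \<open>The value of \<open>cleared f\<close> at the point recovers the level, and the level
  recovers the parameter.\<close>

lemma inj_on_level_point:
  assumes "only_removable_discontinuities f" "a \<in> {0..1}" "b \<in> {0..1}" "cleared f a < cleared f b"
  shows "inj_on (level_point f a b) {0..1}"
proof (rule inj_onI)
  fix s t assume st: "s \<in> {0..1}" "t \<in> {0..1}" "level_point f a b s = level_point f a b t"
  then have "level f a b s = level f a b t"
    using level_point(2)[OF assms] by metis
  then show "s = t" using assms(4) unfolding level_def by simp
qed

text \<open>By continuity, an inequality between two values would already occur between rational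
  points; the second of these is found with the negated function.\<close>

lemma cleared_constant:
  assumes rem: "only_removable_discontinuities f"
    and const: "\<And>a b. a \<in> \<rat> \<inter> {0..1} \<Longrightarrow> b \<in> \<rat> \<inter> {0..1} \<Longrightarrow> \<not> cleared f a < cleared f b"
    and xy: "x \<in> {0..1}" "y \<in> {0..1}"
  shows "cleared f x = cleared f y"
proof -
  note h = continuous_on_cleared[OF rem]
  have "\<not> cleared f x < cleared f y" if "x \<in> {0..1}" "y \<in> {0..1}" for x y
  proof
    assume less: "cleared f x < cleared f y"
    obtain a where a: "a \<in> \<rat> \<inter> {0..1}" "cleared f a < cleared f y"
      using rational_value_below[OF h \<open>x \<in> {0..1}\<close> less, of "x - 1"] by auto
    obtain b where "b \<in> \<rat> \<inter> {0..1}" "- cleared f b < - cleared f a"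
      using rational_value_below[OF continuous_on_minus[OF h] \<open>y \<in> {0..1}\<close>, of "- cleared f a" "y - 1"] a by auto
    then show False using const[OF a(1)] by simp
  qed
  from this[OF xy] this[OF xy(2,1)] show ?thesis by simp
qed

text \<open>Off the countable set \<open>disc f\<close> the function is constant, and every ball
  around \<open>y\<close> contains further points of this kind.\<close>

lemma not_strict_local_max_of_cleared_constant:
  assumes rem: "only_removable_discontinuities f" and reg: "regulated f"
    and const: "\<And>x z. x \<in> {0..1} \<Longrightarrow> z \<in> {0..1} \<Longrightarrow> cleared f x = cleared f z"
    and y: "y \<in> {0..1}" "y \<notin> disc f"
  shows "\<not> strict_local_max f y"
proof -
  have "\<exists>z \<in> ball y (1 / 2 ^ N) \<inter> {0..1}. z \<noteq> y \<and> f y \<le> f z" for N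
  proof -
    have "countable (insert y (disc f))" using countable_is_height[OF is_height_disc[OF reg]] by simp
    moreover have "max 0 (y - 1 / 2 ^ N) < min 1 (y + 1 / 2 ^ N)"
    proof -
      have "(0 :: real) < 1 / 2 ^ N" by simp
      with y(1) show ?thesis unfolding max_less_iff_conj min_less_iff_conj atLeastAtMost_iff by linarith
    qed
    ultimately obtain z where z: "z \<in> {max 0 (y - 1 / 2 ^ N)<..<min 1 (y + 1 / 2 ^ N)}" "z \<noteq> y" "z \<notin> disc f"
      using exists_outside_countable by (metis insertI1 insertI2)
    then have "z \<in> {0..1}" by auto
    then have "f y \<le> f z"
      using cleared_eq[OF rem reg] const[of y z] y z(3) by simp
    moreover have "z \<in> ball y (1 / 2 ^ N)" using z(1) by (auto simp: dist_real_def)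
    ultimately show ?thesis using z(2) \<open>z \<in> {0..1}\<close> by blast
  qed
  then show ?thesis unfolding strict_local_max_def by (metis not_le)
qed

section \<open>Computability of real functions and sets\<close>

text \<open>Representations of functions are meaningful on the unit interval only; clamping the
  argument keeps terms total and changes nothing inside the interval.\<close>

definition clamp01 :: "real \<Rightarrow> real" where
  "clamp01 x = min 1 (max 0 x)"

lemma clamp01: "clamp01 x \<in> {0..1}" "x \<in> {0..1} \<Longrightarrow> clamp01 x = x"
  unfolding clamp01_def by auto

lemma rcomp_clamp01: "wfc C \<Longrightarrow> rcomp C r \<Longrightarrow> rcomp C (\<lambda>g. clamp01 (r g))"
  unfolding clamp01_def by (intro rcomp_min rcomp_max rcomp_one rcomp_zero)

definition has_fun :: "'g ctx \<Rightarrow> ('g \<Rightarrow> real \<Rightarrow> real) \<Rightarrow> bool" where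
  "has_fun C f \<longleftrightarrow> (\<exists>F. has C (\<lambda>g y. y = Obj (Ty11 (F g))) \<and>
     (\<forall>(a, g) \<in> C. fun_rep (F g) (f g) \<and> regulated (f g)))"

definition has_set :: "'g ctx \<Rightarrow> ('g \<Rightarrow> real set) \<Rightarrow> bool" where
  "has_set C A \<longleftrightarrow> (\<exists>\<xi>. has C (\<lambda>g y. y = Obj (Ty2 (\<xi> g))) \<and> (\<forall>(a, g) \<in> C. set_rep (\<xi> g) (A g)))"

definition has_nat_fun :: "'g ctx \<Rightarrow> ('g \<Rightarrow> real \<Rightarrow> nat) \<Rightarrow> bool" where
  "has_nat_fun C H \<longleftrightarrow> (\<exists>h. has C (\<lambda>g y. y = Obj (Ty2 (h g))) \<and> (\<forall>(a, g) \<in> C. nat_fun_rep (h g) (H g)))"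

lemma extend_iff: "(b, x) \<in> extend c C \<longleftrightarrow> (\<exists>a. b = Obj (c (snd x)) # a \<and> (a, fst x) \<in> C)"
  unfolding extend_def by (cases x) auto

lemma has_fun_extend: "has_fun C f \<Longrightarrow> has_fun (extend c C) (\<lambda>x. f (fst x))"
  unfolding has_fun_def by (elim exE conjE) (rule exI[of _ "\<lambda>x. _ (fst x)"], auto dest: has_extend simp: extend_iff)

lemma has_set_extend: "has_set C A \<Longrightarrow> has_set (extend c C) (\<lambda>x. A (fst x))"
  unfolding has_set_def by (elim exE conjE) (rule exI[of _ "\<lambda>x. _ (fst x)"], auto dest: has_extend simp: extend_iff)

lemma has_nat_fun_extend: "has_nat_fun C H \<Longrightarrow> has_nat_fun (extend c C) (\<lambda>x. H (fst x))"
  unfolding has_nat_fun_def by (elim exE conjE) (rule exI[of _ "\<lambda>x. _ (fst x)"], auto dest: has_extend simp: extend_iff)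

lemma kcomp_nat_fun:
  assumes wf: "wfc C" and H: "has_nat_fun C H" and r: "rcomp C r"
  shows "kcomp C (\<lambda>g. H g (r g))"
proof -
  obtain h where h: "has C (\<lambda>g y. y = Obj (Ty2 (h g)))" "\<And>a g. (a, g) \<in> C \<Longrightarrow> nat_fun_rep (h g) (H g)"
    using H unfolding has_nat_fun_def by blast
  have "ocomp C (\<lambda>g. Ty1 (name (r g)))"
    using nfam_name[OF wf r] unfolding nfam_def by (rule ocomp_1)
  then show ?thesis
    by (intro kcomp_call[OF wf h(1), of "[\<lambda>g. Ty1 (name (r g))]"])
       (use h(2) represents_name in \<open>auto simp: nat_fun_rep_def\<close>)
qed

lemma dec_set:
  assumes wf: "wfc C" and A: "has_set C A" and r: "rcomp C r"
  shows "dec C (\<lambda>g. r g \<in> A g)"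
proof -
  have "has_nat_fun C (\<lambda>g x. if x \<in> A g then 1 else 0)"
    using A unfolding has_set_def has_nat_fun_def set_rep_def .
  from kcomp_nat_fun[OF wf this r] show ?thesis unfolding dec_def .
qed

text \<open>The input is called on the canonical name of the argument; any other name would lead to
  the same real.\<close>

lemma rcomp_fun:
  assumes wf: "wfc C" and f: "has_fun C f" and r: "rcomp C r"
  shows "rcomp C (\<lambda>g. f g (clamp01 (r g)))"
proof -
  obtain F where F: "has C (\<lambda>g y. y = Obj (Ty11 (F g)))" "\<And>a g. (a, g) \<in> C \<Longrightarrow> fun_rep (F g) (f g)"
    using f unfolding has_fun_def by blast
  let ?u = "\<lambda>g. name (clamp01 (r g))"
  have "rcomp (ext0 C) (\<lambda>x. clamp01 (r (fst x)))" by (intro rcomp_clamp01 rcomp_extend wfc_extend wf r)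
  then have "ocomp (ext0 C) (\<lambda>x. Ty1 (?u (fst x)))"
    using nfam_name[OF wfc_extend[OF wf]] unfolding nfam_def by (intro ocomp_1) auto
  then have "kcomp (ext0 C) (\<lambda>x. F (fst x) (?u (fst x)) (snd x))"
    by (intro kcomp_call[OF wfc_extend[OF wf] has_extend[OF F(1)],
          of "[\<lambda>x. Ty1 (?u (fst x)), \<lambda>x. Ty0 (snd x)]"])
       (auto intro: ocomp_0 kcomp_var)
  then have "nfam C (\<lambda>g. F g (?u g))" unfolding nfam_def .
  then show ?thesis
    by (rule rcomp_represents[OF wf]) (use F(2) represents_name clamp01(1) in \<open>auto simp: fun_rep_def\<close>)
qed

lemma regulated_of_has_fun: "has_fun C f \<Longrightarrow> (a, g) \<in> C \<Longrightarrow> regulated (f g)"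
  unfolding has_fun_def by blast

lemmas rcomp_intros = rcomp_zero rcomp_one rcomp_numeral rcomp_ratq rcomp_inverse_power rcomp_if
  rcomp_add rcomp_diff rcomp_mult rcomp_abs rcomp_max rcomp_min rcomp_clamp01 rcomp_neg
  dec_rless dec_rle dec_req rcomp_extend

section \<open>One-sided limits, jumps and derived notions as computable terms\<close>

lemma rcomp_lval:
  assumes wf: "wfc C" and f: "has_fun C f" and r: "rcomp C r"
  shows "rcomp C (\<lambda>g. lval (f g) (clamp01 (r g)))"
proof (rule rcomp_lim[OF wf])
  let ?c = "\<lambda>g. clamp01 (r g)"
  show "rfam C (\<lambda>g n. f g (clamp01 (?c g - ?c g * (1 / 2 ^ Suc n))))"
    unfolding rfam_def
    by (intro rcomp_fun[OF wfc_extend[OF wf] has_fun_extend[OF f]] rcomp_intros kcomp_intros wf r)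
  fix a g assume "(a, g) \<in> C"
  then have reg: "regulated (f g)" by (rule regulated_of_has_fun[OF f])
  have "clamp01 (?c g - ?c g * (1 / 2 ^ Suc n)) = ?c g - ?c g * (1 / 2 ^ Suc n)" for n
    using lval_point[OF clamp01(1)[of "r g"], of n] clamp01(1)[of "r g"]
    by (intro clamp01(2)) (simp del: power_Suc)
  with lval_tendsto[OF reg clamp01(1)]
  show "(\<lambda>n. f g (clamp01 (?c g - ?c g * (1 / 2 ^ Suc n)))) \<longlonglongrightarrow> lval (f g) (?c g)"
    by (simp del: power_Suc)
qed

lemma rcomp_rval:
  assumes wf: "wfc C" and f: "has_fun C f" and r: "rcomp C r"
  shows "rcomp C (\<lambda>g. rval (f g) (clamp01 (r g)))"
proof (rule rcomp_lim[OF wf])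
  let ?c = "\<lambda>g. clamp01 (r g)"
  show "rfam C (\<lambda>g n. f g (clamp01 (?c g + (1 - ?c g) * (1 / 2 ^ Suc n))))"
    unfolding rfam_def
    by (intro rcomp_fun[OF wfc_extend[OF wf] has_fun_extend[OF f]] rcomp_intros kcomp_intros wf r)
  fix a g assume "(a, g) \<in> C"
  then have reg: "regulated (f g)" by (rule regulated_of_has_fun[OF f])
  have "clamp01 (?c g + (1 - ?c g) * (1 / 2 ^ Suc n)) = ?c g + (1 - ?c g) * (1 / 2 ^ Suc n)" for n
    using rval_point[OF clamp01(1)[of "r g"], of n] clamp01(1)[of "r g"]
    by (intro clamp01(2)) (simp del: power_Suc)
  with rval_tendsto[OF reg clamp01(1)]
  show "(\<lambda>n. f g (clamp01 (?c g + (1 - ?c g) * (1 / 2 ^ Suc n)))) \<longlonglongrightarrow> rval (f g) (?c g)"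
    by (simp del: power_Suc)
qed

lemma rcomp_jump:
  assumes "wfc C" "has_fun C f" "rcomp C r"
  shows "rcomp C (\<lambda>g. jump (f g) (clamp01 (r g)))"
  unfolding jump_def
  by (intro rcomp_max rcomp_abs rcomp_diff rcomp_fun[OF assms] rcomp_lval[OF assms] rcomp_rval[OF assms] assms(1))

lemma rcomp_cleared:
  "wfc C \<Longrightarrow> has_fun C f \<Longrightarrow> rcomp C r \<Longrightarrow> rcomp C (\<lambda>g. cleared (f g) (clamp01 (r g)))"
  unfolding cleared_def
  by (intro rcomp_lval rcomp_rval rcomp_if rcomp_inverse_power[of _ "\<lambda>_. 1", simplified] kcomp_const
        dec_rle rcomp_clamp01)

lemma dec_unit_interval: "wfc C \<Longrightarrow> rcomp C r \<Longrightarrow> dec C (\<lambda>g. r g \<in> {0..1})"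
  unfolding atLeastAtMost_iff by (intro dec_conj dec_rle rcomp_zero rcomp_one)

lemma dec_disc:
  assumes wf: "wfc C" and f: "has_fun C f" and r: "rcomp C r"
  shows "dec C (\<lambda>g. r g \<in> disc (f g))"
proof -
  have "dec C (\<lambda>g. r g \<in> {0..1} \<and> 0 < jump (f g) (clamp01 (r g)))"
    by (intro dec_conj dec_unit_interval dec_rless rcomp_zero rcomp_jump wf f r)
  then show ?thesis by (rule dec_cong) (auto simp: disc_def clamp01(2))
qed

lemma kcomp_jump_height:
  assumes wf: "wfc C" and f: "has_fun C f" and r: "rcomp C r"
  shows "kcomp C (\<lambda>g. jump_height (f g) (clamp01 (r g)))"
  unfolding jump_height_def
  by (intro kcomp_Least kcomp_intros rcomp_intros jump_height
      rcomp_jump[OF wfc_extend[OF wf] has_fun_extend[OF f]] wf r)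

lemma dec_Rats: "wfc C \<Longrightarrow> rcomp C r \<Longrightarrow> dec C (\<lambda>g. r g \<in> \<rat>)"
proof -
  assume a: "wfc C" "rcomp C r"
  have "dec C (\<lambda>g. \<exists>i. ratq i = r g)" by (intro kcomp_intros rcomp_intros a)
  moreover have "(\<exists>i. ratq i = x) \<longleftrightarrow> x \<in> \<rat>" for x
    using ratq_surj ratq_Rats by metis
  ultimately show ?thesis by simp
qed

lemma rcomp_coding_fun:
  assumes wf: "wfc C" and A: "dec C (\<lambda>g. r g \<in> A g)" and H: "kcomp C (\<lambda>g. H g (r g))"
  shows "rcomp C (\<lambda>g. coding_fun (H g) (A g) (r g))"
  unfolding coding_fun_def by (intro rcomp_intros kcomp_intros A H wf)

text \<open>Through the junk value of \<open>lim_of\<close> these objects are total, as S8 demands.\<close>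

definition fun_obj :: "(real \<Rightarrow> real) \<Rightarrow> obj" where
  "fun_obj f = Ty11 (\<lambda>u. name (f (lim_of u)))"

definition nat_fun_obj :: "(real \<Rightarrow> nat) \<Rightarrow> obj" where
  "nat_fun_obj H = Ty2 (\<lambda>u. H (lim_of u))"

definition set_obj :: "real set \<Rightarrow> obj" where
  "set_obj A = nat_fun_obj (\<lambda>x. if x \<in> A then 1 else 0)"

lemma fun_rep_name: "fun_rep (\<lambda>u. name (f (lim_of u))) f"
  unfolding fun_rep_def using represents_name lim_of_eq by auto

lemma nat_fun_rep_lim_of: "nat_fun_rep (\<lambda>u. H (lim_of u)) H"
  unfolding nat_fun_rep_def using lim_of_eq by auto

lemma ocomp_fun_obj:
  assumes wf: "wfc C" and f: "rcomp (ext1 C) (\<lambda>x. f (fst x) (lim_of (snd x)))"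
  shows "ocomp C (\<lambda>g. fun_obj (f g))"
  unfolding fun_obj_def
  using nfam_name[OF wfc_extend[OF wf] f] unfolding nfam_def by (rule ocomp_11[OF wf])

lemma ocomp_nat_fun_obj:
  "kcomp (ext1 C) (\<lambda>x. H (fst x) (lim_of (snd x))) \<Longrightarrow> ocomp C (\<lambda>g. nat_fun_obj (H g))"
  unfolding nat_fun_obj_def by (rule ocomp_2)

lemma ocomp_set_obj:
  "dec (ext1 C) (\<lambda>x. lim_of (snd x) \<in> A (fst x)) \<Longrightarrow> ocomp C (\<lambda>g. set_obj (A g))"
  unfolding set_obj_def dec_def by (rule ocomp_nat_fun_obj)

lemma ocomp_extend:
  assumes wf: "wfc C" and "ocomp C t"
  shows "ocomp (extend c C) (\<lambda>x. t (fst x))"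
proof -
  obtain d where d: "\<forall>(a, g) \<in> C. kabs d a (t g)" using assms(2) unfolding ocomp_def by blast
  obtain L where L: "\<forall>(a, g) \<in> C. length a = L" using wfc_length[OF wf] by blast
  have "distinct (map Suc [0..<L])" "set (map Suc [0..<L]) \<subseteq> {..<Suc L}" by (auto simp: distinct_map)
  from kabs_reindex[OF this] obtain d' where d': "\<And>a x. length a = Suc L \<Longrightarrow>
      kabs d (map ((!) a) (map Suc [0..<L])) x \<Longrightarrow> kabs d' a x" by blast
  have m: "map ((!) (x # a)) (map Suc [0..<length a]) = a" for x :: arg and a
    by (simp add: o_def map_nth)
  have "kabs d' (Obj (c v) # a) (t g)" if ag: "(a, g) \<in> C" for a g v
  proof (rule d')
    have "length a = L" using L ag by auto
    then show "kabs d (map ((!) (Obj (c v) # a)) (map Suc [0..<L])) (t g)"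
      using d ag m[of "Obj (c v)" a] by auto
  qed (use L ag in auto)
  then have "\<forall>(a, x) \<in> extend c C. kabs d' a (t (fst x))" unfolding extend_def by auto
  then show ?thesis unfolding ocomp_def by blast
qed

text \<open>A specification fixes a property of the output and not its value, so the output is
  chosen for each \<open>g\<close>. Its name is obtained by calls with the place in the sequence as
  last argument.\<close>

lemma rcomp_call:
  assumes wf: "wfc C" and \<Phi>: "has C (\<lambda>g y. y = Fnl (\<Phi> g))"
    and os: "\<And>o'. o' \<in> set os \<Longrightarrow> ocomp C o'"
    and out: "\<And>a g. (a, g) \<in> C \<Longrightarrow> \<exists>r. outputs (\<Phi> g) (map (\<lambda>o'. o' g) os) r \<and> R g r"
  obtains y where "rcomp C y" "\<And>a g. (a, g) \<in> C \<Longrightarrow> R g (y g)"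
proof -
  have "\<forall>g \<in> snd ` C. \<exists>r y. (\<forall>n. \<Phi> g (map (\<lambda>o'. o' g) os @ [Ty0 n]) = Some (y n)) \<and> represents y r \<and> R g r"
    using out unfolding outputs_def by fastforce
  then obtain r y where ry: "\<And>g. g \<in> snd ` C \<Longrightarrow>
      (\<forall>n. \<Phi> g (map (\<lambda>o'. o' g) os @ [Ty0 n]) = Some (y g n)) \<and> represents (y g) (r g) \<and> R g (r g)"
    by metis
  have "kcomp (ext0 C) (\<lambda>x. y (fst x) (snd x))"
  proof (rule kcomp_call[OF wfc_extend[OF wf] has_extend[OF \<Phi>],
        of "map (\<lambda>o' x. o' (fst x)) os @ [\<lambda>x. Ty0 (snd x)]"])
    show "ocomp (ext0 C) o'" if "o' \<in> set (map (\<lambda>o' x. o' (fst x)) os @ [\<lambda>x. Ty0 (snd x)])" for o'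
      using that by (auto intro!: ocomp_extend[OF wf] os ocomp_0 kcomp_var)
    show "app (Fnl (\<Phi> (fst x))) (map (\<lambda>o'. o' x) (map (\<lambda>o' x. o' (fst x)) os @ [\<lambda>x. Ty0 (snd x)])) =
        Some (y (fst x) (snd x))" if "(a, x) \<in> ext0 C" for a x
    proof -
      have "fst x \<in> snd ` C" using that unfolding extend_iff by force
      from ry[OF this] show ?thesis by (simp add: o_def)
    qed
  qed
  then have "nfam C y" unfolding nfam_def .
  then have "rcomp C r"
    by (rule rcomp_represents[OF wf]) (use ry in force)
  then show thesis
    by (rule that) (use ry in force)
qed

section \<open>Avoiding weakly countable sets\<close>

text \<open>Membership and height are required at every sequence, through \<open>lim_of\<close>, so
  that both can be handed to a functional as total objects.\<close>

definition weakly_countable_in :: "'g ctx \<Rightarrow> ('g \<Rightarrow> real set) \<Rightarrow> bool" where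
  "weakly_countable_in C A \<longleftrightarrow> (\<exists>H. dec (ext1 C) (\<lambda>x. lim_of (snd x) \<in> A (fst x)) \<and>
     kcomp (ext1 C) (\<lambda>x. H (fst x) (lim_of (snd x))) \<and>
     (\<forall>(a, g) \<in> C. A g \<subseteq> {0..1} \<and> is_height (H g) (A g)))"

lemma weakly_countable_inI:
  assumes "dec (ext1 C) (\<lambda>x. lim_of (snd x) \<in> A (fst x))"
    "kcomp (ext1 C) (\<lambda>x. H (fst x) (lim_of (snd x)))"
    "\<And>a g. (a, g) \<in> C \<Longrightarrow> A g \<subseteq> {0..1} \<and> is_height (H g) (A g)"
  shows "weakly_countable_in C A"
  unfolding weakly_countable_in_def using assms by blast

lemma weakly_countable_inE:
  assumes "weakly_countable_in C A"
  obtains H where "dec (ext1 C) (\<lambda>x. lim_of (snd x) \<in> A (fst x))"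
    "kcomp (ext1 C) (\<lambda>x. H (fst x) (lim_of (snd x)))"
    "\<And>a g. (a, g) \<in> C \<Longrightarrow> A g \<subseteq> {0..1} \<and> is_height (H g) (A g)"
proof -
  obtain H where H: "dec (ext1 C) (\<lambda>x. lim_of (snd x) \<in> A (fst x))"
    "kcomp (ext1 C) (\<lambda>x. H (fst x) (lim_of (snd x)))"
    "\<forall>(a, g) \<in> C. A g \<subseteq> {0..1} \<and> is_height (H g) (A g)"
    using assms unfolding weakly_countable_in_def by (elim exE conjE)
  have "A g \<subseteq> {0..1} \<and> is_height (H g) (A g)" if "(a, g) \<in> C" for a g
    using bspec[OF H(3) that] by simp
  with H(1,2) show thesis by (rule that)
qed

lemma is_height_Un:
  assumes "is_height H A" "is_height K B"
  shows "is_height (\<lambda>x. if x \<in> A then H x else K x) (A \<union> B)"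
  unfolding is_height_def
proof
  fix n
  have "{x \<in> A \<union> B. (if x \<in> A then H x else K x) < n} \<subseteq> {x \<in> A. H x < n} \<union> {x \<in> B. K x < n}"
    by auto
  then show "finite {x \<in> A \<union> B. (if x \<in> A then H x else K x) < n}"
    using assms unfolding is_height_def by (meson finite_UnI finite_subset)
qed

lemma is_height_subset: "is_height H A \<Longrightarrow> B \<subseteq> A \<Longrightarrow> is_height H B"
  unfolding is_height_def
proof
  fix n
  assume "\<forall>n. finite {x \<in> A. H x < n}" "B \<subseteq> A"
  moreover from this have "{x \<in> B. H x < n} \<subseteq> {x \<in> A. H x < n}" by auto
  ultimately show "finite {x \<in> B. H x < n}" using finite_subset by blast
qed

lemma is_height_inj_on: "inj_on Y A \<Longrightarrow> is_height Y A"
  unfolding is_height_def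
proof
  fix n assume "inj_on Y A"
  then have "inj_on Y {x \<in> A. Y x < n}" by (rule inj_on_subset) auto
  then show "finite {x \<in> A. Y x < n}"
    by (rule inj_on_finite[of _ _ "{..<n}"]) auto
qed

lemma is_height_vimage:
  assumes "is_height H A" "inj_on \<phi> S"
  shows "is_height (\<lambda>x. H (\<phi> x)) {x \<in> S. \<phi> x \<in> A}"
  unfolding is_height_def
proof
  fix n
  have "inj_on \<phi> {x \<in> {x \<in> S. \<phi> x \<in> A}. H (\<phi> x) < n}"
    by (rule inj_on_subset[OF assms(2)]) auto
  then show "finite {x \<in> {x \<in> S. \<phi> x \<in> A}. H (\<phi> x) < n}"
    by (rule inj_on_finite[of _ _ "{x \<in> A. H x < n}"])
      (use assms(1) in \<open>auto simp: is_height_def\<close>)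
qed

lemma weakly_countable_in_Un:
  assumes wf: "wfc C" and "weakly_countable_in C A" "weakly_countable_in C B"
  shows "weakly_countable_in C (\<lambda>g. A g \<union> B g)"
proof -
  obtain H where H: "dec (ext1 C) (\<lambda>x. lim_of (snd x) \<in> A (fst x))"
     "kcomp (ext1 C) (\<lambda>x. H (fst x) (lim_of (snd x)))"
     "\<And>a g. (a, g) \<in> C \<Longrightarrow> A g \<subseteq> {0..1} \<and> is_height (H g) (A g)"
    by (rule weakly_countable_inE[OF assms(2)], rule that; assumption)
  obtain K where K: "dec (ext1 C) (\<lambda>x. lim_of (snd x) \<in> B (fst x))"
     "kcomp (ext1 C) (\<lambda>x. K (fst x) (lim_of (snd x)))"
     "\<And>a g. (a, g) \<in> C \<Longrightarrow> B g \<subseteq> {0..1} \<and> is_height (K g) (B g)"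
    by (rule weakly_countable_inE[OF assms(3)], rule that; assumption)
  show ?thesis
  proof (rule weakly_countable_inI)
    show "dec (ext1 C) (\<lambda>x. lim_of (snd x) \<in> A (fst x) \<union> B (fst x))"
      unfolding Un_iff by (intro dec_disj wfc_extend wf H K)
    show "kcomp (ext1 C) (\<lambda>x. if lim_of (snd x) \<in> A (fst x) then H (fst x) (lim_of (snd x))
        else K (fst x) (lim_of (snd x)))"
      by (intro kcomp_if wfc_extend wf H K)
    show "A g \<union> B g \<subseteq> {0..1} \<and> is_height (\<lambda>x. if x \<in> A g then H g x else K g x) (A g \<union> B g)"
      if "(a, g) \<in> C" for a g
      using H(3)[OF that] K(3)[OF that] is_height_Un by blast
  qed
qed

lemma weakly_countable_in_input:
  assumes wf: "wfc C" and A: "has_set C A" and H: "has_nat_fun C H"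
    and "\<And>a g. (a, g) \<in> C \<Longrightarrow> A g \<subseteq> {0..1} \<and> is_height (H g) (A g)"
  shows "weakly_countable_in C A"
proof (rule weakly_countable_inI[OF _ _ assms(4)])
  show "dec (ext1 C) (\<lambda>x. lim_of (snd x) \<in> A (fst x))"
    by (rule dec_set[OF wfc_extend[OF wf] has_set_extend[OF A] rcomp_var[OF wf]])
  show "kcomp (ext1 C) (\<lambda>x. H (fst x) (lim_of (snd x)))"
    by (rule kcomp_nat_fun[OF wfc_extend[OF wf] has_nat_fun_extend[OF H] rcomp_var[OF wf]])
qed

text \<open>To reach a point of continuity within a prescribed family \<open>\<phi> g t\<close>, it
  is the parameter \<open>t\<close> that has to avoid a weakly countable set. The identity gives
  \<open>disc (f g)\<close> itself.\<close>

lemma weakly_countable_in_disc_vimage: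
  assumes wf: "wfc C" and f: "has_fun C f"
    and \<phi>: "rcomp (ext1 C) (\<lambda>x. \<phi> (fst x) (lim_of (snd x)))"
    and inj: "\<And>a g. (a, g) \<in> C \<Longrightarrow> inj_on (\<phi> g) {0..1}"
    and unit: "\<And>a g t. (a, g) \<in> C \<Longrightarrow> t \<in> {0..1} \<Longrightarrow> \<phi> g t \<in> {0..1}"
  shows "weakly_countable_in C (\<lambda>g. {t \<in> {0..1}. \<phi> g t \<in> disc (f g)})"
proof (rule weakly_countable_inI)
  note wf1 = wfc_extend[OF wf] and f1 = has_fun_extend[OF f]
  show "dec (ext1 C) (\<lambda>x. lim_of (snd x) \<in> {t \<in> {0..1}. \<phi> (fst x) t \<in> disc (f (fst x))})"
    unfolding mem_Collect_eq
    by (intro dec_conj wf1 dec_unit_interval dec_disc[OF wf1 f1] rcomp_var \<phi> wf)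
  show "kcomp (ext1 C) (\<lambda>x. jump_height (f (fst x)) (clamp01 (\<phi> (fst x) (lim_of (snd x)))))"
    by (rule kcomp_jump_height[OF wf1 f1 \<phi>])
  fix a g assume ag: "(a, g) \<in> C"
  have "is_height (\<lambda>t. jump_height (f g) (\<phi> g t)) {t \<in> {0..1}. \<phi> g t \<in> disc (f g)}"
    by (rule is_height_vimage[OF is_height_disc[OF regulated_of_has_fun[OF f ag]] inj[OF ag]])
  moreover have "{t \<in> {t \<in> {0..1}. \<phi> g t \<in> disc (f g)}. jump_height (f g) (clamp01 (\<phi> g t)) < n} =
      {t \<in> {t \<in> {0..1}. \<phi> g t \<in> disc (f g)}. jump_height (f g) (\<phi> g t) < n}" for n
    using unit[OF ag] clamp01(2) by auto
  ultimately show "{t \<in> {0..1}. \<phi> g t \<in> disc (f g)} \<subseteq> {0..1} \<and>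
      is_height (\<lambda>t. jump_height (f g) (clamp01 (\<phi> g t))) {t \<in> {0..1}. \<phi> g t \<in> disc (f g)}"
    unfolding is_height_def by auto
qed

section \<open>The rationals as a weakly countable set\<close>

definition rat_index :: "real \<Rightarrow> nat" where
  "rat_index x = (LEAST i. x \<in> \<rat> \<longrightarrow> ratq i = x)"

lemma ex_rat_index: "\<exists>i. x \<in> \<rat> \<longrightarrow> ratq i = x"
  using ratq_surj by blast

lemma ratq_rat_index: "x \<in> \<rat> \<Longrightarrow> ratq (rat_index x) = x"
  unfolding rat_index_def using LeastI_ex[OF ex_rat_index[of x]] by blast

lemma kcomp_rat_index: "wfc C \<Longrightarrow> rcomp C r \<Longrightarrow> kcomp C (\<lambda>g. rat_index (r g))"
  unfolding rat_index_def
  by (intro kcomp_Least dec_imp dec_req dec_Rats rcomp_extend rcomp_ratq kcomp_var wfc_extend ex_rat_index)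

lemma inj_on_rat_index: "inj_on rat_index \<rat>"
  using ratq_rat_index by (metis inj_onI)

lemma weakly_countable_in_Rats: "wfc C \<Longrightarrow> weakly_countable_in C (\<lambda>g. \<rat> \<inter> {0..1})"
proof (rule weakly_countable_inI)
  assume wf: "wfc C"
  show "dec (ext1 C) (\<lambda>x. lim_of (snd x) \<in> \<rat> \<inter> {0..1})"
    unfolding Int_iff by (intro dec_conj dec_Rats dec_unit_interval rcomp_var wfc_extend wf)
  show "kcomp (ext1 C) (\<lambda>x. rat_index (lim_of (snd x)))"
    by (intro kcomp_rat_index rcomp_var wfc_extend wf)
  show "\<rat> \<inter> {0..1} \<subseteq> {0..1 :: real} \<and> is_height rat_index (\<rat> \<inter> {0..1})"
    using inj_on_subset[OF inj_on_rat_index] by (auto intro!: is_height_inj_on)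
qed

text \<open>
  Functionals cannot be composed by means of S1--S9 alone without a substitution theorem for type 3
  arguments. Therefore a property of \<open>P\<close> in arbitrary contexts replaces
  \<open>computes_mod_E2 P strong_cantor_realiser\<close>. The type of the context has to be fixed; it carries
  the arguments and all the objects that occur as inputs below.
\<close>

type_synonym inputs = "(real \<Rightarrow> real) \<times> (real \<Rightarrow> real) \<times> real set \<times> (real \<Rightarrow> nat) \<times> real"

definition has_functional :: "(functional \<Rightarrow> bool) \<Rightarrow> 'g ctx \<Rightarrow> bool" where
  "has_functional P C \<longleftrightarrow>
     (\<exists>\<Phi>. has C (\<lambda>g y. y = Fnl (\<Phi> g)) \<and> (\<forall>(a, g) \<in> C. P (\<Phi> g)))"

definition avoids :: "(functional \<Rightarrow> bool) \<Rightarrow> bool" where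
  "avoids P \<longleftrightarrow> (\<forall>(C :: (arg list \<times> inputs) ctx) A.
     wfc C \<and> has_functional P C \<and> weakly_countable_in C A \<longrightarrow>
     (\<exists>y. rcomp C y \<and> (\<forall>(a, g) \<in> C. y g \<in> {0..1} - A g)))"

lemma has_functionalE:
  assumes "has_functional P C"
  obtains \<Phi> where "has C (\<lambda>g y. y = Fnl (\<Phi> g))" "\<And>a g. (a, g) \<in> C \<Longrightarrow> P (\<Phi> g)"
proof -
  obtain \<Phi> where "has C (\<lambda>g y. y = Fnl (\<Phi> g))" "\<forall>(a, g) \<in> C. P (\<Phi> g)"
    using assms unfolding has_functional_def by (elim exE conjE)
  then show thesis using that by fast
qed

lemma set_rep_lim_of: "set_rep (\<lambda>u. if lim_of u \<in> A then 1 else 0) A"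
  unfolding set_rep_def by (rule nat_fun_rep_lim_of)

lemma avoids_strong_cantor_realiser: "avoids strong_cantor_realiser"
  unfolding avoids_def
proof (intro allI impI, elim conjE)
  fix C :: "(arg list \<times> inputs) ctx" and A
  assume wf: "wfc C" and P: "has_functional strong_cantor_realiser C" and wc: "weakly_countable_in C A"
  obtain \<Phi> where \<Phi>: "has C (\<lambda>g y. y = Fnl (\<Phi> g))"
      "\<And>a g. (a, g) \<in> C \<Longrightarrow> strong_cantor_realiser (\<Phi> g)"
    by (rule has_functionalE[OF P], rule that; assumption)
  obtain H where A: "dec (ext1 C) (\<lambda>x. lim_of (snd x) \<in> A (fst x))"
    and H: "kcomp (ext1 C) (\<lambda>x. H (fst x) (lim_of (snd x)))"
    and AH: "\<And>a g. (a, g) \<in> C \<Longrightarrow> A g \<subseteq> {0..1} \<and> is_height (H g) (A g)"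
    by (rule weakly_countable_inE[OF wc], rule that; assumption)
  show "\<exists>y. rcomp C y \<and> (\<forall>(a, g) \<in> C. y g \<in> {0..1} - A g)"
  proof (rule rcomp_call[OF wf \<Phi>(1), of "[\<lambda>g. set_obj (A g), \<lambda>g. nat_fun_obj (H g)]"
        "\<lambda>g y. y \<in> {0..1} - A g"])
    show "ocomp C o'" if "o' \<in> set [\<lambda>g. set_obj (A g), \<lambda>g. nat_fun_obj (H g)]" for o'
      using that by (auto intro: ocomp_set_obj[OF A] ocomp_nat_fun_obj[OF H])
    fix a g assume ag: "(a, g) \<in> C"
    show "\<exists>r. outputs (\<Phi> g) (map (\<lambda>o'. o' g) [\<lambda>g. set_obj (A g), \<lambda>g. nat_fun_obj (H g)]) r \<and>
        r \<in> {0..1} - A g"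
      using \<Phi>(2)[OF ag, unfolded strong_cantor_realiser_def, rule_format,
          of "A g" "\<lambda>u. if lim_of u \<in> A g then 1 else 0" "\<lambda>u. H g (lim_of u)" "H g"]
        AH[OF ag] nat_fun_rep_lim_of[of "H g"] set_rep_lim_of[of "A g"]
      by (simp add: set_obj_def nat_fun_obj_def)
  qed blast
qed

text \<open>
  Removing the rational points \<open>Z\<close> makes the dichotomies of (f) and (h) return an irrational point.
\<close>

lemma avoids_if_coding_fun:
  assumes Z: "Z = {} \<or> Z = \<rat>"
    and es: "\<And>e (C :: (arg list \<times> inputs) ctx). e \<in> set es \<Longrightarrow> wfc C \<Longrightarrow> ocomp C (\<lambda>g. e)"
    and key: "\<And>\<Phi> A H F. P \<Phi> \<Longrightarrow> A \<subseteq> {0..1} \<Longrightarrow> is_height H A \<Longrightarrow>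
       fun_rep F (coding_fun H (A - Z)) \<Longrightarrow> is_height H (A - Z) \<Longrightarrow>
       \<exists>y. outputs \<Phi> (Ty11 F # es) y \<and> y \<in> {0..1} - A"
  shows "avoids P"
  unfolding avoids_def
proof (intro allI impI, elim conjE)
  fix C :: "(arg list \<times> inputs) ctx" and A
  assume wf: "wfc C" and P: "has_functional P C" and wc: "weakly_countable_in C A"
  obtain \<Phi> where \<Phi>: "has C (\<lambda>g y. y = Fnl (\<Phi> g))"
      "\<And>a g. (a, g) \<in> C \<Longrightarrow> P (\<Phi> g)"
    by (rule has_functionalE[OF P], rule that; assumption)
  obtain H where A: "dec (ext1 C) (\<lambda>x. lim_of (snd x) \<in> A (fst x))"
    and H: "kcomp (ext1 C) (\<lambda>x. H (fst x) (lim_of (snd x)))"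
    and AH: "\<And>a g. (a, g) \<in> C \<Longrightarrow> A g \<subseteq> {0..1} \<and> is_height (H g) (A g)"
    by (rule weakly_countable_inE[OF wc], rule that; assumption)
  have "dec (ext1 C) (\<lambda>x. lim_of (snd x) \<in> Z)"
    using Z by (elim disjE) (simp_all add: dec_const dec_Rats rcomp_var wfc_extend wf)
  then have "dec (ext1 C) (\<lambda>x. lim_of (snd x) \<in> A (fst x) - Z)"
    unfolding Diff_iff by (intro dec_conj dec_not A wfc_extend wf)
  then have f: "rcomp (ext1 C) (\<lambda>x. coding_fun (H (fst x)) (A (fst x) - Z) (lim_of (snd x)))"
    by (rule rcomp_coding_fun[where A = "\<lambda>x. A (fst x) - Z" and H = "\<lambda>x. H (fst x)", OF wfc_extend[OF wf] _ H])
  let ?os = "(\<lambda>g. fun_obj (coding_fun (H g) (A g - Z))) # map (\<lambda>e g. e) es"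
  show "\<exists>y. rcomp C y \<and> (\<forall>(a, g) \<in> C. y g \<in> {0..1} - A g)"
  proof (rule rcomp_call[OF wf \<Phi>(1), of ?os "\<lambda>g y. y \<in> {0..1} - A g"])
    show "ocomp C o'" if "o' \<in> set ?os" for o'
      using that by (auto intro: ocomp_fun_obj[OF wf f] es[OF _ wf])
    fix a g assume ag: "(a, g) \<in> C"
    show "\<exists>r. outputs (\<Phi> g) (map (\<lambda>o'. o' g) ?os) r \<and> r \<in> {0..1} - A g"
      using key[OF \<Phi>(2)[OF ag] _ _ fun_rep_name, of "A g" "H g"] AH[OF ag]
        is_height_subset[of "H g" "A g" "A g - Z"]
      by (simp add: fun_obj_def o_def)
  qed blast
qed

section \<open>Points off a coded set, from each functional of the list\<close>

lemma avoids_if_coding_fun_simple: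
  assumes "\<And>\<Phi> A H F. P \<Phi> \<Longrightarrow> is_height H A \<Longrightarrow> fun_rep F (coding_fun H A) \<Longrightarrow>
       \<exists>y. outputs \<Phi> [Ty11 F] y \<and> y \<in> {0..1} - A"
  shows "avoids P"
  by (rule avoids_if_coding_fun[of "{}" "[]"]) (use assms in auto)

text \<open>The additional argument \<open>0\<close> selects the first component of the pair, which
  alone is off \<open>A\<close>.\<close>

lemma avoids_infinite_range_functional: "avoids infinite_range_functional"
proof (rule avoids_if_coding_fun[of "{}" "[Ty0 0]"])
  show "ocomp C (\<lambda>g. e)" if "e \<in> set [Ty0 0]" for e and C :: "(arg list \<times> inputs) ctx"
    using that by (simp add: ocomp_0 kcomp_const)
  fix \<Phi> A H F
  assume P: "infinite_range_functional \<Phi>" and H: "is_height H A" and "fun_rep F (coding_fun H (A - {}))"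
  then have "fun_rep F (coding_fun H A) \<and> regulated (coding_fun H A)"
    by (simp add: regulated_coding_fun)
  then obtain a b where "outputs \<Phi> [Ty11 F, Ty0 0] a" "a \<in> {0..1}"
    "infinite {x \<in> {0..1}. coding_fun H A a \<le> coding_fun H A x \<and> coding_fun H A x \<le> coding_fun H A b}"
    using P unfolding infinite_range_functional_def by blast
  then show "\<exists>y. outputs \<Phi> [Ty11 F, Ty0 0] y \<and> y \<in> {0..1} - A"
    using infinite_range_coding_fun[OF H] by blast
qed simp

lemma avoids_continuity_functional: "avoids continuity_functional"
  by (rule avoids_if_coding_fun_simple)
    (unfold continuity_functional_def, metis DiffI regulated_coding_fun cont_at_coding_fun)

lemma avoids_quasi_continuity_functional: "avoids quasi_continuity_functional"
  by (rule avoids_if_coding_fun_simple)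
    (unfold quasi_continuity_functional_def, metis DiffI regulated_coding_fun quasi_cont_at_coding_fun)

lemma avoids_lower_semicontinuity_functional: "avoids lower_semicontinuity_functional"
  by (rule avoids_if_coding_fun_simple)
    (unfold lower_semicontinuity_functional_def, metis DiffI regulated_coding_fun lower_semicont_at_coding_fun)

lemma avoids_darboux_functional: "avoids darboux_functional"
  by (rule avoids_if_coding_fun_simple)
    (unfold darboux_functional_def, metis DiffI regulated_coding_fun darboux_point_coding_fun)

lemma avoids_integral_zero_functional: "avoids integral_zero_functional"
proof (rule avoids_if_coding_fun_simple)
  fix \<Phi> A H F
  assume P: "integral_zero_functional \<Phi>" and H: "is_height H A" and F: "fun_rep F (coding_fun H A)"
  have "coding_fun H A ` {0..1} \<subseteq> {0..1}" using coding_fun_nonneg coding_fun_le_1 by auto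
  with F regulated_coding_fun[OF H] has_riemann_integral_coding_fun[OF H]
  have "\<exists>x. outputs \<Phi> [Ty11 F] x \<and> x \<in> {0..1} \<and> coding_fun H A x = 0"
    using P unfolding integral_zero_functional_def by blast
  then show "\<exists>y. outputs \<Phi> [Ty11 F] y \<and> y \<in> {0..1} - A" by (auto simp: coding_fun_eq_0_iff)
qed

lemma avoids_ftc_functional: "avoids ftc_functional"
proof (rule avoids_if_coding_fun_simple)
  fix \<Phi> A H F
  assume P: "ftc_functional \<Phi>" and H: "is_height H A" and F: "fun_rep F (coding_fun H A)"
  then obtain y where "outputs \<Phi> [Ty11 F] y" "y \<in> {0<..<1}"
    "((\<lambda>x. riemann_integral (coding_fun H A) 0 x) has_real_derivative coding_fun H A y) (at y)"
    using regulated_coding_fun[OF H] unfolding ftc_functional_def by blast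
  then show "\<exists>y. outputs \<Phi> [Ty11 F] y \<and> y \<in> {0..1} - A"
    using riemann_integral_derivative_coding_fun[OF H] by fastforce
qed

lemma avoids_non_strict_max_functional: "avoids non_strict_max_functional"
proof (rule avoids_if_coding_fun_simple)
  fix \<Phi> A H F
  assume P: "non_strict_max_functional \<Phi>" and H: "is_height H A" and F: "fun_rep F (coding_fun H A)"
  then have "\<exists>x. outputs \<Phi> [Ty11 F] x \<and> x \<in> {0..1} \<and> \<not> strict_local_max (coding_fun H A) x"
    using regulated_coding_fun[OF H] only_removable_discontinuities_coding_fun[OF H]
    unfolding non_strict_max_functional_def by blast
  then show "\<exists>y. outputs \<Phi> [Ty11 F] y \<and> y \<in> {0..1} - A"
    using strict_local_max_coding_fun[OF H] by blast
qed

lemma ocomp_fun_obj_zero: "wfc C \<Longrightarrow> ocomp C (\<lambda>g. fun_obj (\<lambda>x. 0))"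
  by (rule ocomp_fun_obj[where f = "\<lambda>g x. 0"]) (auto intro: rcomp_zero wfc_extend)

lemma cont_at_zero: "cont_at (\<lambda>x. 0 :: real) x" and regulated_zero: "regulated (\<lambda>x. 0)"
  unfolding regulated_def by (auto intro: exI[of _ 0])

text \<open>Any ball will do, so both parameters are fixed: centre \<open>0\<close> and radius
  \<open>1\<close>.\<close>

lemma avoids_density_functional: "avoids density_functional"
proof (rule avoids_if_coding_fun[of "{}" "[Ty1 (name 0), Ty0 0]"])
  show "ocomp C (\<lambda>g. e)" if "e \<in> set [Ty1 (name 0), Ty0 0]" "wfc C" for e and C :: "(arg list \<times> inputs) ctx"
    using that nfam_name[OF that(2) rcomp_zero[OF that(2)]]
    by (auto intro: ocomp_0 kcomp_const ocomp_1[where t = "\<lambda>g. name 0"] simp: nfam_def)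
  fix \<Phi> A H F
  assume P: "density_functional \<Phi>" and H: "is_height H A" and "fun_rep F (coding_fun H (A - {}))"
  then have "fun_rep F (coding_fun H A) \<and> regulated (coding_fun H A) \<and> represents (name 0) 0 \<and> (0::real) \<in> {0..1}"
    by (simp add: regulated_coding_fun represents_name)
  then obtain y where "outputs \<Phi> [Ty11 F, Ty1 (name 0), Ty0 0] y" "y \<in> {0..1}" "cont_at (coding_fun H A) y"
    using P unfolding density_functional_def by blast
  then show "\<exists>y. outputs \<Phi> [Ty11 F, Ty1 (name 0), Ty0 0] y \<and> y \<in> {0..1} - A"
    using cont_at_coding_fun[OF H] by blast
qed simp

text \<open>The coded set contains no rational, so the coding function is continuous at every
  rational and the first alternative is void; the second yields an irrational outside
  \<open>A - \<rat>\<close>.\<close>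

lemma avoids_rational_dichotomy_functional: "avoids rational_dichotomy_functional"
proof (rule avoids_if_coding_fun[of \<rat> "[]"])
  fix \<Phi> A H F
  assume P: "rational_dichotomy_functional \<Phi>" and F: "fun_rep F (coding_fun H (A - \<rat>))"
    and H: "is_height H (A - \<rat>)"
  obtain y where y: "outputs \<Phi> [Ty11 F] y"
    "(y \<in> \<rat> \<inter> {0..1} \<and> \<not> cont_at (coding_fun H (A - \<rat>)) y) \<or>
     (y \<in> {0..1} - \<rat> \<and> cont_at (coding_fun H (A - \<rat>)) y)"
    using P F regulated_coding_fun[OF H] unfolding rational_dichotomy_functional_def by blast
  then show "\<exists>y. outputs \<Phi> [Ty11 F] y \<and> y \<in> {0..1} - A"
    using cont_at_coding_fun[OF H, of y] by blast
qed simp_all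

text \<open>Against the zero function, which is continuous everywhere, only joint continuity
  remains.\<close>

lemma avoids_common_point_functional: "avoids common_point_functional"
proof (rule avoids_if_coding_fun[of "{}" "[fun_obj (\<lambda>x. 0)]"])
  show "ocomp C (\<lambda>g. e)" if "e \<in> set [fun_obj (\<lambda>x. 0)]" "wfc C" for e and C :: "(arg list \<times> inputs) ctx"
    using that ocomp_fun_obj_zero by auto
  fix \<Phi> A H F
  let ?Z = "\<lambda>u. name ((\<lambda>x. 0) (lim_of u))"
  assume P: "common_point_functional \<Phi>" and H: "is_height H A" and "fun_rep F (coding_fun H (A - {}))"
  then have "fun_rep F (coding_fun H A) \<and> regulated (coding_fun H A) \<and> fun_rep ?Z (\<lambda>x. 0) \<and> regulated (\<lambda>x. 0)"
    using regulated_zero fun_rep_name[of "\<lambda>x. 0"] by (simp add: regulated_coding_fun)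
  then obtain y where "outputs \<Phi> [Ty11 F, Ty11 ?Z] y" "y \<in> {0..1}" "cont_at (coding_fun H A) y"
    using P cont_at_zero unfolding common_point_functional_def by blast
  then show "\<exists>y. outputs \<Phi> [Ty11 F, fun_obj (\<lambda>x. 0)] y \<and> y \<in> {0..1} - A"
    using cont_at_coding_fun[OF H] unfolding fun_obj_def by blast
qed simp

section \<open>A computable bijection from the rationals of the unit interval to the numbers\<close>

definition first_index :: "nat \<Rightarrow> bool" where
  "first_index i \<longleftrightarrow> ratq i \<in> {0..1} \<and> (\<forall>j. j < i \<longrightarrow> ratq j \<noteq> ratq i)"

text \<open>Removes the gaps in the range of \<open>rat_index\<close>, since strong countability
  demands that every number be a value.\<close>

definition rat_rank :: "real \<Rightarrow> nat" where
  "rat_rank x = rec_nat 0 (\<lambda>m k. if first_index m then Suc k else k) (rat_index x)"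

lemma rec_nat_count:
  "rec_nat 0 (\<lambda>m k. if P m then Suc k else k) n = card {m. m < n \<and> P m}"
proof (induction n)
  case (Suc n)
  have "{m. m < Suc n \<and> P m} = (if P n then insert n {m. m < n \<and> P m} else {m. m < n \<and> P m})"
    by (auto simp: less_Suc_eq)
  then show ?case using Suc by simp
qed simp

lemma first_index_rat_index:
  assumes "x \<in> \<rat> \<inter> {0..1}"
  shows "first_index (rat_index x)"
proof -
  have x: "ratq (rat_index x) = x" using assms ratq_rat_index by blast
  have "ratq j \<noteq> x" if "j < rat_index x" for j
    using not_less_Least[OF that[unfolded rat_index_def]] by blast
  then show ?thesis unfolding first_index_def using x assms by auto
qed

lemma rat_index_ratq: "first_index i \<Longrightarrow> rat_index (ratq i) = i"
  unfolding rat_index_def first_index_def using ratq_Rats[of i]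
  by (intro Least_equality) (auto simp: not_less[symmetric])

lemma card_less_strict_mono:
  assumes "P i" "i < (j :: nat)"
  shows "card {m. m < i \<and> P m} < card {m. m < j \<and> P m}"
  using assms by (intro psubset_card_mono) auto

lemma strongly_countable_by_rat_rank: "strongly_countable_by rat_rank (\<rat> \<inter> {0..1})"
  unfolding strongly_countable_by_def
proof
  let ?c = "\<lambda>n. card {m. m < n \<and> first_index m}"
  show "inj_on rat_rank (\<rat> \<inter> {0..1})"
  proof (rule inj_onI)
    fix x y :: real
    assume xy: "x \<in> \<rat> \<inter> {0..1}" "y \<in> \<rat> \<inter> {0..1}" "rat_rank x = rat_rank y"
    then have "?c (rat_index x) = ?c (rat_index y)" unfolding rat_rank_def rec_nat_count by simp
    then have "rat_index x = rat_index y"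
      using card_less_strict_mono[of first_index] first_index_rat_index[OF xy(1)]
        first_index_rat_index[OF xy(2)] by (metis less_irrefl linorder_neqE_nat)
    then show "x = y" using xy ratq_rat_index by (metis IntD1)
  qed
  have "n \<in> rat_rank ` (\<rat> \<inter> {0..1})" for n
  proof -
    have "infinite (rat_index ` (\<rat> \<inter> {0..1}))"
    proof -
      have "infinite (\<rat> \<inter> {0..1 :: real})"
      proof
        assume fin: "finite (\<rat> \<inter> {0..1 :: real})"
        \<comment> \<open>A finite set is closed, whereas the rationals are dense in the open
          interval.\<close>
        have "closure (\<rat> \<inter> {0<..<1 :: real}) = closure {0<..<1}"
          using Rats_closure_real open_Int_closure_eq_empty closure_open_Int_superset[of "{0<..<1 :: real}" \<rat>]
          by (simp add: Int_commute)
        moreover have "finite (\<rat> \<inter> {0<..<1 :: real})" by (rule finite_subset[OF _ fin]) auto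
        ultimately show False using finite_imp_closed[of "\<rat> \<inter> {0<..<1 :: real}"]
          by (metis closure_closed closure_greaterThanLessThan infinite_Icc zero_less_one)
      qed
      then show ?thesis using inj_on_subset[OF inj_on_rat_index] by (simp add: finite_image_iff)
    qed
    moreover have "rat_index ` (\<rat> \<inter> {0..1}) \<subseteq> {i. first_index i}"
      using first_index_rat_index by blast
    ultimately have "infinite {i. first_index i}" using infinite_super by blast
    then obtain T where T: "finite T" "card T = Suc n" "T \<subseteq> {i. first_index i}"
      using infinite_arbitrarily_large by blast
    then have "T \<subseteq> {m. m < Suc (Max T) \<and> first_index m}" by (auto simp: less_Suc_eq_le)
    then have "Suc n \<le> ?c (Suc (Max T))" using card_mono[of "{m. m < Suc (Max T) \<and> first_index m}" T] T by simp
    then have ex: "\<exists>m. n < ?c m" by (intro exI[of _ "Suc (Max T)"]) simp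
    \<comment> \<open>The first \<open>m\<close> at which the count exceeds \<open>n\<close> is the
      successor of a first index with exactly \<open>n\<close> first indices before it.\<close>
    define m where "m = (LEAST m. n < ?c m)"
    have m: "n < ?c m" unfolding m_def by (rule LeastI_ex[OF ex])
    then obtain k where k: "m = Suc k" by (cases m) auto
    then have "?c k \<le> n" using not_less_Least[of k "\<lambda>m. n < ?c m"] m_def by simp
    moreover have "?c (Suc k) = (if first_index k then Suc (?c k) else ?c k)"
      unfolding rec_nat_count[symmetric] by simp
    ultimately have "first_index k" "?c k = n" using m k by (auto split: if_splits)
    then have "rat_rank (ratq k) = n" "ratq k \<in> \<rat> \<inter> {0..1}"
      unfolding rat_rank_def rec_nat_count using rat_index_ratq ratq_Rats by (auto simp: first_index_def)
    then show ?thesis by blast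
  qed
  then show "rat_rank ` (\<rat> \<inter> {0..1}) = UNIV" by blast
qed

lemma kcomp_rat_rank: "wfc C \<Longrightarrow> rcomp C r \<Longrightarrow> kcomp C (\<lambda>g. rat_rank (r g))"
  unfolding rat_rank_def first_index_def
  by (intro kcomp_rec kcomp_const kcomp_rat_index kcomp_if kcomp_Suc dec_conj dec_all dec_imp dec_not
      dec_unit_interval dec_req dec_less rcomp_ratq kcomp_intros)

lemma Rats_unit_dense: "{0..1} \<subseteq> closure (\<rat> \<inter> {0..1 :: real})"
proof -
  have "closure ({0<..<1 :: real} \<inter> \<rat>) = closure {0<..<1}"
    using closure_open_Int_superset[of "{0<..<1 :: real}" \<rat>] by (simp add: Rats_closure_real)
  then have "{0..1 :: real} = closure ({0<..<1} \<inter> \<rat>)" by simp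
  also have "\<dots> \<subseteq> closure (\<rat> \<inter> {0..1})" by (intro closure_mono) auto
  finally show ?thesis .
qed

lemma avoids_dense_dichotomy_functional:
  assumes W: "W rat_rank (\<rat> \<inter> {0..1})"
  shows "avoids (dense_dichotomy_functional W)"
proof (rule avoids_if_coding_fun[of \<rat> "[fun_obj (\<lambda>x. 0), set_obj (\<rat> \<inter> {0..1}), nat_fun_obj rat_rank]"])
  show "ocomp C (\<lambda>g. e)"
    if e: "e \<in> set [fun_obj (\<lambda>x. 0), set_obj (\<rat> \<inter> {0..1}), nat_fun_obj rat_rank]" and wf: "wfc C"
    for e and C :: "(arg list \<times> inputs) ctx"
  proof -
    have "ocomp C (\<lambda>g. set_obj (\<rat> \<inter> {0..1}))"
      by (rule ocomp_set_obj, unfold Int_iff)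
        (intro dec_conj dec_Rats dec_unit_interval rcomp_var wfc_extend wf)
    moreover have "ocomp C (\<lambda>g. nat_fun_obj rat_rank)"
      by (rule ocomp_nat_fun_obj[where H = "\<lambda>g. rat_rank"]) (intro kcomp_rat_rank rcomp_var wfc_extend wf)
    ultimately show ?thesis using e ocomp_fun_obj_zero[OF wf] by auto
  qed
  fix \<Phi> A H F
  let ?f = "coding_fun H (A - \<rat>)" and ?Z = "\<lambda>u. name ((\<lambda>x. 0) (lim_of u))"
    and ?\<xi> = "\<lambda>u. if lim_of u \<in> \<rat> \<inter> {0..1} then 1 else 0" and ?h = "\<lambda>u. rat_rank (lim_of u)"
  assume P: "dense_dichotomy_functional W \<Phi>" and F: "fun_rep F ?f" and H: "is_height H (A - \<rat>)"
  have "fun_rep F ?f \<and> regulated ?f \<and> fun_rep ?Z (\<lambda>x. 0) \<and> regulated (\<lambda>x. 0) \<and>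
      \<rat> \<inter> {0..1} \<subseteq> {0..1 :: real} \<and> {0..1} \<subseteq> closure (\<rat> \<inter> {0..1 :: real}) \<and>
      set_rep ?\<xi> (\<rat> \<inter> {0..1}) \<and> nat_fun_rep ?h rat_rank \<and> W rat_rank (\<rat> \<inter> {0..1})"
    using F regulated_coding_fun[OF H] fun_rep_name[of "\<lambda>x. 0"] regulated_zero Rats_unit_dense
      set_rep_lim_of nat_fun_rep_lim_of W by blast
  from P[unfolded dense_dichotomy_functional_def, rule_format, OF this]
  obtain y where "outputs \<Phi> [Ty11 F, Ty11 ?Z, Ty2 ?\<xi>, Ty2 ?h] y"
    "(y \<in> \<rat> \<inter> {0..1} \<inter> {0..1} \<and> \<not> cont_at ?f y) \<or> (y \<in> {0..1} - \<rat> \<inter> {0..1} \<and> cont_at ?f y)"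
    by blast
  then show "\<exists>y. outputs \<Phi> [Ty11 F, fun_obj (\<lambda>x. 0), set_obj (\<rat> \<inter> {0..1}), nat_fun_obj rat_rank] y \<and>
      y \<in> {0..1} - A"
    using cont_at_coding_fun[OF H, of y] unfolding fun_obj_def set_obj_def nat_fun_obj_def by blast
qed simp

section \<open>Computing from a functional that avoids weakly countable sets\<close>

fun the_Ty0 :: "arg \<Rightarrow> nat" where "the_Ty0 (Obj (Ty0 n)) = n"
fun the_Ty1 :: "arg \<Rightarrow> nat \<Rightarrow> nat" where "the_Ty1 (Obj (Ty1 u)) = u"
fun the_Ty2 :: "arg \<Rightarrow> (nat \<Rightarrow> nat) \<Rightarrow> nat" where "the_Ty2 (Obj (Ty2 h)) = h"
fun the_Ty11 :: "arg \<Rightarrow> (nat \<Rightarrow> nat) \<Rightarrow> nat \<Rightarrow> nat" where "the_Ty11 (Obj (Ty11 F)) = F"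
fun the_Fnl :: "arg \<Rightarrow> functional" where "the_Fnl (Fnl \<Phi>) = \<Phi>"

definition kleene_args :: "functional \<Rightarrow> obj list \<Rightarrow> arg list" where
  "kleene_args \<Phi> xs = Fnl \<Phi> # Obj (Ty2 E2) # map Obj xs"

text \<open>The semantic part repeats the argument list, so that terms can refer to the functional
  and to the given representations, besides the objects in \<open>s\<close>.\<close>

definition base :: "(functional \<Rightarrow> bool) \<Rightarrow> (obj list \<Rightarrow> inputs \<Rightarrow> bool) \<Rightarrow> (arg list \<times> inputs) ctx" where
  "base P In = {(a, (a, s)) | a s. \<exists>\<Phi> xs. a = kleene_args \<Phi> xs \<and> P \<Phi> \<and> In xs s}"

lemma baseE:
  assumes "(a, g) \<in> base P In"
  obtains \<Phi> xs s where "a = kleene_args \<Phi> xs" "g = (a, s)" "P \<Phi>" "In xs s"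
  using assms unfolding base_def by blast

lemma baseI: "P \<Phi> \<Longrightarrow> In xs s \<Longrightarrow> (kleene_args \<Phi> xs, (kleene_args \<Phi> xs, s)) \<in> base P In"
  unfolding base_def by blast

lemma kleene_args_nth: "k < length xs \<Longrightarrow> kleene_args \<Phi> xs ! (k + 2) = Obj (xs ! k)"
  unfolding kleene_args_def by simp

lemma wfc_base:
  assumes "\<And>xs s. In xs s \<Longrightarrow> length xs = n"
  shows "wfc (base P In)"
  unfolding wfc_def
  by (intro exI[of _ "n + 2"] exI[of _ 1]) (auto elim!: baseE dest: assms simp: kleene_args_def)

lemma has_functional_base: "has_functional P (base P In)"
proof -
  have "has (base P In) (\<lambda>g y. y = Fnl (the_Fnl (fst g ! 0)))"
    unfolding has_def by (intro exI[of _ 0]) (auto elim!: baseE simp: kleene_args_def)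
  moreover have "\<forall>(a, g) \<in> base P In. P (the_Fnl (fst g ! 0))"
    by (auto elim!: baseE simp: kleene_args_def)
  ultimately show ?thesis unfolding has_functional_def by (intro exI[of _ "\<lambda>g. the_Fnl (fst g ! 0)"] conjI)
qed

lemma has_base:
  assumes "\<And>xs s. In xs s \<Longrightarrow> k < length xs \<and> Obj (xs ! k) = c (Obj (xs ! k))"
  shows "has (base P In) (\<lambda>g y. y = c (fst g ! (k + 2)))"
  unfolding has_def
proof (intro exI[of _ "k + 2"] ballI, clarify)
  fix a b s assume "(a, (b, s)) \<in> base P In"
  then obtain \<Phi> xs where "a = kleene_args \<Phi> xs" "b = a" "In xs s" by (auto elim!: baseE)
  then show "k + 2 < length a \<and> a ! (k + 2) = c (fst (b, s) ! (k + 2))"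
    using assms[of xs s] kleene_args_nth[of k xs \<Phi>] by (simp add: kleene_args_def)
qed

lemma has_fun_base:
  assumes "\<And>xs s. In xs s \<Longrightarrow> k < length xs \<and> (\<exists>F. xs ! k = Ty11 F \<and> fun_rep F (f s) \<and> regulated (f s))"
  shows "has_fun (base P In) (\<lambda>g. f (snd g))"
  unfolding has_fun_def
proof (intro exI[of _ "\<lambda>g. the_Ty11 (fst g ! (k + 2))"] conjI)
  show "has (base P In) (\<lambda>g y. y = Obj (Ty11 (the_Ty11 (fst g ! (k + 2)))))"
    by (rule has_base) (use assms in fastforce)
  show "\<forall>(a, g) \<in> base P In. fun_rep (the_Ty11 (fst g ! (k + 2))) (f (snd g)) \<and> regulated (f (snd g))"
  proof (clarify elim!: baseE)
    fix \<Phi> xs s assume "In xs s"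
    from assms[OF this] show "fun_rep (the_Ty11 (fst (kleene_args \<Phi> xs, s) ! (k + 2))) (f (snd (kleene_args \<Phi> xs, s))) \<and>
        regulated (f (snd (kleene_args \<Phi> xs, s)))"
      using kleene_args_nth[of k xs \<Phi>] by auto
  qed
qed

lemma has_nat_fun_base:
  assumes "\<And>xs s. In xs s \<Longrightarrow> k < length xs \<and> (\<exists>h. xs ! k = Ty2 h \<and> nat_fun_rep h (H s))"
  shows "has_nat_fun (base P In) (\<lambda>g. H (snd g))"
  unfolding has_nat_fun_def
proof (intro exI[of _ "\<lambda>g. the_Ty2 (fst g ! (k + 2))"] conjI)
  show "has (base P In) (\<lambda>g y. y = Obj (Ty2 (the_Ty2 (fst g ! (k + 2)))))"
    by (rule has_base) (use assms in fastforce)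
  show "\<forall>(a, g) \<in> base P In. nat_fun_rep (the_Ty2 (fst g ! (k + 2))) (H (snd g))"
  proof (clarify elim!: baseE)
    fix \<Phi> xs s assume "In xs s"
    from assms[OF this] show "nat_fun_rep (the_Ty2 (fst (kleene_args \<Phi> xs, s) ! (k + 2))) (H (snd (kleene_args \<Phi> xs, s)))"
      using kleene_args_nth[of k xs \<Phi>] by auto
  qed
qed

lemma has_set_base:
  assumes "\<And>xs s. In xs s \<Longrightarrow> k < length xs \<and> (\<exists>\<xi>. xs ! k = Ty2 \<xi> \<and> set_rep \<xi> (A s))"
  shows "has_set (base P In) (\<lambda>g. A (snd g))"
  using has_nat_fun_base[of In k "\<lambda>s x. if x \<in> A s then 1 else 0"] assms
  unfolding has_set_def has_nat_fun_def set_rep_def by simp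

section \<open>From computable terms to indices of algorithms\<close>

lemma kleene_fun_eq:
  assumes "kleene e (kleene_args \<Phi> xs) n"
  shows "kleene_fun e \<Phi> xs = Some n"
proof -
  have "(THE n. kleene e (kleene_args \<Phi> xs) n) = n"
    using assms kleene_unique(1)[OF assms] by (rule the_equality)
  then show ?thesis
    using assms unfolding kleene_fun_def kleene_args_def Let_def by auto
qed

lemma kleene_args_append: "kleene_args \<Phi> (xs @ ys) = kleene_args \<Phi> xs @ map Obj ys"
  unfolding kleene_args_def by simp

text \<open>The place in the output sequence is the last argument of a functional but the first
  variable of a term; the selection \<open>L # [0..<L]\<close> moves it to the front.\<close>

lemma outputs_if_rcomp:
  assumes wf: "wfc (base P In)" and r: "rcomp (base P In) r"
  obtains e where "\<And>\<Phi> xs s. P \<Phi> \<Longrightarrow> In xs s \<Longrightarrow> outputs (kleene_fun e \<Phi>) xs (r (kleene_args \<Phi> xs, s))"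
proof -
  obtain c where c: "\<forall>(a, x) \<in> ext0 (base P In). kleene c a (name (r (fst x)) (snd x))"
    using nfam_name[OF wf r] unfolding nfam_def kcomp_def by blast
  obtain L where L: "\<forall>(a, g) \<in> base P In. length a = L" using wfc_length[OF wf] by blast
  have "distinct (L # [0..<L])" "set (L # [0..<L]) \<subseteq> {..<Suc L}" by auto
  from kleene_reindex[OF this] obtain e where e: "\<And>a n. length a = Suc L \<Longrightarrow>
      kleene c (map ((!) a) (L # [0..<L])) n \<Longrightarrow> kleene e a n" by blast
  have "outputs (kleene_fun e \<Phi>) xs (r (kleene_args \<Phi> xs, s))" if "P \<Phi>" "In xs s" for \<Phi> xs s
    unfolding outputs_def
  proof (intro exI conjI allI)
    let ?a = "kleene_args \<Phi> xs" and ?r = "r (kleene_args \<Phi> xs, s)"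
    show "represents (name ?r) ?r" by (rule represents_name)
    fix n
    have a: "(?a, (?a, s)) \<in> base P In" using that by (rule baseI)
    then have len: "length ?a = L" using L by fast
    have m: "map ((!) (?a @ [Obj (Ty0 n)])) (L # [0..<L]) = Obj (Ty0 n) # ?a"
      using len by (auto intro!: nth_equalityI simp: nth_append nth_Cons')
    have "(Obj (Ty0 n) # ?a, ((?a, s), n)) \<in> ext0 (base P In)" using a unfolding extend_iff by simp
    then have "kleene c (Obj (Ty0 n) # ?a) (name ?r n)" using c by fastforce
    then have "kleene e (?a @ [Obj (Ty0 n)]) (name ?r n)" using len m by (intro e) simp_all
    then show "kleene_fun e \<Phi> (xs @ [Ty0 n]) = Some (name ?r n)"
      by (intro kleene_fun_eq) (simp add: kleene_args_append)
  qed
  then show thesis by (rule that)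
qed

text \<open>For outputs that are pairs: the selector of the component comes just before the place in
  the sequence.\<close>

lemma outputs_if_rfam:
  assumes wf: "wfc (base P In)" and r: "rfam (base P In) r"
  obtains e where
    "\<And>\<Phi> xs s i. P \<Phi> \<Longrightarrow> In xs s \<Longrightarrow> outputs (kleene_fun e \<Phi>) (xs @ [Ty0 i]) (r (kleene_args \<Phi> xs, s) i)"
proof -
  have "nfam (ext0 (base P In)) (\<lambda>x. name (r (fst x) (snd x)))"
    using nfam_name[OF wfc_extend[OF wf]] r unfolding rfam_def by blast
  then obtain c where c: "\<forall>(a, x) \<in> ext0 (ext0 (base P In)).
      kleene c a (name (r (fst (fst x)) (snd (fst x))) (snd x))"
    unfolding nfam_def kcomp_def by blast
  obtain L where L: "\<forall>(a, g) \<in> base P In. length a = L" using wfc_length[OF wf] by blast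
  have "distinct (Suc L # L # [0..<L])" "set (Suc L # L # [0..<L]) \<subseteq> {..<Suc (Suc L)}" by auto
  from kleene_reindex[OF this] obtain e where e: "\<And>a n. length a = Suc (Suc L) \<Longrightarrow>
      kleene c (map ((!) a) (Suc L # L # [0..<L])) n \<Longrightarrow> kleene e a n" by blast
  have "outputs (kleene_fun e \<Phi>) (xs @ [Ty0 i]) (r (kleene_args \<Phi> xs, s) i)"
    if "P \<Phi>" "In xs s" for \<Phi> xs s i
    unfolding outputs_def
  proof (intro exI conjI allI)
    let ?a = "kleene_args \<Phi> xs" and ?r = "r (kleene_args \<Phi> xs, s) i"
    show "represents (name ?r) ?r" by (rule represents_name)
    fix n
    have a: "(?a, (?a, s)) \<in> base P In" using that by (rule baseI)
    then have len: "length ?a = L" using L by fast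
    have m: "map ((!) (?a @ [Obj (Ty0 i), Obj (Ty0 n)])) (Suc L # L # [0..<L]) = Obj (Ty0 n) # Obj (Ty0 i) # ?a"
      using len by (auto intro!: nth_equalityI simp: nth_append nth_Cons')
    have "(Obj (Ty0 n) # Obj (Ty0 i) # ?a, (((?a, s), i), n)) \<in> ext0 (ext0 (base P In))"
      using a unfolding extend_iff by simp
    then have "kleene c (Obj (Ty0 n) # Obj (Ty0 i) # ?a) (name ?r n)" using c by fastforce
    then have "kleene e (?a @ [Obj (Ty0 i), Obj (Ty0 n)]) (name ?r n)" using len m by (intro e) simp_all
    then show "kleene_fun e \<Phi> ((xs @ [Ty0 i]) @ [Ty0 n]) = Some (name ?r n)"
      by (intro kleene_fun_eq) (simp add: kleene_args_append)
  qed
  then show thesis by (rule that)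
qed

lemma computes_mono:
  "computes_mod_E2 P Q \<Longrightarrow> (\<And>\<Psi>. Q \<Psi> \<Longrightarrow> Q' \<Psi>) \<Longrightarrow> computes_mod_E2 P Q'"
  unfolding computes_mod_E2_def by blast

lemma avoiding_point:
  assumes P: "avoids P" and wf: "wfc (base P In)" and wc: "weakly_countable_in (base P In) A"
  obtains y where "rcomp (base P In) y"
    "\<And>\<Phi> xs s. P \<Phi> \<Longrightarrow> In xs s \<Longrightarrow> y (kleene_args \<Phi> xs, s) \<in> {0..1} - A (kleene_args \<Phi> xs, s)"
proof -
  have "\<exists>y. rcomp (base P In) y \<and> (\<forall>(a, g) \<in> base P In. y g \<in> {0..1} - A g)"
    using P wf wc has_functional_base unfolding avoids_def by blast
  then obtain y where y: "rcomp (base P In) y" "\<forall>(a, g) \<in> base P In. y g \<in> {0..1} - A g"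
    by (elim exE conjE)
  show thesis by (rule that[OF y(1)]) (use y(2) baseI in fast)
qed

text \<open>The set avoided consists of parameters, which \<open>\<phi>\<close> turns into outputs;
  often \<open>\<phi>\<close> leaves the parameter unchanged.\<close>

lemma avoiding_algorithm:
  assumes "avoids P" and wf: "wfc (base P In)" and "weakly_countable_in (base P In) A"
    and \<phi>: "\<And>t. rcomp (base P In) t \<Longrightarrow> rcomp (base P In) (\<lambda>g. \<phi> g (t g))"
  obtains e where "\<And>\<Phi> xs s. P \<Phi> \<Longrightarrow> In xs s \<Longrightarrow>
    \<exists>t \<in> {0..1} - A (kleene_args \<Phi> xs, s). outputs (kleene_fun e \<Phi>) xs (\<phi> (kleene_args \<Phi> xs, s) t)"
proof -
  obtain t where t: "rcomp (base P In) t"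
    "\<And>\<Phi> xs s. P \<Phi> \<Longrightarrow> In xs s \<Longrightarrow> t (kleene_args \<Phi> xs, s) \<in> {0..1} - A (kleene_args \<Phi> xs, s)"
    by (rule avoiding_point[OF assms(1-3)], rule that; assumption)
  obtain e where "\<And>\<Phi> xs s. P \<Phi> \<Longrightarrow> In xs s \<Longrightarrow>
      outputs (kleene_fun e \<Phi>) xs (\<phi> (kleene_args \<Phi> xs, s) (t (kleene_args \<Phi> xs, s)))"
    by (rule outputs_if_rcomp[OF wf \<phi>[OF t(1)]], rule that; assumption)
  with t(2) show thesis by (intro that) blast
qed

lemma weakly_countable_in_disc:
  assumes wf: "wfc C" and f: "has_fun C f"
  shows "weakly_countable_in C (\<lambda>g. disc (f g))"
proof -
  have "{t \<in> {0..1}. t \<in> disc (f g)} = disc (f g)" for g unfolding disc_def by blast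
  then show ?thesis
    using weakly_countable_in_disc_vimage[OF wf f, of "\<lambda>g t. t"] rcomp_var[OF wf] by simp
qed

section \<open>Each functional of the list, from a point off a weakly countable set\<close>

lemma computes_strong_cantor_realiser:
  assumes "avoids P"
  shows "computes_mod_E2 P strong_cantor_realiser"
proof -
  define In where "In xs s \<longleftrightarrow> (\<exists>\<xi> h. xs = [Ty2 \<xi>, Ty2 h] \<and> set_rep \<xi> (fst (snd (snd s))) \<and>
    nat_fun_rep h (fst (snd (snd (snd s)))) \<and> fst (snd (snd s)) \<subseteq> {0..1} \<and>
    is_height (fst (snd (snd (snd s)))) (fst (snd (snd s))))" for xs :: "obj list" and s :: inputs
  let ?A = "\<lambda>g. fst (snd (snd (snd g)))" and ?H = "\<lambda>g. fst (snd (snd (snd (snd g))))"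
  have wf: "wfc (base P In)" by (rule wfc_base[of _ 2]) (auto simp: In_def)
  have "has_set (base P In) ?A"
    by (rule has_set_base[of In 0 "\<lambda>s. fst (snd (snd s))"]) (auto simp: In_def)
  moreover have "has_nat_fun (base P In) ?H"
    by (rule has_nat_fun_base[of In 1 "\<lambda>s. fst (snd (snd (snd s)))"]) (auto simp: In_def)
  ultimately have "weakly_countable_in (base P In) ?A"
    by (rule weakly_countable_in_input[OF wf]) (erule baseE, unfold In_def, elim exE conjE, simp)
  from avoiding_algorithm[OF assms wf this, of "\<lambda>g t. t"] obtain e where
    e: "\<And>\<Phi> xs s. P \<Phi> \<Longrightarrow> In xs s \<Longrightarrow> \<exists>y \<in> {0..1} - fst (snd (snd s)). outputs (kleene_fun e \<Phi>) xs y"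
    by auto
  have "strong_cantor_realiser (kleene_fun e \<Phi>)" if "P \<Phi>" for \<Phi>
    unfolding strong_cantor_realiser_def
  proof (intro allI impI)
    fix \<xi> A h H assume *: "A \<subseteq> {0..1} \<and> set_rep \<xi> A \<and> nat_fun_rep h H \<and> is_height H A"
    let ?s = "(undefined, undefined, A, H, undefined) :: inputs"
    have In: "In [Ty2 \<xi>, Ty2 h] ?s" using * unfolding In_def by simp
    show "\<exists>y. outputs (kleene_fun e \<Phi>) [Ty2 \<xi>, Ty2 h] y \<and> y \<in> {0..1} - A"
      using e[OF that In] by auto
  qed
  then show ?thesis unfolding computes_mod_E2_def by blast
qed

text \<open>
  Adding the rationals to the set to be avoided serves most of the functionals at once: an irrational
  point of continuity also meets (f), and it lies in the open interval, as (j) demands.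
\<close>

definition irrational_continuity_functional :: "functional \<Rightarrow> bool" where
  "irrational_continuity_functional \<Phi> \<longleftrightarrow>
     (\<forall>F f. fun_rep F f \<and> regulated f \<longrightarrow>
        (\<exists>y. outputs \<Phi> [Ty11 F] y \<and> y \<in> {0..1} - \<rat> \<and> cont_at f y))"

lemma computes_irrational_continuity_functional:
  assumes "avoids P"
  shows "computes_mod_E2 P irrational_continuity_functional"
proof -
  define In where "In xs s \<longleftrightarrow> (\<exists>F. xs = [Ty11 F] \<and> fun_rep F (fst s) \<and> regulated (fst s))"
    for xs :: "obj list" and s :: inputs
  have wf: "wfc (base P In)" by (rule wfc_base[of _ 1]) (auto simp: In_def)
  have f: "has_fun (base P In) (\<lambda>g. fst (snd g))"
    by (rule has_fun_base[of In 0 fst]) (auto simp: In_def)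
  have "weakly_countable_in (base P In) (\<lambda>g. disc (fst (snd g)) \<union> \<rat> \<inter> {0..1})"
    by (intro weakly_countable_in_Un weakly_countable_in_disc weakly_countable_in_Rats wf f)
  from avoiding_algorithm[OF assms wf this, of "\<lambda>g t. t"] obtain e where
    e: "\<And>\<Phi> xs s. P \<Phi> \<Longrightarrow> In xs s \<Longrightarrow> \<exists>y \<in> {0..1} - (disc (fst s) \<union> \<rat> \<inter> {0..1}). outputs (kleene_fun e \<Phi>) xs y"
    by auto
  have "irrational_continuity_functional (kleene_fun e \<Phi>)" if "P \<Phi>" for \<Phi>
    unfolding irrational_continuity_functional_def
  proof (intro allI impI)
    fix F f assume *: "fun_rep F f \<and> regulated f"
    let ?s = "(f, undefined, undefined, undefined, undefined) :: inputs"
    have In: "In [Ty11 F] ?s" using * unfolding In_def by simp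
    show "\<exists>y. outputs (kleene_fun e \<Phi>) [Ty11 F] y \<and> y \<in> {0..1} - \<rat> \<and> cont_at f y"
      using e[OF that In] * by (auto simp: disc_eq)
  qed
  then show ?thesis unfolding computes_mod_E2_def by blast
qed

lemma irrational_continuity_functional_imp:
  assumes "irrational_continuity_functional \<Psi>"
  shows "continuity_functional \<Psi>" "quasi_continuity_functional \<Psi>" "lower_semicontinuity_functional \<Psi>"
    "darboux_functional \<Psi>" "rational_dichotomy_functional \<Psi>" "integral_zero_functional \<Psi>" "ftc_functional \<Psi>"
proof -
  note \<Psi> = assms[unfolded irrational_continuity_functional_def, rule_format]
  show "continuity_functional \<Psi>"
    unfolding continuity_functional_def using \<Psi> by (meson DiffD1)
  show "quasi_continuity_functional \<Psi>"
    unfolding quasi_continuity_functional_def using \<Psi> cont_at_imp_quasi_cont_at by (meson DiffD1)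
  show "lower_semicontinuity_functional \<Psi>"
    unfolding lower_semicontinuity_functional_def using \<Psi> cont_at_imp_lower_semicont_at by (meson DiffD1)
  show "darboux_functional \<Psi>"
    unfolding darboux_functional_def using \<Psi> cont_at_imp_darboux_point by (meson DiffD1)
  show "rational_dichotomy_functional \<Psi>"
    unfolding rational_dichotomy_functional_def using \<Psi> by meson
  show "integral_zero_functional \<Psi>"
    unfolding integral_zero_functional_def
    using \<Psi> cont_at_imp_zero_of_integral_zero by (meson DiffD1)
  show "ftc_functional \<Psi>"
    unfolding ftc_functional_def
  proof (intro allI impI)
    fix F f assume f: "fun_rep F f \<and> regulated f"
    from \<Psi>[OF f] obtain y where y: "outputs \<Psi> [Ty11 F] y" "y \<in> {0..1} - \<rat>" "cont_at f y" by blast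
    then have "y \<noteq> 0" "y \<noteq> 1" by auto
    then have "y \<in> {0<..<1}" using y(2) by auto
    then show "\<exists>y. outputs \<Psi> [Ty11 F] y \<and> y \<in> {0<..<1} \<and>
        ((\<lambda>x. riemann_integral f 0 x) has_real_derivative f y) (at y)"
      using y f cont_at_imp_riemann_integral_derivative by blast
  qed
qed

lemma computes_common_point_functional:
  assumes "avoids P"
  shows "computes_mod_E2 P common_point_functional"
proof -
  define In where "In xs s \<longleftrightarrow> (\<exists>F G. xs = [Ty11 F, Ty11 G] \<and> fun_rep F (fst s) \<and> regulated (fst s) \<and>
    fun_rep G (fst (snd s)) \<and> regulated (fst (snd s)))" for xs :: "obj list" and s :: inputs
  have wf: "wfc (base P In)" by (rule wfc_base[of _ 2]) (auto simp: In_def)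
  have f: "has_fun (base P In) (\<lambda>g. fst (snd g))"
    by (rule has_fun_base[of In 0 fst]) (auto simp: In_def)
  have f': "has_fun (base P In) (\<lambda>g. fst (snd (snd g)))"
    by (rule has_fun_base[of In 1 "\<lambda>s. fst (snd s)"]) (auto simp: In_def)
  have "weakly_countable_in (base P In) (\<lambda>g. disc (fst (snd g)) \<union> disc (fst (snd (snd g))))"
    by (intro weakly_countable_in_Un weakly_countable_in_disc wf f f')
  from avoiding_algorithm[OF assms wf this, of "\<lambda>g t. t"] obtain e where
    e: "\<And>\<Phi> xs s. P \<Phi> \<Longrightarrow> In xs s \<Longrightarrow> \<exists>y \<in> {0..1} - (disc (fst s) \<union> disc (fst (snd s))). outputs (kleene_fun e \<Phi>) xs y"
    by auto
  have "common_point_functional (kleene_fun e \<Phi>)" if "P \<Phi>" for \<Phi>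
    unfolding common_point_functional_def
  proof (intro allI impI)
    fix F f G g assume *: "fun_rep F f \<and> regulated f \<and> fun_rep G g \<and> regulated g"
    let ?s = "(f, g, undefined, undefined, undefined) :: inputs"
    have In: "In [Ty11 F, Ty11 G] ?s" using * unfolding In_def by simp
    show "\<exists>x. outputs (kleene_fun e \<Phi>) [Ty11 F, Ty11 G] x \<and> x \<in> {0..1} \<and>
        ((cont_at f x \<and> cont_at g x) \<or> (\<not> cont_at f x \<and> \<not> cont_at g x))"
      using e[OF that In] * by (auto simp: disc_eq)
  qed
  then show ?thesis unfolding computes_mod_E2_def by blast
qed

text \<open>A point off both \<open>D\<close> and \<open>disc f\<close> meets the second
  alternative. All three kinds of witness qualify, since an injection into the numbers is a
  height.\<close>

lemma computes_dense_dichotomy_functional: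
  assumes "avoids P" and W: "\<And>Y D. W Y D \<Longrightarrow> is_height Y D"
  shows "computes_mod_E2 P (dense_dichotomy_functional W)"
proof -
  define In where "In xs s \<longleftrightarrow> (\<exists>F G \<xi> h. xs = [Ty11 F, Ty11 G, Ty2 \<xi>, Ty2 h] \<and>
    fun_rep F (fst s) \<and> regulated (fst s) \<and> set_rep \<xi> (fst (snd (snd s))) \<and>
    nat_fun_rep h (fst (snd (snd (snd s)))) \<and> fst (snd (snd s)) \<subseteq> {0..1} \<and>
    is_height (fst (snd (snd (snd s)))) (fst (snd (snd s))))" for xs :: "obj list" and s :: inputs
  let ?A = "\<lambda>g. fst (snd (snd (snd g)))" and ?H = "\<lambda>g. fst (snd (snd (snd (snd g))))"
  have wf: "wfc (base P In)" by (rule wfc_base[of _ 4]) (auto simp: In_def)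
  have f: "has_fun (base P In) (\<lambda>g. fst (snd g))"
    by (rule has_fun_base[of In 0 fst]) (auto simp: In_def)
  have "has_set (base P In) ?A"
    by (rule has_set_base[of In 2 "\<lambda>s. fst (snd (snd s))"]) (auto simp: In_def)
  moreover have "has_nat_fun (base P In) ?H"
    by (rule has_nat_fun_base[of In 3 "\<lambda>s. fst (snd (snd (snd s)))"]) (auto simp: In_def)
  ultimately have "weakly_countable_in (base P In) ?A"
    by (rule weakly_countable_in_input[OF wf]) (erule baseE, unfold In_def, elim exE conjE, simp)
  then have "weakly_countable_in (base P In) (\<lambda>g. disc (fst (snd g)) \<union> ?A g)"
    by (intro weakly_countable_in_Un weakly_countable_in_disc wf f)
  from avoiding_algorithm[OF assms(1) wf this, of "\<lambda>g t. t"] obtain e where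
    e: "\<And>\<Phi> xs s. P \<Phi> \<Longrightarrow> In xs s \<Longrightarrow> \<exists>y \<in> {0..1} - (disc (fst s) \<union> fst (snd (snd s))). outputs (kleene_fun e \<Phi>) xs y"
    by auto
  have "dense_dichotomy_functional W (kleene_fun e \<Phi>)" if "P \<Phi>" for \<Phi>
    unfolding dense_dichotomy_functional_def
  proof (intro allI impI)
    fix F f G g \<xi> D h Y
    assume *: "fun_rep F f \<and> regulated f \<and> fun_rep G g \<and> regulated g \<and>
        D \<subseteq> {0..1} \<and> {0..1} \<subseteq> closure D \<and> set_rep \<xi> D \<and> nat_fun_rep h Y \<and> W Y D"
    let ?s = "(f, undefined, D, Y, undefined) :: inputs" and ?xs = "[Ty11 F, Ty11 G, Ty2 \<xi>, Ty2 h]"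
    have In: "In ?xs ?s" using * W unfolding In_def by simp
    show "\<exists>x. outputs (kleene_fun e \<Phi>) ?xs x \<and>
        ((x \<in> D \<inter> {0..1} \<and> \<not> cont_at f x) \<or> (x \<in> {0..1} - D \<and> cont_at f x))"
      using e[OF that In] * by (auto simp: disc_eq)
  qed
  then show ?thesis unfolding computes_mod_E2_def by blast
qed

lemma rcomp_approach:
  "wfc C \<Longrightarrow> rcomp C y \<Longrightarrow> kcomp C n \<Longrightarrow> rcomp C (\<lambda>g. approach (y g) (n g))"
  unfolding approach_def by (intro rcomp_intros kcomp_Suc)

lemma rcomp_lower_upper_point:
  assumes wf: "wfc C" and f: "has_fun C f" and y: "rcomp C y"
    and unit: "\<And>a g. (a, g) \<in> C \<Longrightarrow> y g \<in> {0..1}"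
  shows "rcomp C (\<lambda>g. lower_point (f g) (y g))" "rcomp C (\<lambda>g. upper_point (f g) (y g))"
proof -
  let ?f = "\<lambda>g x. f g (clamp01 x)"
  note f1 = rcomp_fun[OF wfc_extend[OF wf] has_fun_extend[OF f]]
  note f2 = rcomp_fun[OF wfc_extend[OF wfc_extend[OF wf]] has_fun_extend[OF has_fun_extend[OF f]]]
  have L: "dec (ext0 C) (\<lambda>x. ?f (fst x) (approach (y (fst x)) (snd x)) < ?f (fst x) (y (fst x)))"
    and U: "dec (ext0 C) (\<lambda>x. ?f (fst x) (y (fst x)) < ?f (fst x) (approach (y (fst x)) (snd x)))"
    by (intro dec_rless f1 rcomp_approach rcomp_extend kcomp_var wfc_extend wf y)+
  have L': "dec C (\<lambda>g. \<exists>n. ?f g (approach (y g) n) < ?f g (y g))"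
    and U': "dec C (\<lambda>g. \<exists>n. ?f g (y g) < ?f g (approach (y g) n))"
    by (intro dec_ex L U wf)+
  have eq: "clamp01 (approach (y g) n) = approach (y g) n" "clamp01 (y g) = y g" if "(a, g) \<in> C" for a g n
    using clamp01(2) approach_in_unit unit[OF that] by auto
  have "rcomp C (\<lambda>g. if \<exists>n. ?f g (approach (y g) n) < ?f g (y g)
     then approach (y g) (LEAST n. (\<exists>n. ?f g (approach (y g) n) < ?f g (y g)) \<longrightarrow>
       ?f g (approach (y g) n) < ?f g (y g)) else y g)"
    by (intro rcomp_if rcomp_approach kcomp_Least dec_imp dec_extend wfc_extend L L' wf y) blast
  then show "rcomp C (\<lambda>g. lower_point (f g) (y g))"
    by (rule rcomp_cong) (simp add: lower_point_def eq)
  have "rcomp C (\<lambda>g. if \<exists>n. ?f g (y g) < ?f g (approach (y g) n)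
     then approach (y g) (LEAST n. (\<exists>n. ?f g (y g) < ?f g (approach (y g) n)) \<longrightarrow>
       ?f g (y g) < ?f g (approach (y g) n)) else y g)"
    by (intro rcomp_if rcomp_approach kcomp_Least dec_imp dec_extend wfc_extend U U' wf y) blast
  then show "rcomp C (\<lambda>g. upper_point (f g) (y g))"
    by (rule rcomp_cong) (simp add: upper_point_def eq)
qed

lemma computes_infinite_range_functional:
  assumes "avoids P"
  shows "computes_mod_E2 P infinite_range_functional"
proof -
  define In where "In xs s \<longleftrightarrow> (\<exists>F. xs = [Ty11 F] \<and> fun_rep F (fst s) \<and> regulated (fst s))"
    for xs :: "obj list" and s :: inputs
  have wf: "wfc (base P In)" by (rule wfc_base[of _ 1]) (auto simp: In_def)
  have f: "has_fun (base P In) (\<lambda>g. fst (snd g))"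
    by (rule has_fun_base[of In 0 fst]) (auto simp: In_def)
  obtain y where y: "rcomp (base P In) y"
    "\<And>\<Phi> xs s. P \<Phi> \<Longrightarrow> In xs s \<Longrightarrow> y (kleene_args \<Phi> xs, s) \<in> {0..1} - disc (fst s)"
    by (rule avoiding_point[OF assms wf weakly_countable_in_disc[OF wf f]], rule that, assumption) simp
  have unit: "y g \<in> {0..1}" if "(a, g) \<in> base P In" for a g
    using that y(2) by (elim baseE) blast
  have "rfam (base P In) (\<lambda>g i. if i = 0 then lower_point (fst (snd g)) (y g) else upper_point (fst (snd g)) (y g))"
    unfolding rfam_def
    by (intro rcomp_if dec_eq kcomp_var kcomp_const wfc_extend wf
        rcomp_extend[OF wf rcomp_lower_upper_point(1)[OF wf f y(1) unit]]
        rcomp_extend[OF wf rcomp_lower_upper_point(2)[OF wf f y(1) unit]])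
  from outputs_if_rfam[OF wf this] obtain e where e: "\<And>\<Phi> xs s i. P \<Phi> \<Longrightarrow> In xs s \<Longrightarrow>
    outputs (kleene_fun e \<Phi>) (xs @ [Ty0 i])
      (if i = 0 then lower_point (fst (snd (kleene_args \<Phi> xs, s))) (y (kleene_args \<Phi> xs, s))
      else upper_point (fst (snd (kleene_args \<Phi> xs, s))) (y (kleene_args \<Phi> xs, s)))" by blast
  have "infinite_range_functional (kleene_fun e \<Phi>)" if "P \<Phi>" for \<Phi>
    unfolding infinite_range_functional_def
  proof (intro allI impI)
    fix F f assume *: "fun_rep F f \<and> regulated f"
    let ?s = "(f, undefined, undefined, undefined, undefined) :: inputs"
    let ?y = "y (kleene_args \<Phi> [Ty11 F], ?s)"
    have In: "In [Ty11 F] ?s" using * unfolding In_def by simp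
    have "?y \<in> {0..1} - disc f" using y(2)[OF that In] by simp
    then have y01: "?y \<in> {0..1}" and cont: "cont_at f ?y" using * by (auto simp: disc_eq)
    show "\<exists>a b. outputs (kleene_fun e \<Phi>) [Ty11 F, Ty0 0] a \<and> outputs (kleene_fun e \<Phi>) [Ty11 F, Ty0 1] b \<and>
        a \<in> {0..1} \<and> b \<in> {0..1} \<and> infinite {x \<in> {0..1}. f a \<le> f x \<and> f x \<le> f b}"
      using e[OF that In, of 0] e[OF that In, of 1] lower_point_in_unit[OF y01] upper_point_in_unit[OF y01]
        infinite_range_at_cont_point[OF cont y01]
      by (intro exI[of _ "lower_point f ?y"] exI[of _ "upper_point f ?y"]) simp
  qed
  then show ?thesis unfolding computes_mod_E2_def by blast
qed

text \<open>Moves away from the nearer endpoint by at most a quarter of the permitted distance, so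
  the point stays in the ball and in the unit interval for every parameter.\<close>

definition near_point :: "real \<Rightarrow> nat \<Rightarrow> real \<Rightarrow> real" where
  "near_point x k t = (if x \<le> 1 / 2 then x + t * (1 / 2 ^ (k + 2)) else x - t * (1 / 2 ^ (k + 2)))"

lemma rcomp_half: "wfc C \<Longrightarrow> rcomp C (\<lambda>g. 1 / 2)"
  using rcomp_inverse_power[of C "\<lambda>_. 1"] by (simp add: kcomp_const)

lemma rcomp_near_point:
  "wfc C \<Longrightarrow> rcomp C x \<Longrightarrow> kcomp C k \<Longrightarrow> rcomp C t \<Longrightarrow> rcomp C (\<lambda>g. near_point (x g) (k g) (t g))"
  unfolding near_point_def
  by (intro rcomp_if dec_rle rcomp_half rcomp_add rcomp_diff rcomp_mult rcomp_inverse_power kcomp_add kcomp_const)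

lemma near_point:
  assumes x: "x \<in> {0..1}" and t: "t \<in> {0..1}"
  shows "near_point x k t \<in> {0..1}" "near_point x k t \<in> ball x (1 / 2 ^ k)"
proof -
  define p where "p = 1 / (2 :: real) ^ k"
  have p: "0 < p" "p \<le> 1"
    using power_increasing[of 0 k "2 :: real"] by (auto simp: p_def)
  define s where "s = t * (1 / 2 ^ (k + 2))"
  have "s = t * (p / 4)" by (simp add: s_def p_def power_add)
  moreover have "0 \<le> t * (p / 4)" "t * (p / 4) \<le> 1 * (p / 4)"
    using t p by (auto intro!: mult_nonneg_nonneg mult_right_mono)
  ultimately have s: "0 \<le> s" "s \<le> p / 4" by simp_all
  have s4: "s \<le> 1 / 4" using s(2) p(2) by linarith
  have eq: "near_point x k t = (if x \<le> 1 / 2 then x + s else x - s)"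
    unfolding near_point_def s_def ..
  show "near_point x k t \<in> {0..1}"
  proof (cases "x \<le> 1 / 2")
    case True
    then have "0 \<le> x + s" "x + s \<le> 1" using x s(1) s4 by simp_all
    then show ?thesis unfolding eq using True by simp
  next
    case False
    then have "0 \<le> x - s" "x - s \<le> 1" using x s(1) s4 by simp_all
    then show ?thesis unfolding eq using False by simp
  qed
  show "near_point x k t \<in> ball x (1 / 2 ^ k)"
  proof -
    have "dist x (near_point x k t) = s" unfolding eq dist_real_def using s(1) by simp
    then show ?thesis using s(2) p(1) unfolding p_def[symmetric] mem_ball by linarith
  qed
qed

lemma inj_near_point: "inj_on (near_point x k) S"
  unfolding near_point_def by (rule inj_onI) (auto split: if_splits)

lemma kcomp_nat_input:
  assumes "has C (\<lambda>g y. y = Obj (Ty0 (n g)))"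
  shows "kcomp C n"
proof -
  obtain k where k: "\<forall>(a, g) \<in> C. k < length a \<and> a ! k = Obj (Ty0 (n g))"
    using assms unfolding has_def by blast
  have "kleene (list_encode [6, k, list_encode [3]]) a (n g)" if "(a, g) \<in> C" for a g
    using k that by (intro S6) (auto intro!: S3 simp del: list_encode.simps)
  then show ?thesis unfolding kcomp_def by blast
qed

lemma nfam_input:
  assumes "has C (\<lambda>g y. y = Obj (Ty1 (u g)))"
  shows "nfam C u"
  unfolding nfam_def by (rule kcomp_apply_var[OF has_extend[OF assms] kcomp_var])

lemma computes_density_functional:
  assumes "avoids P"
  shows "computes_mod_E2 P density_functional"
proof -
  let ?x = "\<lambda>s :: inputs. snd (snd (snd (snd s)))"
  define In where "In xs s \<longleftrightarrow> (\<exists>F u k. xs = [Ty11 F, Ty1 u, Ty0 k] \<and> fun_rep F (fst s) \<and> regulated (fst s) \<and>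
    represents u (?x s) \<and> ?x s \<in> {0..1})" for xs :: "obj list" and s :: inputs
  define x where "x g = ?x (snd g)" for g :: "arg list \<times> inputs"
  define k where "k g = the_Ty0 (fst g ! (2 + 2))" for g :: "arg list \<times> inputs"
  have wf: "wfc (base P In)" by (rule wfc_base[of _ 3]) (auto simp: In_def)
  have f: "has_fun (base P In) (\<lambda>g. fst (snd g))"
    by (rule has_fun_base[of In 0 fst]) (auto simp: In_def)
  have "has (base P In) (\<lambda>g y. y = Obj (Ty1 (the_Ty1 (fst g ! (1 + 2)))))"
    by (rule has_base) (auto simp: In_def)
  from rcomp_represents[OF wf nfam_input[OF this]] have x: "rcomp (base P In) x"
    by (rule meta_mp) (auto elim!: baseE simp: In_def x_def kleene_args_def)
  have "has (base P In) (\<lambda>g y. y = Obj (Ty0 (the_Ty0 (fst g ! (2 + 2)))))"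
    by (rule has_base) (auto simp: In_def)
  from kcomp_nat_input[OF this] have k: "kcomp (base P In) k" unfolding k_def .
  have x01: "x g \<in> {0..1}" if "(a, g) \<in> base P In" for a g
    using that by (auto elim!: baseE simp: In_def x_def)
  have "weakly_countable_in (base P In) (\<lambda>g. {t \<in> {0..1}. near_point (x g) (k g) t \<in> disc (fst (snd g))})"
  proof (rule weakly_countable_in_disc_vimage[OF wf f])
    show "rcomp (ext1 (base P In)) (\<lambda>z. near_point (x (fst z)) (k (fst z)) (lim_of (snd z)))"
      by (intro rcomp_near_point rcomp_extend kcomp_extend rcomp_var wfc_extend wf x k)
    show "near_point (x g) (k g) t \<in> {0..1}" if "(a, g) \<in> base P In" "t \<in> {0..1}" for a g t
      using near_point(1)[OF x01] that by blast
  qed (rule inj_near_point)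
  from avoiding_algorithm[OF assms wf this, of "\<lambda>g. near_point (x g) (k g)", OF rcomp_near_point[OF wf x k]]
  obtain e where e: "\<And>\<Phi> xs s. P \<Phi> \<Longrightarrow> In xs s \<Longrightarrow> \<exists>t \<in> {0..1} -
      {t \<in> {0..1}. near_point (x (kleene_args \<Phi> xs, s)) (k (kleene_args \<Phi> xs, s)) t \<in> disc (fst s)}.
      outputs (kleene_fun e \<Phi>) xs (near_point (x (kleene_args \<Phi> xs, s)) (k (kleene_args \<Phi> xs, s)) t)"
    by auto
  have "density_functional (kleene_fun e \<Phi>)" if P: "P \<Phi>" for \<Phi>
    unfolding density_functional_def
  proof (intro allI impI)
    fix F f u z and n :: nat
    assume *: "fun_rep F f \<and> regulated f \<and> represents u z \<and> z \<in> {0..1}"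
    let ?s = "(f, undefined, undefined, undefined, z) :: inputs" and ?xs = "[Ty11 F, Ty1 u, Ty0 n]"
    let ?g = "(kleene_args \<Phi> ?xs, ?s)"
    have In: "In ?xs ?s" using * unfolding In_def by simp
    have xk: "x ?g = z" "k ?g = n" by (simp_all add: x_def k_def kleene_args_def)
    have "\<exists>t \<in> {0..1} - {t \<in> {0..1}. near_point z n t \<in> disc f}.
        outputs (kleene_fun e \<Phi>) ?xs (near_point z n t)"
      using e[OF P In] by (simp only: xk fst_conv)
    then obtain t where t: "t \<in> {0..1}" "near_point z n t \<notin> disc f"
        "outputs (kleene_fun e \<Phi>) ?xs (near_point z n t)"
      by blast
    moreover have "near_point z n t \<in> {0..1} \<inter> ball z (1 / 2 ^ n)" using near_point t(1) * by blast
    ultimately show "\<exists>y. outputs (kleene_fun e \<Phi>) ?xs y \<and> y \<in> {0..1} \<inter> ball z (1 / 2 ^ n) \<and> cont_at f y"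
      using * by (intro exI[of _ "near_point z n t"]) (auto simp: disc_eq)
  qed
  then show ?thesis unfolding computes_mod_E2_def by blast
qed

text \<open>The only part that is not an arithmetical combination of computable reals is
  \<open>last_below\<close>; its cut is decided on rational parameters, which the continuity of the
  cleared function justifies.\<close>

lemma rcomp_level_point:
  assumes wf: "wfc C" and f: "has_fun C f" and abt: "rcomp C a" "rcomp C b" "rcomp C t"
    and rem: "\<And>x g. (x, g) \<in> C \<Longrightarrow> only_removable_discontinuities (f g)"
  shows "rcomp C (\<lambda>g. level_point (f g) (clamp01 (a g)) (clamp01 (b g)) (t g))"
proof -
  let ?a = "\<lambda>g. clamp01 (a g)" and ?b = "\<lambda>g. clamp01 (b g)"
  let ?h = "\<lambda>g s. cleared (f g) (segment (?a g) (?b g) s)"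
  have lev: "rcomp C (\<lambda>g. level (f g) (?a g) (?b g) (t g))"
    unfolding level_def
    by (intro rcomp_add rcomp_diff rcomp_mult rcomp_half rcomp_cleared[OF wf f] wf abt)
  have "rcomp C (\<lambda>g. last_below (?h g) (level (f g) (?a g) (?b g) (t g)))"
  proof -
    have D: "dec (ext0 C) (\<lambda>x. ratq (snd x) < 0 \<or> (\<exists>i. ratq i \<in> {0..1} \<and>
        cleared (f (fst x)) (clamp01 (segment (?a (fst x)) (?b (fst x)) (ratq i)))
          < level (f (fst x)) (?a (fst x)) (?b (fst x)) (t (fst x)) \<and> ratq (snd x) < ratq i))"
      unfolding segment_def
      by (intro dec_disj dec_ex dec_conj dec_unit_interval dec_rless
          rcomp_cleared[OF wfc_extend[OF wfc_extend[OF wf]] has_fun_extend[OF has_fun_extend[OF f]]]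
          rcomp_extend[OF wfc_extend[OF wf] rcomp_extend[OF wf lev]]
          rcomp_add rcomp_diff rcomp_mult rcomp_clamp01 rcomp_ratq rcomp_zero
          rcomp_extend[OF wfc_extend[OF wf] rcomp_extend[OF wf abt(1)]]
          rcomp_extend[OF wfc_extend[OF wf] rcomp_extend[OF wf abt(2)]]
          kcomp_var kcomp_var' wfc_extend wf)
    have eq: "q < 0 \<or> (\<exists>i. ratq i \<in> {0..1} \<and>
        cleared (f g) (clamp01 (segment (?a g) (?b g) (ratq i))) < c \<and> q < ratq i) \<longleftrightarrow>
        q < last_below (?h g) c" if "(x, g) \<in> C" for x g q c
    proof -
      have "q < last_below (?h g) c \<longleftrightarrow> q < 0 \<or> (\<exists>r \<in> \<rat> \<inter> {0..1}. ?h g r < c \<and> q < r)"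
        by (rule less_last_below_iff[OF continuous_on_cleared_segment[OF rem[OF that] clamp01(1) clamp01(1)]])
      also have "(\<exists>r \<in> \<rat> \<inter> {0..1}. ?h g r < c \<and> q < r) \<longleftrightarrow>
          (\<exists>i. ratq i \<in> {0..1} \<and> ?h g (ratq i) < c \<and> q < ratq i)"
        using ratq_surj ratq_Rats by (metis Int_iff)
      also have "\<dots> \<longleftrightarrow> (\<exists>i. ratq i \<in> {0..1} \<and>
          cleared (f g) (clamp01 (segment (?a g) (?b g) (ratq i))) < c \<and> q < ratq i)"
        using clamp01(2)[OF segment_in_unit[OF clamp01(1) clamp01(1)]] by metis
      finally show ?thesis by blast
    qed
    show ?thesis
      unfolding rcomp_def
    proof (rule dec_cong[OF D])
      fix x z assume "(x, z) \<in> ext0 C"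
      then obtain x' where "(x', fst z) \<in> C" unfolding extend_iff by blast
      from eq[OF this] show "(ratq (snd z) < 0 \<or> (\<exists>i. ratq i \<in> {0..1} \<and>
        cleared (f (fst z)) (clamp01 (segment (?a (fst z)) (?b (fst z)) (ratq i)))
          < level (f (fst z)) (?a (fst z)) (?b (fst z)) (t (fst z)) \<and> ratq (snd z) < ratq i)) =
        (ratq (snd z) < last_below (?h (fst z)) (level (f (fst z)) (?a (fst z)) (?b (fst z)) (t (fst z))))" .
    qed
  qed
  then show ?thesis
    unfolding level_point_def segment_def[of _ _ "last_below _ _"]
    by (intro rcomp_add rcomp_diff rcomp_mult rcomp_clamp01 wf abt)
qed

definition increase :: "(real \<Rightarrow> real) \<Rightarrow> nat \<Rightarrow> nat \<Rightarrow> bool" where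
  "increase f i j \<longleftrightarrow> ratq i \<in> {0..1} \<and> ratq j \<in> {0..1} \<and> cleared f (ratq i) < cleared f (ratq j)"

text \<open>The two rationals are searched for one after the other; the implications make both
  searches succeed also when there is no increase.\<close>

definition increase_fst :: "(real \<Rightarrow> real) \<Rightarrow> nat" where
  "increase_fst f = (LEAST i. (\<exists>i j. increase f i j) \<longrightarrow> (\<exists>j. increase f i j))"

definition increase_snd :: "(real \<Rightarrow> real) \<Rightarrow> nat" where
  "increase_snd f = (LEAST j. (\<exists>i j. increase f i j) \<longrightarrow> increase f (increase_fst f) j)"

definition candidate :: "(real \<Rightarrow> real) \<Rightarrow> real \<Rightarrow> real" where
  "candidate f t = (if \<exists>i j. increase f i j
     then level_point f (clamp01 (ratq (increase_fst f))) (clamp01 (ratq (increase_snd f))) t else t)"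

lemma ex_increase_fst: "\<exists>i. (\<exists>i j. increase f i j) \<longrightarrow> (\<exists>j. increase f i j)"
  by blast

lemma ex_increase_snd: "\<exists>j. (\<exists>i j. increase f i j) \<longrightarrow> increase f (increase_fst f) j"
  using LeastI_ex[OF ex_increase_fst[of f]] unfolding increase_fst_def[symmetric] by blast

lemma increase_fst_snd: "\<exists>i j. increase f i j \<Longrightarrow> increase f (increase_fst f) (increase_snd f)"
  using LeastI_ex[OF ex_increase_snd[of f]] unfolding increase_snd_def[symmetric] by blast

lemma dec_increase:
  assumes wf: "wfc C" and f: "has_fun C f" and ij: "kcomp C i" "kcomp C j"
  shows "dec C (\<lambda>g. increase (f g) (i g) (j g))"
proof -
  have "dec C (\<lambda>g. ratq (i g) \<in> {0..1} \<and> ratq (j g) \<in> {0..1} \<and>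
      cleared (f g) (clamp01 (ratq (i g))) < cleared (f g) (clamp01 (ratq (j g))))"
    by (intro dec_conj dec_unit_interval dec_rless rcomp_cleared[OF wf f] rcomp_ratq wf ij)
  then show ?thesis by (rule dec_cong) (auto simp: increase_def clamp01(2))
qed

lemma rcomp_candidate:
  assumes wf: "wfc C" and f: "has_fun C f" and t: "rcomp C t"
    and rem: "\<And>x g. (x, g) \<in> C \<Longrightarrow> only_removable_discontinuities (f g)"
  shows "rcomp C (\<lambda>g. candidate (f g) (t g))"
proof -
  note wf1 = wfc_extend[OF wf] and f1 = has_fun_extend[OF f]
  note wf2 = wfc_extend[OF wf1] and f2 = has_fun_extend[OF f1]
  have ex: "dec C (\<lambda>g. \<exists>i j. increase (f g) i j)"
    by (intro dec_ex dec_increase[OF wf2 f2] kcomp_var kcomp_var' wf1 wf)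
  have fst: "kcomp C (\<lambda>g. increase_fst (f g))"
    unfolding increase_fst_def
    by (rule kcomp_Least[OF wf _ ex_increase_fst])
      (intro dec_imp dec_extend[OF wf ex] dec_ex dec_increase[OF wf2 f2] kcomp_var kcomp_var' wf1 wf)
  have snd: "kcomp C (\<lambda>g. increase_snd (f g))"
    unfolding increase_snd_def
    by (rule kcomp_Least[OF wf _ ex_increase_snd])
      (intro dec_imp dec_extend[OF wf ex] dec_increase[OF wf1 f1] kcomp_extend[OF wf fst] kcomp_var wf1)
  show ?thesis
    unfolding candidate_def
    by (intro rcomp_if[OF wf ex _ t] rcomp_level_point[OF wf f _ _ t rem] rcomp_ratq wf fst snd)
qed

text \<open>Injectivity keeps the preimage of \<open>disc f\<close> weakly countable, so the
  parameter can avoid it in both cases of the definition.\<close>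

lemma candidate:
  assumes reg: "regulated f" and rem: "only_removable_discontinuities f"
  shows "inj_on (candidate f) {0..1}"
    and "t \<in> {0..1} \<Longrightarrow> candidate f t \<in> {0..1}"
    and "t \<in> {0..1} \<Longrightarrow> candidate f t \<notin> disc f \<Longrightarrow> \<not> strict_local_max f (candidate f t)"
proof -
  have "inj_on (candidate f) {0..1} \<and> (t \<in> {0..1} \<longrightarrow> candidate f t \<in> {0..1}) \<and>
    (t \<in> {0..1} \<longrightarrow> candidate f t \<notin> disc f \<longrightarrow> \<not> strict_local_max f (candidate f t))" for t
  proof (cases "\<exists>i j. increase f i j")
    case True
    let ?a = "ratq (increase_fst f)" and ?b = "ratq (increase_snd f)"
    have ab: "?a \<in> {0..1}" "?b \<in> {0..1}" "cleared f ?a < cleared f ?b"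
      using increase_fst_snd[OF True] unfolding increase_def by auto
    have "candidate f = level_point f ?a ?b"
      using True ab by (simp add: candidate_def fun_eq_iff clamp01(2))
    then show ?thesis
      using inj_on_level_point[OF rem ab] level_point(1,3)[OF rem ab] reg by auto
  next
    case False
    have "\<not> cleared f a < cleared f b" if "a \<in> \<rat> \<inter> {0..1}" "b \<in> \<rat> \<inter> {0..1}" for a b
      using that False ratq_surj unfolding increase_def by (metis Int_iff)
    then have const: "cleared f x = cleared f z" if "x \<in> {0..1}" "z \<in> {0..1}" for x z
      using cleared_constant[OF rem _ that] by blast
    have eq: "candidate f t = t" for t unfolding candidate_def by (rule if_not_P[OF False])
    have "candidate f = (\<lambda>t. t)" by (rule ext) (rule eq)
    then show ?thesis
      using not_strict_local_max_of_cleared_constant[OF rem reg const] by (simp only:) (simp add: inj_on_id2)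
  qed
  then show "inj_on (candidate f) {0..1}"
    and "t \<in> {0..1} \<Longrightarrow> candidate f t \<in> {0..1}"
    and "t \<in> {0..1} \<Longrightarrow> candidate f t \<notin> disc f \<Longrightarrow> \<not> strict_local_max f (candidate f t)"
    by blast+
qed

lemma computes_non_strict_max_functional:
  assumes "avoids P"
  shows "computes_mod_E2 P non_strict_max_functional"
proof -
  define In where "In xs s \<longleftrightarrow> (\<exists>F. xs = [Ty11 F] \<and> fun_rep F (fst s) \<and> regulated (fst s) \<and>
    only_removable_discontinuities (fst s))" for xs :: "obj list" and s :: inputs
  have wf: "wfc (base P In)" by (rule wfc_base[of _ 1]) (auto simp: In_def)
  have f: "has_fun (base P In) (\<lambda>g. fst (snd g))"
    by (rule has_fun_base[of In 0 fst]) (auto simp: In_def)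
  have g: "regulated (fst (snd g))" "only_removable_discontinuities (fst (snd g))"
    if "(a, g) \<in> base P In" for a g
    using that by (auto elim!: baseE simp: In_def)
  have wc: "weakly_countable_in (base P In) (\<lambda>g. {t \<in> {0..1}. candidate (fst (snd g)) t \<in> disc (fst (snd g))})"
  proof (rule weakly_countable_in_disc_vimage[OF wf f])
    show "rcomp (ext1 (base P In)) (\<lambda>x. candidate (fst (snd (fst x))) (lim_of (snd x)))"
      by (rule rcomp_candidate[OF wfc_extend[OF wf] has_fun_extend[OF f] rcomp_var[OF wf]])
        (auto simp: extend_iff dest: g(2))
  qed (use candidate(1,2) g in blast)+
  have \<phi>: "rcomp (base P In) (\<lambda>g. candidate (fst (snd g)) (t g))" if "rcomp (base P In) t" for t
    by (rule rcomp_candidate[OF wf f that g(2)])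
  from avoiding_algorithm[where P = P and In = In and \<phi> = "\<lambda>g. candidate (fst (snd g))", OF assms wf wc \<phi>]
  obtain e where e: "\<And>\<Phi> xs s. P \<Phi> \<Longrightarrow> In xs s \<Longrightarrow>
      \<exists>t \<in> {0..1} - {t \<in> {0..1}. candidate (fst s) t \<in> disc (fst s)}.
      outputs (kleene_fun e \<Phi>) xs (candidate (fst s) t)"
    by auto
  have "non_strict_max_functional (kleene_fun e \<Phi>)" if P: "P \<Phi>" for \<Phi>
    unfolding non_strict_max_functional_def
  proof (intro allI impI)
    fix F f assume *: "fun_rep F f \<and> regulated f \<and> only_removable_discontinuities f"
    let ?s = "(f, undefined, undefined, undefined, undefined) :: inputs"
    have In: "In [Ty11 F] ?s" using * unfolding In_def by simp
    have "\<exists>t \<in> {0..1} - {t \<in> {0..1}. candidate f t \<in> disc f}.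
        outputs (kleene_fun e \<Phi>) [Ty11 F] (candidate f t)"
      using e[OF P In] by (simp only: fst_conv)
    then obtain t where "t \<in> {0..1}" "candidate f t \<notin> disc f"
        "outputs (kleene_fun e \<Phi>) [Ty11 F] (candidate f t)"
      by blast
    then show "\<exists>x. outputs (kleene_fun e \<Phi>) [Ty11 F] x \<and> x \<in> {0..1} \<and> \<not> strict_local_max f x"
      using candidate(2,3)[of f t] * by blast
  qed
  then show ?thesis unfolding computes_mod_E2_def by blast
qed

theorem theorem2p4:
  shows "\<forall>P Q. {P, Q} \<subseteq>
     {strong_cantor_realiser,
      infinite_range_functional,
      continuity_functional,
      quasi_continuity_functional,
      lower_semicontinuity_functional,
      darboux_functional,
      density_functional,
      rational_dichotomy_functional,
      common_point_functional,
      dense_dichotomy_functional is_height,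
      dense_dichotomy_functional countable_by,
      dense_dichotomy_functional strongly_countable_by,
      integral_zero_functional,
      ftc_functional,
      non_strict_max_functional}
     \<longrightarrow> computes_mod_E2 P Q"
proof (intro allI impI)
  let ?S = "{strong_cantor_realiser, infinite_range_functional, continuity_functional,
      quasi_continuity_functional, lower_semicontinuity_functional, darboux_functional,
      density_functional, rational_dichotomy_functional, common_point_functional,
      dense_dichotomy_functional is_height, dense_dichotomy_functional countable_by,
      dense_dichotomy_functional strongly_countable_by, integral_zero_functional,
      ftc_functional, non_strict_max_functional}"
  fix P Q assume "{P, Q} \<subseteq> ?S"
  then have P: "P \<in> ?S" and Q: "Q \<in> ?S" by simp_all
  \<comment> \<open>One ranking of the rationals serves all three variants of (h).\<close>
  have rank: "countable_by rat_rank (\<rat> \<inter> {0..1})" "is_height rat_rank (\<rat> \<inter> {0..1})"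
    using strongly_countable_by_rat_rank is_height_inj_on
    unfolding strongly_countable_by_def countable_by_def by auto
  have "avoids P"
    using P avoids_strong_cantor_realiser avoids_infinite_range_functional avoids_continuity_functional
      avoids_quasi_continuity_functional avoids_lower_semicontinuity_functional avoids_darboux_functional
      avoids_density_functional avoids_rational_dichotomy_functional avoids_common_point_functional
      avoids_dense_dichotomy_functional[of is_height, OF rank(2)]
      avoids_dense_dichotomy_functional[of countable_by, OF rank(1)]
      avoids_dense_dichotomy_functional[of strongly_countable_by, OF strongly_countable_by_rat_rank]
      avoids_integral_zero_functional avoids_ftc_functional avoids_non_strict_max_functional
    by (elim insertE emptyE) simp_all
  note irr = computes_mono[OF computes_irrational_continuity_functional[OF this]]
  show "computes_mod_E2 P Q"
    using Q computes_strong_cantor_realiser[OF \<open>avoids P\<close>] computes_infinite_range_functional[OF \<open>avoids P\<close>]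
      irr[OF irrational_continuity_functional_imp(1)] irr[OF irrational_continuity_functional_imp(2)]
      irr[OF irrational_continuity_functional_imp(3)] irr[OF irrational_continuity_functional_imp(4)]
      irr[OF irrational_continuity_functional_imp(5)] irr[OF irrational_continuity_functional_imp(6)]
      irr[OF irrational_continuity_functional_imp(7)]
      computes_density_functional[OF \<open>avoids P\<close>] computes_common_point_functional[OF \<open>avoids P\<close>]
      computes_dense_dichotomy_functional[OF \<open>avoids P\<close>, of is_height]
      computes_dense_dichotomy_functional[OF \<open>avoids P\<close>, of countable_by]
      computes_dense_dichotomy_functional[OF \<open>avoids P\<close>, of strongly_countable_by]
      computes_non_strict_max_functional[OF \<open>avoids P\<close>] is_height_inj_on
    unfolding countable_by_def strongly_countable_by_def
    by (elim insertE emptyE) simp_all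
qed

end
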